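(* Let $\varphi$ be a Jacob's ladder, let $\epsilon>0$ be a fixed (arbitrarily small) number, and let $U=U(T)=T^{7/8+2\epsilon}$. Then for every sufficiently large $T$ there is a number $\alpha=\alpha(T)=\alpha(T,U,\varphi)$ with $$\alpha\in(T,T+U),\qquad \tfrac12\varphi(\alpha)\in\left(\tfrac12\varphi(T),\tfrac12\varphi(T+U)\right),$$ such that $$Z^4\left[\frac{\varphi(\alpha)}{2}\right]Z^2(\alpha)\ \sim\ \frac{1}{2\pi^2}\ln^5 T,\qquad T\to\infty .$$ Moreover, for all sufficiently large $T$, $$[T,T+U]\cap\left[\tfrac12\varphi(T),\tfrac12\varphi(T+U)\right]=\emptyset,$$ $$\rho\left\{[T,T+U];\left[\tfrac12\varphi(T),\tfrac12\varphi(T+U)\right]\right\}>(1-c-2\epsilon)\frac{T}{\ln T},$$ where the lower bound tends to $\infty$ as $T\to\infty$, and $\rho$ denotes the distance between the two segments.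
   Context: Notation. $\zeta$ is the Riemann zeta-function, and $Z(t)=e^{i\theta(t)}\zeta\left(\frac12+it\right)$ is the real-valued Hardy function, where $\theta$ is the Riemann–Siegel theta function; thus $|Z(t)|=\left|\zeta\left(\frac12+it\right)\right|$. The notation $Z^4[x]$ means $(Z(x))^4$. $c$ is Euler's constant, $\pi(t)$ is the prime-counting function, and $A(T)\sim B(T)$ means $A(T)/B(T)\to 1$. The number $\epsilon$ is small enough that $7/8+2\epsilon<1$ (so that $0<U\le T/\ln T$ for all large $T$) and $1-c-2\epsilon>0$. Jacob's ladder. $\varphi$ is a fixed real-valued, positive, increasing, continuously differentiable function, defined for all sufficiently large $t$, with the following properties: (i) $t-\frac12\varphi(t)\sim(1-c)\,\pi(t)$ as $t\to\infty$; (ii) there are a number $T_0=T_0[\varphi]$ and a positive continuous function on $[T_0,\infty)$, denoted $t\mapsto\Phi'_\varphi[\varphi(t)]$, such that for $t\ge T_0$ $$Z^2(t)=\Phi'_\varphi[\varphi(t)]\,\frac{d\varphi(t)}{dt},\qquad \Phi'_\varphi[\varphi(t)]=\frac12\left\{1+O\left(\frac{\ln\ln t}{\ln t}\right)\right\}\ln t .$$ *)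

theory Defs
  imports "HOL-Complex_Analysis.Complex_Analysis" "HOL-Library.Landau_Symbols"
begin

(* The Riemann zeta-function: the unique holomorphic function on the complex plane without 1
   that extends the Dirichlet series.  The condition f 1 = 0 only fixes an irrelevant value at
   the pole, so that the description is unique. *)
definition zeta :: "complex \<Rightarrow> complex" where
  "zeta = (THE f. f holomorphic_on (- {1}) \<and>
                  (\<forall>s. Re s > 1 \<longrightarrow> (\<lambda>n. 1 / of_nat (Suc n) powr s) sums f s) \<and>
                  f 1 = 0)"

(* ln_Gamma is the holomorphic branch of log Gamma on the plane cut along the nonpositive
   reals that is real on the positive reals, so its imaginary part is the continuous argument. *)
definition rs_theta :: "real \<Rightarrow> real" where
  "rs_theta t = Im (ln_Gamma (Complex (1/4) (t/2))) - t / 2 * ln pi"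

(* The number under Re is real by the functional equation of zeta; Re only makes
   hardy_Z real-valued as a function in HOL. *)
definition hardy_Z :: "real \<Rightarrow> real" where
  "hardy_Z t = Re (exp (\<i> * of_real (rs_theta t)) * zeta (Complex (1/2) t))"

definition prime_pi :: "real \<Rightarrow> nat" where
  "prime_pi t = card {p::nat. prime p \<and> real p \<le> t}"

(* A function that is only defined for large t is represented by a total function that is
   constrained on {T0..} only.  G t stands for Phi'_phi[phi(t)], d is the derivative of phi, and
   r is the error term of Phi'_phi[phi(t)]. *)
definition jacobs_ladder :: "(real \<Rightarrow> real) \<Rightarrow> bool" where
  "jacobs_ladder \<phi> \<longleftrightarrow>
     (\<lambda>t. t - \<phi> t / 2) \<sim>[at_top] (\<lambda>t. (1 - euler_mascheroni) * real (prime_pi t)) \<and>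
     (\<exists>T0 d G r.
        (\<forall>t\<ge>T0. \<phi> t > 0) \<and>
        strict_mono_on {T0..} \<phi> \<and>
        (\<forall>t\<ge>T0. (\<phi> has_real_derivative d t) (at t within {T0..})) \<and>
        continuous_on {T0..} d \<and>
        (\<forall>t\<ge>T0. G t > 0) \<and>
        continuous_on {T0..} G \<and>
        (\<forall>t\<ge>T0. (hardy_Z t)\<^sup>2 = G t * d t) \<and>
        (\<forall>t\<ge>T0. G t = 1/2 * (1 + r t) * ln t) \<and>
        r \<in> O[at_top](\<lambda>t. ln (ln t) / ln t))"

end

theory Submission
  imports Defs "HOL-Real_Asymp.Real_Asymp" "HOL-Number_Theory.Number_Theory"
begin

text \<open>
  Write u(t) = \<phi>(t)/2 and F(t) = Z(u(t))^4 Z(t)^2, and let L = ln T. The point \<alpha> is found by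
  the intermediate value theorem: on the interval (T, T + U) the continuous function F has a zero, and
  somewhere it is at least L^5, so it takes the value L^5 / (2 \<pi>^2) exactly and the asserted asymptotic
  relation is an eventual equality.

  The zero of F is a zero of Z (\<open>hardy_Z_has_zero\<close>). It comes from Hardy's argument:
  the mean of \<zeta>(1/2 + it) over an interval much longer than T^(3/4) is close to 1, hence the mean of |Z| is not
  small, whereas the factor exp(i \<theta>(t)) makes every term of the Dirichlet polynomial oscillate, so the mean
  of Z itself is small. Thus Z cannot keep one sign.

  The large value of F comes from a contradiction (\<open>product_large_somewhere\<close>). The ladder satisfies
  u' = Z^2 / (2 \<Phi>') with \<Phi>' of size ln t. If F < L^5 throughout, then Z(u)^4 u' < 2 L^4, which says that
  the fourth moment of Z over a piece of the image of u is at most 2 L^4 times the length of its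
  preimage. Preimages are short: the mean square of Z over every window of length about 10 L is bounded
  below (\<open>local_second_moment_lower\<close>), so u grows by at least a negative power of L over
  each window, and a piece of length 1/L has a preimage of length O(L^2). Hence all pieces of
  length 1/L would have fourth moment O(L^6). On the other hand, the resonance method
  (\<open>resonance\<close>, \<open>zeta_short_integral_large\<close>) produces, in every interval of length T^(4/5), a piece
  of length 1/L on which the mean of \<zeta> exceeds L^12 in absolute value.

  For the separation of the two segments, put t = T + U. Then T - u(t) is t - u(t) minus U, where
  t - u(t) is asymptotic to (1 - c) \<pi>(t) and U is negligible against T / ln T. So one needs \<pi>(t) to be at
  least (1 - o(1)) t / ln t, the lower half of the prime number theorem
  (\<open>prime_pi_lower\<close>). It follows from the absence of zeros of \<zeta> on the line Re s = 1: if \<psi>(N) were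
  smaller than (1 - \<delta>) N, then \<psi>(n) - n would be markedly negative just below N, because \<psi> is
  monotone, and this is incompatible with the smallness of a Fejer-smoothed mean of \<psi>(n) - n.

  The function \<zeta> is described as the unique holomorphic function with the given properties, so an
  analytic continuation to the whole plane is constructed first: Euler-Maclaurin summation reaches
  Re s > -1, and the functional equation, obtained by computing one Mellin transform in two ways,
  supplies the rest. The functional equation also shows that exp(i \<theta>(t)) \<zeta>(1/2 + it) is real.
\<close>

section \<open>Euler-Maclaurin continuation of the zeta-function\<close>

text \<open>
  The trapezoidal error of the function x powr (-s) on [n+1, n+2], multiplied by s - 1. The multiplication
  removes the pole, so that the series of these errors yields (s - 1) \<zeta>(s)
  on the half-plane Re s > -1.
\<close>
definition zeta_step :: "nat \<Rightarrow> complex \<Rightarrow> complex" where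
  "zeta_step n s = (s - 1) * (of_nat (Suc n) powr (-s) + of_nat (Suc (Suc n)) powr (-s)) / 2
                   - (of_nat (Suc n) powr (1 - s) - of_nat (Suc (Suc n)) powr (1 - s))"

definition zeta_reg :: "complex \<Rightarrow> complex" where
  "zeta_reg s = 1 + (s - 1) / 2 + (\<Sum>n. zeta_step n s)"

text \<open>
  The second derivative of x powr (-s) brings down two factors s, s + 1 and improves the decay to
  the exponent -Re s - 2; this is why the series of errors converges down to Re s > -1.
\<close>
lemma norm_zeta_step_le:
  assumes "Re s \<ge> -2"
  shows "norm (zeta_step n s) \<le> norm (s - 1) * norm s * norm (s + 1) * real (Suc n) powr (- Re s - 2)"
proof -
  define a where "a = real (Suc n)"
  have a: "a \<ge> 1" by (simp add: a_def)
  define p :: "complex \<Rightarrow> complex" where "p = (\<lambda>w. (w - of_real a) * (of_real a + 1 - w) / 2)"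
  define p' :: "complex \<Rightarrow> complex" where "p' = (\<lambda>w. (2 * of_real a + 1 - 2 * w) / 2)"
  (* Q is the antiderivative obtained from two integrations by parts of (s - 1) p times the second
     derivative of w powr (-s); p vanishes at both ends of the interval. *)
  define Q where "Q = (\<lambda>w. (s - 1) * (p w * (-s) * w powr (-s-1) - p' w * w powr (-s)) + w powr (1-s))"
  define S where "S = closed_segment (complex_of_real a) (complex_of_real (a + 1))"
  define B where "B = norm (s - 1) * norm s * norm (s + 1) * a powr (- Re s - 2)"
  have S: "\<exists>x. w = of_real x \<and> a \<le> x \<and> x \<le> a + 1" if "w \<in> S" for w
    using that unfolding S_def closed_segment_of_real closed_segment_eq_real_ivl by auto
  have deriv: "(Q has_field_derivative ((s-1) * s * (s+1) * p w * w powr (-s-2))) (at w within S)" if "w \<in> S" for w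
  proof -
    from S[OF that] obtain x where x: "w = of_real x" "a \<le> x" by blast
    have nz: "w \<notin> \<real>\<^sub>\<le>\<^sub>0" using x a by (auto simp: complex_nonpos_Reals_iff)
    have w0: "w \<noteq> 0" using x a by auto
    have e1: "w powr (-s-1) = w * w powr (-s-2)"
    proof -
      have "-s-1 = 1 + (-s-2)" by simp
      hence "w powr (-s-1) = w powr (1 + (-s-2))" by (rule arg_cong)
      also have "\<dots> = w * w powr (-s-2)" using w0 by (subst powr_add) simp
      finally show ?thesis .
    qed
    have e2: "w powr (-s) = w * w * w powr (-s-2)"
    proof -
      have "-s = 1 + (1 + (-s-2))" by simp
      hence "w powr (-s) = w powr (1 + (1 + (-s-2)))" by (rule arg_cong)
      also have "\<dots> = w * w * w powr (-s-2)" using w0 by (simp only: powr_add) simp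
      finally show ?thesis .
    qed
    have e3: "w powr (-s-1-1) = w powr (-s-2)" by (simp add: algebra_simps)
    have e4: "w powr (1-s-1) = w powr (-s)" by simp
    have dp: "(p has_field_derivative p' w) (at w)"
      unfolding p_def p'_def by (auto intro!: derivative_eq_intros simp: field_simps)
    have dp': "(p' has_field_derivative -1) (at w)"
      unfolding p'_def by (auto intro!: derivative_eq_intros)
    have "(Q has_field_derivative ((s - 1) * ((p' w * (-s) * w powr (-s-1) + p w * (-s) * ((-s-1) * w powr (-s-1-1)))
           - (-1 * w powr (-s) + p' w * ((-s) * w powr (-s-1)))) + (1-s) * w powr (1-s-1))) (at w)"
      unfolding Q_def using nz
      by (auto intro!: derivative_eq_intros dp dp')
    also have "((s - 1) * ((p' w * (-s) * w powr (-s-1) + p w * (-s) * ((-s-1) * w powr (-s-1-1)))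
           - (-1 * w powr (-s) + p' w * ((-s) * w powr (-s-1)))) + (1-s) * w powr (1-s-1))
         = ((s-1) * s * (s+1) * p w * w powr (-s-2))"
      unfolding e3 e4 by (simp add: algebra_simps)
    finally show ?thesis by (rule DERIV_subset) auto
  qed
  have bound: "norm ((s-1) * s * (s+1) * p w * w powr (-s-2)) \<le> B" if "w \<in> S" for w
  proof -
    from S[OF that] obtain x where x: "w = of_real x" "a \<le> x" "x \<le> a + 1" by blast
    have "p w = of_real ((x - a) * (a + 1 - x) / 2)" by (simp add: p_def x)
    hence "norm (p w) = (x - a) * (a + 1 - x) / 2" using x by (simp only: norm_of_real) auto
    also have "\<dots> \<le> 1 * 1" 
    proof -
      have "(x - a) * (a + 1 - x) \<le> 1 * 1" by (rule mult_mono) (use x in auto)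
      thus ?thesis by simp
    qed
    finally have 1: "norm (p w) \<le> 1" by simp
    have "norm (w powr (-s-2)) = x powr (- Re s - 2)" using x a by (simp add: norm_powr_real_powr)
    also have "\<dots> \<le> a powr (- Re s - 2)" using x a assms by (intro powr_mono2') auto
    finally have 2: "norm (w powr (-s-2)) \<le> a powr (- Re s - 2)" .
    have "norm (p w) * norm (w powr (-s-2)) \<le> 1 * a powr (- Re s - 2)"
      by (intro mult_mono 1 2) auto
    thus ?thesis unfolding B_def norm_mult
      by (simp add: mult.assoc mult_left_mono)
  qed
  have "norm (Q (of_real (a+1)) - Q (of_real a)) \<le> B * norm (complex_of_real (a + 1) - of_real a)"
    by (rule field_differentiable_bound[OF _ deriv bound]) (auto simp: S_def)
  also have "Q (of_real (a+1)) - Q (of_real a) = zeta_step n s"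
  proof -
    have e: "complex_of_real (a + 1) = of_nat (Suc (Suc n))" "complex_of_real a = of_nat (Suc n)"
      by (simp_all add: a_def)
    have e2: "p (of_nat (Suc n)) = 0" "p (of_nat (Suc (Suc n))) = 0"
      "p' (of_nat (Suc n)) = 1/2" "p' (of_nat (Suc (Suc n))) = -1/2"
      by (simp_all add: p_def p'_def a_def)
    show ?thesis unfolding e Q_def e2 zeta_step_def by (simp add: field_simps del: of_nat_Suc)
  qed
  finally show ?thesis unfolding B_def a_def by simp
qed

lemma summable_zeta_step:
  assumes "Re s > -1"
  shows "summable (\<lambda>n. norm (zeta_step n s))"
proof (rule summable_comparison_test')
  show "summable (\<lambda>n. norm (s - 1) * norm s * norm (s + 1) * real (Suc n) powr (- Re s - 2))"
    using assms by (intro summable_mult) (subst summable_Suc_iff, auto simp: summable_real_powr_iff)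
qed (use norm_zeta_step_le[of s] assms in auto)

lemma zeta_reg_holomorphic: "zeta_reg holomorphic_on {s. Re s > -1}"
proof -
  have op: "open {s. Re s > -1}" by (rule open_halfspace_Re_gt)
  have "(\<lambda>s. \<Sum>n. zeta_step n s) holomorphic_on {s. Re s > -1}"
  proof (rule holomorphic_uniform_sequence[OF op, where f = "\<lambda>N s. \<Sum>n<N. zeta_step n s"])
    show "(\<lambda>s. \<Sum>n<N. zeta_step n s) holomorphic_on {s. Re s > -1}" for N
      unfolding zeta_step_def by (intro holomorphic_intros) (auto simp: complex_nonpos_Reals_iff)
  next
    fix x :: complex assume "x \<in> {s. Re s > -1}"
    then have x: "Re x > -1" by simp
    define d where "d = (Re x + 1) / 2"
    have d: "d > 0" using x by (simp add: d_def)
    define K where "K = (norm x + d + 1)"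
    have Re_ge: "Re y \<ge> -1 + d" if "y \<in> cball x d" for y
    proof -
      have "\<bar>Re (x - y)\<bar> \<le> d" using that abs_Re_le_cmod[of "x - y"] by (simp add: dist_norm)
      thus ?thesis unfolding d_def by (simp add: field_simps abs_if split: if_splits)
    qed
    have sub: "cball x d \<subseteq> {s. Re s > -1}" using Re_ge d by force
    have "uniform_limit (cball x d) (\<lambda>N s. \<Sum>n<N. zeta_step n s) (\<lambda>s. \<Sum>n. zeta_step n s) sequentially"
    proof (rule Weierstrass_m_test[where M = "\<lambda>n. K * K * K * real (Suc n) powr (- 1 - d)"])
      show "summable (\<lambda>n. K * K * K * real (Suc n) powr (- 1 - d))"
        using d by (intro summable_mult) (subst summable_Suc_iff, auto simp: summable_real_powr_iff)
    next
      fix n y assume y: "y \<in> cball x d"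
      have ny: "norm y \<le> norm x + d" 
        using y norm_triangle_ineq2[of y x] by (simp add: dist_norm norm_minus_commute)
      have "norm (y - 1) \<le> K" "norm y \<le> K" "norm (y + 1) \<le> K"
        using norm_triangle_ineq4[of y 1] norm_triangle_ineq[of y 1] ny by (auto simp: K_def)
      moreover have "real (Suc n) powr (- Re y - 2) \<le> real (Suc n) powr (- 1 - d)"
        using Re_ge[OF y] by (intro powr_mono) auto
      ultimately have "norm (y - 1) * norm y * norm (y + 1) * real (Suc n) powr (- Re y - 2)
           \<le> K * K * K * real (Suc n) powr (- 1 - d)"
        using d by (intro mult_mono) (auto simp: K_def)
      moreover have "norm (zeta_step n y) \<le> norm (y - 1) * norm y * norm (y + 1) * real (Suc n) powr (- Re y - 2)"
        using Re_ge[OF y] d by (intro norm_zeta_step_le) auto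
      ultimately show "norm (zeta_step n y) \<le> K * K * K * real (Suc n) powr (- 1 - d)" by linarith
    qed
    thus "\<exists>d>0. cball x d \<subseteq> {s. Re s > - 1} \<and>
             uniform_limit (cball x d) (\<lambda>N s. \<Sum>n<N. zeta_step n s) (\<lambda>s. \<Sum>n. zeta_step n s) sequentially"
      using d sub by blast
  qed
  thus ?thesis unfolding zeta_reg_def[abs_def] by (intro holomorphic_intros) auto
qed

lemma zeta_reg_1 [simp]: "zeta_reg 1 = 1"
  by (simp add: zeta_reg_def zeta_step_def del: of_nat_Suc)

lemma sum_zeta_step:
  "(\<Sum>n<N. zeta_step n s) = (s - 1) * ((\<Sum>k=1..Suc N. of_nat k powr (-s)) - 1/2 - of_nat (Suc N) powr (-s) / 2)
      - 1 + of_nat (Suc N) powr (1 - s)"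
proof (induction N)
  case 0
  show ?case by simp
next
  case (Suc N)
  have e: "(\<Sum>k=1..Suc (Suc N). of_nat k powr (-s)) = (\<Sum>k=1..Suc N. of_nat k powr (-s)) + of_nat (Suc (Suc N)) powr (-s)"
    by simp
  show ?case unfolding sum.lessThan_Suc Suc.IH e
    by (simp add: zeta_step_def algebra_simps add_divide_distrib diff_divide_distrib del: of_nat_Suc sum.cl_ivl_Suc)
qed

lemma suminf_inverse_squares_tail:
  assumes "M \<ge> 1"
  shows "summable (\<lambda>n. real (n + M) powr (-2))" "(\<Sum>n. real (n + M) powr (-2)) \<le> 2 / real M"
proof -
  show 1: "summable (\<lambda>n. real (n + M) powr (-2))"
    by (subst summable_iff_shift[where f = "\<lambda>n. real n powr (-2)"]) (simp add: summable_real_powr_iff)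
  have lim: "(\<lambda>n. 2 / real (n + M)) \<longlonglongrightarrow> 0"
    by real_asymp
  have "(\<lambda>n. 2 / real (n + M) - 2 / real (Suc n + M)) sums (2 / real (0 + M) - 0)"
    using telescope_sums'[OF lim] by simp
  hence 2: "(\<lambda>n. 2 / real (n + M) - 2 / real (Suc n + M)) sums (2 / real M)" by simp
  have "(\<Sum>n. real (n + M) powr (-2)) \<le> (\<Sum>n. 2 / real (n + M) - 2 / real (Suc n + M))"
  proof (rule suminf_le[OF _ 1 sums_summable[OF 2]])
    fix n
    define x where "x = real (n + M)"
    have x: "x \<ge> 1" using assms by (simp add: x_def)
    have "x powr (-2) = 1 / x^2" using x by (simp add: powr_minus field_simps)
    also have "\<dots> \<le> 2 / (x * (x + 1))" using x
      by (simp add: divide_simps power2_eq_square)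
    also have "\<dots> = 2 / x - 2 / (x + 1)" using x by (simp add: field_simps)
    finally show "real (n + M) powr (-2) \<le> 2 / real (n + M) - 2 / real (Suc n + M)"
      by (simp add: x_def add.commute)
  qed
  thus "(\<Sum>n. real (n + M) powr (-2)) \<le> 2 / real M" using 2 by (simp add: sums_iff)
qed

text \<open>
  The tail of the defining series is bounded termwise. This is the approximation of \<zeta> by its partial
  sums that is used on the critical line, and it determines the limit of Dirichlet blocks
  in the critical strip.
\<close>
lemma zeta_reg_approx:
  assumes "Re s \<ge> 0" "M \<ge> 1"
  shows "norm (zeta_reg s - ((s - 1) * ((\<Sum>k=1..M. of_nat k powr (-s)) - of_nat M powr (-s) / 2)
                  + of_nat M powr (1 - s)))
         \<le> norm (s - 1) * norm s * norm (s + 1) * (2 * real M powr (- Re s - 1))"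
proof -
  define N where "N = M - 1"
  have M: "M = Suc N" using assms by (simp add: N_def)
  have sm: "summable (\<lambda>n. norm (zeta_step n s))" using summable_zeta_step[of s] assms by simp
  have sm': "summable (\<lambda>n. zeta_step n s)" using sm by (rule summable_norm_cancel)
  define C where "C = norm (s - 1) * norm s * norm (s + 1)"
  have C: "C \<ge> 0" by (simp add: C_def)
  have "zeta_reg s - ((s - 1) * ((\<Sum>k=1..M. of_nat k powr (-s)) - of_nat M powr (-s) / 2)
                  + of_nat M powr (1 - s)) = (\<Sum>n. zeta_step (n + N) s)"
    unfolding zeta_reg_def using suminf_split_initial_segment[OF sm', of N]
    by (simp only: sum_zeta_step M) (simp add: algebra_simps)
  also have "norm \<dots> \<le> (\<Sum>n. norm (zeta_step (n + N) s))"
    by (intro summable_norm summable_ignore_initial_segment[OF sm])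
  also have "\<dots> \<le> (\<Sum>n. C * real M powr (- Re s) * real (n + M) powr (-2))"
  proof (rule suminf_le)
    fix n
    have "norm (zeta_step (n + N) s) \<le> C * real (Suc (n + N)) powr (- Re s - 2)"
      unfolding C_def using assms by (intro norm_zeta_step_le) auto
    also have "real (Suc (n + N)) powr (- Re s - 2) = real (n + M) powr (- Re s) * real (n + M) powr (- 2)"
      by (simp add: M powr_add[symmetric])
    also have "C * \<dots> \<le> C * (real M powr (- Re s) * real (n + M) powr (- 2))"
      using assms C by (intro mult_left_mono mult_right_mono powr_mono2') auto
    finally show "norm (zeta_step (n + N) s) \<le> C * real M powr (- Re s) * real (n + M) powr (-2)" 
      by (simp add: mult.assoc)
  next
    show "summable (\<lambda>n. norm (zeta_step (n + N) s))" by (rule summable_ignore_initial_segment[OF sm])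
    show "summable (\<lambda>n. C * real M powr (- Re s) * real (n + M) powr (-2))"
      by (intro summable_mult suminf_inverse_squares_tail assms)
  qed
  also have "\<dots> = C * real M powr (- Re s) * (\<Sum>n. real (n + M) powr (-2))"
    by (intro suminf_mult suminf_inverse_squares_tail assms)
  also have "\<dots> \<le> C * real M powr (- Re s) * (2 / real M)"
    using C by (intro mult_left_mono suminf_inverse_squares_tail assms) auto
  also have "\<dots> = C * (2 * real M powr (- Re s - 1))"
    using assms by (simp add: powr_diff)
  finally show ?thesis by (simp add: C_def)
qed

lemma zeta_reg_sums:
  assumes "Re s > 1"
  shows "(\<lambda>n. 1 / of_nat (Suc n) powr s) sums (zeta_reg s / (s - 1))"
proof -
  have s1: "s \<noteq> 1" using assms by auto
  have lim0: "(\<lambda>n. of_nat (Suc n) powr (-s) :: complex) \<longlonglongrightarrow> 0"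
  proof (rule tendsto_norm_zero_cancel)
    have "(\<lambda>n. real (Suc n) powr (- Re s)) \<longlonglongrightarrow> 0" 
      by (rule tendsto_neg_powr[OF _ filterlim_compose[OF filterlim_real_sequentially filterlim_Suc]]) (use assms in simp)
    thus "(\<lambda>n. norm (of_nat (Suc n) powr (-s) :: complex)) \<longlonglongrightarrow> 0"
      by (simp add: norm_powr_real_powr del: of_nat_Suc)
  qed
  have lim1: "(\<lambda>n. of_nat (Suc n) powr (1-s) :: complex) \<longlonglongrightarrow> 0"
  proof (rule tendsto_norm_zero_cancel)
    have "(\<lambda>n. real (Suc n) powr (1 - Re s)) \<longlonglongrightarrow> 0"
      by (rule tendsto_neg_powr[OF _ filterlim_compose[OF filterlim_real_sequentially filterlim_Suc]]) (use assms in simp)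
    thus "(\<lambda>n. norm (of_nat (Suc n) powr (1-s) :: complex)) \<longlonglongrightarrow> 0"
      by (simp add: norm_powr_real_powr del: of_nat_Suc)
  qed
  have sm': "summable (\<lambda>n. zeta_step n s)" by (rule summable_norm_cancel[OF summable_zeta_step]) (use assms in auto)
  have "(\<lambda>N. (\<Sum>n<N. zeta_step n s)) \<longlonglongrightarrow> (\<Sum>n. zeta_step n s)" using sm' by (rule summable_LIMSEQ)
  hence "(\<lambda>N. ((\<Sum>n<N. zeta_step n s) + 1 - of_nat (Suc N) powr (1 - s)) / (s - 1) + 1/2 + of_nat (Suc N) powr (-s) / 2)
     \<longlonglongrightarrow> ((\<Sum>n. zeta_step n s) + 1 - 0) / (s - 1) + 1/2 + 0 / 2"
    by (intro tendsto_intros lim0 lim1) (use s1 in auto)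
  also have "(\<lambda>N. ((\<Sum>n<N. zeta_step n s) + 1 - of_nat (Suc N) powr (1 - s)) / (s - 1) + 1/2 + of_nat (Suc N) powr (-s) / 2)
      = (\<lambda>N. (\<Sum>k=1..Suc N. of_nat k powr (-s)))"
  proof (intro ext)
    fix N
    define S :: complex where "S = (\<Sum>k=1..Suc N. of_nat k powr (-s))"
    show "((\<Sum>n<N. zeta_step n s) + 1 - of_nat (Suc N) powr (1 - s)) / (s - 1) + 1/2 + of_nat (Suc N) powr (-s) / 2
      = (\<Sum>k=1..Suc N. of_nat k powr (-s))"
      unfolding sum_zeta_step S_def[symmetric] using s1 by (simp add: diff_divide_distrib add_divide_distrib)
  qed
  also have "((\<Sum>n. zeta_step n s) + 1 - 0) / (s - 1) + 1/2 + 0 / 2 = zeta_reg s / (s - 1)"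
    unfolding zeta_reg_def using s1 by (simp add: field_simps)
  finally have "(\<lambda>N. (\<Sum>k<Suc N. of_nat (Suc k) powr (-s))) \<longlonglongrightarrow> zeta_reg s / (s - 1)"
    by (simp only: sum.atLeast_Suc_atMost_Suc_shift One_nat_def atLeast0AtMost lessThan_Suc_atMost o_def)
  hence "(\<lambda>n. of_nat (Suc n) powr (-s)) sums (zeta_reg s / (s - 1))"
    unfolding sums_def by (subst (asm) filterlim_sequentially_Suc)
  thus ?thesis by (simp add: powr_minus field_simps)
qed

section \<open>Mellin transforms\<close>

lemma has_bochner_integral_lborelI:
  fixes f :: "real \<Rightarrow> complex"
  assumes "f absolutely_integrable_on S" "(f has_integral I) S"
    "(\<lambda>x. indicator S x *\<^sub>R f x) \<in> borel_measurable borel"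
  shows "has_bochner_integral lborel (\<lambda>x. indicator S x *\<^sub>R f x) I"
proof -
  have "integrable lebesgue (\<lambda>x. indicator S x *\<^sub>R f x)"
    using assms(1) by (simp add: set_integrable_def)
  hence 1: "integrable lborel (\<lambda>x. indicator S x *\<^sub>R f x)"
    using assms(3) by (subst (asm) integrable_completion) auto
  have "integral\<^sup>L lborel (\<lambda>x. indicator S x *\<^sub>R f x) = integral\<^sup>L lebesgue (\<lambda>x. indicator S x *\<^sub>R f x)"
    using assms(3) by (subst integral_completion) auto
  also have "\<dots> = integral S f"
    using set_lebesgue_integral_eq_integral(2)[OF assms(1)] by (simp add: set_lebesgue_integral_def)
  also have "\<dots> = I" using assms(2) by (rule integral_unique)
  finally show ?thesis using 1 by (simp add: has_bochner_integral_iff)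
qed

lemma Gamma_mellin:
  assumes "Re z > 0" "b > 0"
  shows "has_bochner_integral lborel (\<lambda>x. indicator {0<..} x *\<^sub>R (of_real x powr (z - 1) * of_real (exp (- (b * x)))))
           (Gamma z * of_real b powr (-z))"
proof -
  define f where "f = (\<lambda>x::real. indicator {0<..} x *\<^sub>R (complex_of_real x powr (z - 1) * of_real (exp (- x))))"
  have 1: "(\<lambda>t. complex_of_real t powr (z - 1) * of_real (exp (- t))) absolutely_integrable_on {0<..}"
    using absolutely_integrable_Gamma_integral'[OF assms(1)] by (simp add: exp_minus field_simps)
  have 2: "((\<lambda>t. complex_of_real t powr (z - 1) * of_real (exp (- t))) has_integral Gamma z) {0<..}"
    using Gamma_integral_complex'[OF assms(1)] by (simp add: exp_minus field_simps)
  have 3: "has_bochner_integral lborel f (Gamma z)"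
    unfolding f_def 
    by (intro has_bochner_integral_lborelI 1 2 borel_measurable_continuous_on_indicator continuous_intros) auto
  hence "has_bochner_integral lborel (\<lambda>x. f (0 + b * x)) (Gamma z /\<^sub>R \<bar>b\<bar>)"
    using assms by (subst lborel_has_bochner_integral_real_affine_iff[symmetric]) auto
  hence 4: "has_bochner_integral lborel (\<lambda>x. of_real b powr (1 - z) * f (b * x)) (of_real b powr (1 - z) * (Gamma z /\<^sub>R \<bar>b\<bar>))"
    by (intro has_bochner_integral_mult_right) auto
  have e1: "of_real b powr (1 - z) * f (b * x) = indicator {0<..} x *\<^sub>R (of_real x powr (z - 1) * of_real (exp (- (b * x))))" for x
  proof (cases "x > 0")
    case True
    have "complex_of_real (b * x) powr (z - 1) = of_real b powr (z - 1) * of_real x powr (z - 1)"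
      using True assms by (subst of_real_mult, subst powr_times_real) auto
    moreover have "complex_of_real b powr (1 - z) * of_real b powr (z - 1) = 1"
      using assms by (subst powr_add[symmetric]) auto
    ultimately show ?thesis using True assms unfolding f_def by (simp add: mult.assoc[symmetric])
  next
    case False
    hence "\<not> b * x > 0" using assms by (simp add: zero_less_mult_iff)
    thus ?thesis using False by (simp add: f_def)
  qed
  have e2: "of_real b powr (1 - z) * (Gamma z /\<^sub>R \<bar>b\<bar>) = Gamma z * of_real b powr (-z)"
    using assms by (simp add: powr_diff powr_minus scaleR_conv_of_real field_simps)
  show ?thesis using 4 unfolding e1 e2 .
qed

lemma integrable_powr_over:
  fixes a :: real
  assumes "0 < a" "a < 1"
  shows "integrable lborel (\<lambda>y. indicator {0<..} y *\<^sub>R (y powr (a - 1) / (1 + y)))"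
proof -
  have 1: "integrable lborel (\<lambda>y. indicator {0<..1} y *\<^sub>R (y powr (a - 1)))"
  proof -
    have "(\<lambda>y. y powr (a - 1)) integrable_on {0<..1}" 
      using integrable_on_powr_from_0'[of "a - 1" 1] assms by simp
    hence "(\<lambda>y. y powr (a - 1)) absolutely_integrable_on {0<..1}"
      by (rule nonnegative_absolutely_integrable_1) auto
    thus ?thesis unfolding set_integrable_def by (subst (asm) integrable_completion) auto
  qed
  have 2: "integrable lborel (\<lambda>y. indicator {1..} y *\<^sub>R (y powr (a - 2)))"
  proof -
    have "(\<lambda>y. y powr (a - 2)) integrable_on {1..}" 
      using has_integral_powr_to_inf[of "a - 2" 1] assms by (auto simp: integrable_on_def)
    hence "(\<lambda>y. y powr (a - 2)) absolutely_integrable_on {1..}"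
      by (rule nonnegative_absolutely_integrable_1) auto
    thus ?thesis unfolding set_integrable_def by (subst (asm) integrable_completion) auto
  qed
  show ?thesis
  proof (rule Bochner_Integration.integrable_bound[OF Bochner_Integration.integrable_add[OF 1 2]])
    show "AE y in lborel. norm (indicator {0<..} y *\<^sub>R (y powr (a - 1) / (1 + y)))
        \<le> norm (indicator {0<..1} y *\<^sub>R (y powr (a - 1)) + indicator {1..} y *\<^sub>R (y powr (a - 2)))"
    proof (intro AE_I2)
      fix y :: real
      show "norm (indicator {0<..} y *\<^sub>R (y powr (a - 1) / (1 + y)))
        \<le> norm (indicator {0<..1} y *\<^sub>R (y powr (a - 1)) + indicator {1..} y *\<^sub>R (y powr (a - 2)))"
      proof (cases "y > 0")
        case True
        have "y powr (a - 1) / (1 + y) \<le> y powr (a - 1) / 1" using True by (intro divide_left_mono) auto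
        moreover have "y powr (a - 1) / (1 + y) \<le> y powr (a - 1) / y" using True by (intro divide_left_mono) auto
        moreover have "y powr (a - 1) / y = y powr (a - 2)" using True by (simp add: powr_diff power2_eq_square)
        ultimately show ?thesis using True by (auto simp: indicator_def add_nonneg_nonneg abs_of_nonneg)
      qed auto
    qed
  qed auto
qed

text \<open>
  Write 1 / (1 + y) as the integral of exp(-(1 + y) u) over u > 0 and exchange the integrals: the inner
  integral in y is a Gamma integral in y u, and the remaining one in u is another.
\<close>
lemma mellin_beta_kernel:
  assumes w: "0 < Re w" "Re w < 1"
  shows "has_bochner_integral lborel (\<lambda>y. indicator {0<..} y *\<^sub>R (of_real y powr (w - 1) / of_real (1 + y)))
           (Gamma w * Gamma (1 - w))"
proof -
  define f :: "real \<times> real \<Rightarrow> complex" where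
    "f = (\<lambda>p. indicator ({0<..} \<times> {0<..}) p *\<^sub>R (of_real (fst p) powr (w - 1) * of_real (exp (- ((1 + fst p) * snd p)))))"
  have f_eq: "f (y, u) = (indicator {0<..} y *\<^sub>R of_real y powr (w - 1)) * (indicator {0<..} u *\<^sub>R of_real (exp (- ((1 + y) * u))))" for y u
    by (auto simp: f_def indicator_def)
  have meas: "f \<in> borel_measurable (lborel \<Otimes>\<^sub>M lborel)"
  proof -
    have "f \<in> borel_measurable borel" unfolding f_def
      by (intro borel_measurable_continuous_on_indicator continuous_intros borel_open open_Times) auto
    thus ?thesis by (simp add: lborel_prod)
  qed
  have ex: "has_bochner_integral lborel (\<lambda>u. indicator {0<..} u *\<^sub>R complex_of_real (exp (- (b * u)))) (1 / of_real b)"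
    if "b > 0" for b
  proof -
    have "has_bochner_integral lborel (\<lambda>x. indicator {0<..} x *\<^sub>R (complex_of_real x powr (1 - 1) * of_real (exp (- (b * x))))) (1 / of_real b)"
      using Gamma_mellin[of 1 b] that by (simp add: powr_minus field_simps)
    also have "(\<lambda>x. indicator {0<..} x *\<^sub>R (complex_of_real x powr (1 - 1) * of_real (exp (- (b * x))))) = 
        (\<lambda>u. indicator {0<..} u *\<^sub>R complex_of_real (exp (- (b * u))))"
      by (auto simp: indicator_def)
    finally show ?thesis .
  qed
  have in1: "has_bochner_integral lborel (\<lambda>u. f (y, u)) (indicator {0<..} y *\<^sub>R (of_real y powr (w - 1) / of_real (1 + y)))" for y
  proof (cases "y > 0")
    case True
    show ?thesis unfolding f_eq
      using has_bochner_integral_mult_right[OF ex[of "1 + y"], of "(indicator {0<..} y *\<^sub>R of_real y powr (w - 1))"] True by simp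
  qed (simp add: f_eq has_bochner_integral_zero)
  have in1': "(LINT u|lborel. norm (f (y, u))) = indicator {0<..} y *\<^sub>R (y powr (Re w - 1) / (1 + y))" for y
  proof (cases "y > 0")
    case True
    have "has_bochner_integral lborel (\<lambda>u. Re (indicator {0<..} u *\<^sub>R complex_of_real (exp (- ((1 + y) * u))))) (Re (1 / of_real (1 + y)))"
      using True by (intro has_bochner_integral_Re ex) auto
    also have "(\<lambda>u. Re (indicator {0<..} u *\<^sub>R complex_of_real (exp (- ((1 + y) * u))))) = (\<lambda>u. indicator {0<..} u *\<^sub>R exp (- ((1 + y) * u)))"
      by auto
    also have "Re (1 / of_real (1 + y)) = 1 / (1 + y)" by (simp add: Re_divide_of_real del: of_real_add)
    finally have "has_bochner_integral lborel (\<lambda>u. (y powr (Re w - 1)) * (indicator {0<..} u *\<^sub>R exp (- ((1 + y) * u)))) (y powr (Re w - 1) * (1 / (1 + y)))"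
      by (intro has_bochner_integral_mult_right) auto
    also have "(\<lambda>u. (y powr (Re w - 1)) * (indicator {0<..} u *\<^sub>R exp (- ((1 + y) * u)))) = (\<lambda>u. norm (f (y, u)))"
      using True by (auto simp: f_eq norm_mult norm_powr_real_powr indicator_def)
    finally show ?thesis using True by (simp add: has_bochner_integral_iff)
  qed (simp add: f_eq)
  have int: "integrable (lborel \<Otimes>\<^sub>M lborel) f"
  proof (rule lborel_pair.Fubini_integrable[OF meas])
    show "integrable lborel (\<lambda>y. LINT u|lborel. norm (f (y, u)))"
      unfolding in1' using w by (intro integrable_powr_over) auto
    show "AE y in lborel. integrable lborel (\<lambda>u. f (y, u))"
      using in1 by (auto simp: has_bochner_integral_iff)
  qed
  have in2: "has_bochner_integral lborel (\<lambda>y. f (y, u)) (Gamma w * (indicator {0<..} u *\<^sub>R (of_real u powr ((1 - w) - 1) * of_real (exp (- (1 * u))))))" for u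
  proof (cases "u > 0")
    case True
    have "has_bochner_integral lborel (\<lambda>y. (indicator {0<..} y *\<^sub>R (of_real y powr (w - 1) * of_real (exp (- (u * y))))) * of_real (exp (- u)))
        (Gamma w * of_real u powr (-w) * of_real (exp (- u)))"
      using True w by (intro has_bochner_integral_mult_left Gamma_mellin) auto
    also have "(\<lambda>y. (indicator {0<..} y *\<^sub>R (of_real y powr (w - 1) * of_real (exp (- (u * y))))) * of_real (exp (- u))) = (\<lambda>y. f (y, u))"
      using True by (auto simp: f_eq indicator_def algebra_simps exp_add[symmetric] exp_diff exp_minus field_simps simp flip: of_real_mult)
    finally show ?thesis using True by (simp add: mult.assoc)
  qed (simp add: f_eq has_bochner_integral_zero)
  have "integrable lborel (\<lambda>y. LINT u|lborel. f (y, u))"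
    using lborel_pair.integrable_fst'[OF int] .
  moreover have "(LINT y|lborel. LINT u|lborel. f (y, u)) = (LINT u|lborel. LINT y|lborel. f (y, u))"
    using lborel_pair.Fubini_integral[of "\<lambda>y u. f (y, u)"] int by simp
  moreover have "(LINT u|lborel. LINT y|lborel. f (y, u)) = Gamma w * Gamma (1 - w)"
  proof -
    have "has_bochner_integral lborel (\<lambda>u. Gamma w * (indicator {0<..} u *\<^sub>R (of_real u powr ((1 - w) - 1) * of_real (exp (- (1 * u))))))
        (Gamma w * (Gamma (1 - w) * of_real 1 powr (-(1-w))))"
      using w by (intro has_bochner_integral_mult_right Gamma_mellin) auto
    thus ?thesis using has_bochner_integral_integral_eq[OF in2] by (simp add: has_bochner_integral_iff)
  qed
  ultimately show ?thesis
    using has_bochner_integral_integral_eq[OF in1] by (simp add: has_bochner_integral_iff)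
qed

text \<open>
  Substitution x^2 = a^2 y in the beta kernel.
\<close>
lemma mellin_kernel:
  assumes s: "-1 < Re s" "Re s < 1" and a: "a > 0"
  shows "has_bochner_integral lborel (\<lambda>x. indicator {0<..} x *\<^sub>R (of_real x powr (s - 1) * of_real (2 * x / (x\<^sup>2 + a\<^sup>2))))
           (of_real a powr (s - 1) * (Gamma ((1 + s) / 2) * Gamma ((1 - s) / 2)))"
proof -
  define w where "w = (1 + s) / 2"
  have w: "0 < Re w" "Re w < 1" "1 - w = (1 - s) / 2" using s by (auto simp: w_def field_simps)
  define K where "K = Gamma w * Gamma (1 - w)"
  define f where "f = (\<lambda>y. complex_of_real y powr (w - 1) / of_real (1 + y))"
  define h where "h = (\<lambda>x. complex_of_real x powr (s - 1) * of_real (2 * x / (x\<^sup>2 + 1)))"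
  have B: "has_bochner_integral lborel (\<lambda>y. indicator {0<..} y *\<^sub>R f y) K"
    unfolding f_def K_def by (rule mellin_beta_kernel) (use w in auto)
  have cont: "continuous_on {0<..} f" unfolding f_def
    by (intro continuous_intros) (auto simp: add_eq_0_iff simp del: of_real_add)
  have f_abs: "f absolutely_integrable_on {0<..}" "integral {0<..} f = K"
  proof -
    have "integrable lebesgue (\<lambda>y. indicator {0<..} y *\<^sub>R f y)"
      using B by (subst integrable_completion) (auto simp: has_bochner_integral_iff)
    thus 1: "f absolutely_integrable_on {0<..}" by (simp add: set_integrable_def)
    have "integral {0<..} f = integral\<^sup>L lebesgue (\<lambda>x. indicator {0<..} x *\<^sub>R f x)"
      using set_lebesgue_integral_eq_integral(2)[OF 1] by (simp add: set_lebesgue_integral_def)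
    also have "\<dots> = integral\<^sup>L lborel (\<lambda>x. indicator {0<..} x *\<^sub>R f x)"
      using B by (subst integral_completion) (auto simp: has_bochner_integral_iff)
    also have "\<dots> = K" using B by (simp add: has_bochner_integral_iff)
    finally show "integral {0<..} f = K" .
  qed
  have img: "(\<lambda>x::real. x\<^sup>2) ` {0<..} = {0<..}"
  proof safe
    fix y :: real assume "y > 0"
    thus "y \<in> (\<lambda>x::real. x\<^sup>2) ` {0<..}" by (intro image_eqI[of _ _ "sqrt y"]) auto
  qed auto
  have cv: "(\<lambda>x. \<bar>2 * x\<bar> *\<^sub>R f (x\<^sup>2)) absolutely_integrable_on {0<..} \<and> integral {0<..} (\<lambda>x. \<bar>2 * x\<bar> *\<^sub>R f (x\<^sup>2)) = K"
  proof (subst has_absolute_integral_change_of_variables_real)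
    show "inj_on (\<lambda>x::real. x\<^sup>2) {0<..}" by (auto simp: inj_on_def power2_eq_iff)
    show "f absolutely_integrable_on (\<lambda>x. x\<^sup>2) ` {0<..} \<and> integral ((\<lambda>x. x\<^sup>2) ` {0<..}) f = K"
      unfolding img using f_abs by blast
  qed (auto intro!: derivative_eq_intros)
  have heq: "\<bar>2 * x\<bar> *\<^sub>R f (x\<^sup>2) = h x" if "x > 0" for x
  proof -
    have "complex_of_real (x\<^sup>2) powr (w - 1) = of_real x powr (s - 1)"
    proof -
      have "complex_of_real (x\<^sup>2) powr (w - 1) = of_real x powr (w - 1) * of_real x powr (w - 1)"
        using that by (subst power2_eq_square, subst of_real_mult, subst powr_times_real) auto
      also have "\<dots> = of_real x powr (s - 1)"
      proof -
        have "(w - 1) + (w - 1) = s - 1" by (simp add: w_def field_simps)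
        thus ?thesis by (simp only: powr_add[symmetric])
      qed
      finally show ?thesis .
    qed
    thus ?thesis using that by (simp add: f_def h_def scaleR_conv_of_real add.commute field_simps)
  qed
  have H: "has_bochner_integral lborel (\<lambda>x. indicator {0<..} x *\<^sub>R h x) K"
  proof (rule has_bochner_integral_lborelI)
    show h1: "h absolutely_integrable_on {0<..}"
      using cv heq by (metis (no_types, lifting) absolutely_integrable_spike_eq greaterThan_iff negligible_empty DiffD1)
    have "integral {0<..} h = K"
      using cv heq by (metis (no_types, lifting) integral_cong greaterThan_iff)
    thus "(h has_integral K) {0<..}" 
      using set_lebesgue_integral_eq_integral(1)[OF h1] by (simp add: has_integral_iff)
    show "(\<lambda>x. indicator {0<..} x *\<^sub>R h x) \<in> borel_measurable borel"
      unfolding h_def by (intro borel_measurable_continuous_on_indicator continuous_intros)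
        (auto simp: add_nonneg_eq_0_iff)
  qed
  hence "has_bochner_integral lborel (\<lambda>x. indicator {0<..} (0 + (1/a) * x) *\<^sub>R h (0 + (1/a) * x)) (K /\<^sub>R \<bar>1/a\<bar>)"
    using a by (subst lborel_has_bochner_integral_real_affine_iff[symmetric, of "1/a"]) auto
  hence "has_bochner_integral lborel (\<lambda>x. of_real a powr (s - 2) * (indicator {0<..} (0 + (1/a) * x) *\<^sub>R h (0 + (1/a) * x))) (of_real a powr (s - 2) * (K /\<^sub>R \<bar>1/a\<bar>))"
    by (intro has_bochner_integral_mult_right) auto
  also have "(\<lambda>x. of_real a powr (s - 2) * (indicator {0<..} (0 + (1/a) * x) *\<^sub>R h (0 + (1/a) * x))) =
     (\<lambda>x. indicator {0<..} x *\<^sub>R (of_real x powr (s - 1) * of_real (2 * x / (x\<^sup>2 + a\<^sup>2))))"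
  proof
    fix x :: real
    show "of_real a powr (s - 2) * (indicator {0<..} (0 + (1/a) * x) *\<^sub>R h (0 + (1/a) * x)) = 
      indicator {0<..} x *\<^sub>R (of_real x powr (s - 1) * of_real (2 * x / (x\<^sup>2 + a\<^sup>2)))"
    proof (cases "x > 0")
      case True
      have "complex_of_real x powr (s - 1) = of_real a powr (s - 1) * of_real (x / a) powr (s - 1)"
        using True a by (subst powr_times_real[symmetric]) auto
      also have "complex_of_real a powr (s - 1) = of_real a * of_real a powr (s - 2)"
      proof -
        have "s - 1 = 1 + (s - 2)" by simp
        hence "complex_of_real a powr (s - 1) = of_real a powr (1 + (s - 2))" by (rule arg_cong)
        also have "\<dots> = of_real a * of_real a powr (s - 2)" using a by (subst powr_add) auto
        finally show ?thesis .
      qed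
      finally have e: "complex_of_real x powr (s - 1) = of_real a * of_real a powr (s - 2) * of_real (x / a) powr (s - 1)" .
      have "2 * (x / a) / ((x / a)\<^sup>2 + 1) = a * (2 * x / (x\<^sup>2 + a\<^sup>2))"
      proof -
        have "(x / a)\<^sup>2 + 1 = (x\<^sup>2 + a\<^sup>2) / a\<^sup>2" using a by (simp add: field_simps)
        thus ?thesis using a by (simp add: power2_eq_square)
      qed
      hence "h (x / a) = of_real (x / a) powr (s - 1) * (of_real a * of_real (2 * x / (x\<^sup>2 + a\<^sup>2)))"
        unfolding h_def by (metis of_real_mult)
      thus ?thesis using True a unfolding e by simp
    next
      case False
      thus ?thesis using a by (simp add: zero_less_divide_iff)
    qed
  qed
  also have "of_real a powr (s - 2) * (K /\<^sub>R \<bar>1/a\<bar>) = of_real a powr (s - 1) * K"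
    using a powr_add[of "complex_of_real a" 1 "s - 2"] by (simp add: scaleR_conv_of_real algebra_simps)
  finally show ?thesis unfolding K_def w(3) by (simp add: w_def)
qed

text \<open>
  Logarithmic derivative of the reflection formula for Gamma.
\<close>
lemma Digamma_reflection:
  fixes z :: complex
  assumes z: "z \<notin> \<int>"
  shows "Digamma (1 - z) - Digamma z = of_real pi * cot (of_real pi * z)"
proof -
  define h where "h = (\<lambda>z::complex. Gamma z * Gamma (1 - z) * sin (of_real pi * z))"
  have z1: "1 - z \<notin> \<int>" 
  proof
    assume "1 - z \<in> \<int>"
    hence "1 - (1 - z) \<in> \<int>" by (intro Ints_diff) auto
    thus False using z by simp
  qed
  have sin0: "sin (of_real pi * y) \<noteq> 0" if "y \<notin> \<int>" for y :: complex
    using that by (auto simp: sin_eq_0 Ints_def)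
  have nn: "z \<notin> \<int>\<^sub>\<le>\<^sub>0" "1 - z \<notin> \<int>\<^sub>\<le>\<^sub>0" using z z1 by (auto dest: nonpos_Ints_Int)
  have hc: "h y = of_real pi" if "y \<in> - \<int>" for y
    using sin0[of y] that by (simp add: h_def Gamma_reflection_complex)
  have d1: "(h has_field_derivative (Gamma z * Digamma z * Gamma (1 - z) * sin (of_real pi * z)
      - Gamma z * (Gamma (1 - z) * Digamma (1 - z)) * sin (of_real pi * z)
      + Gamma z * Gamma (1 - z) * (cos (of_real pi * z) * of_real pi))) (at z)"
    unfolding h_def using nn by (auto intro!: derivative_eq_intros simp: algebra_simps)
  have "((\<lambda>_. of_real pi) has_field_derivative (Gamma z * Digamma z * Gamma (1 - z) * sin (of_real pi * z)
      - Gamma z * (Gamma (1 - z) * Digamma (1 - z)) * sin (of_real pi * z)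
      + Gamma z * Gamma (1 - z) * (cos (of_real pi * z) * of_real pi))) (at z)"
    by (rule has_field_derivative_transform_within_open[OF d1, of "- \<int>"]) (use z hc in auto)
  hence "Gamma z * Digamma z * Gamma (1 - z) * sin (of_real pi * z)
      - Gamma z * (Gamma (1 - z) * Digamma (1 - z)) * sin (of_real pi * z)
      + Gamma z * Gamma (1 - z) * (cos (of_real pi * z) * of_real pi) = 0"
    using DERIV_unique DERIV_const by blast
  hence "Gamma z * Gamma (1 - z) * (sin (of_real pi * z) * (Digamma z - Digamma (1 - z)) + cos (of_real pi * z) * of_real pi) = 0"
    by (simp add: algebra_simps)
  moreover have "Gamma z \<noteq> 0" "Gamma (1 - z) \<noteq> 0" using nn by (auto simp: Gamma_eq_zero_iff)
  ultimately have "sin (of_real pi * z) * (Digamma z - Digamma (1 - z)) + cos (of_real pi * z) * of_real pi = 0"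
    by simp
  thus ?thesis using sin0[OF z] unfolding cot_def by (simp add: field_simps) 
qed

text \<open>
  At z = 1/2 - i x / (2 \<pi>) the reflection formula for Digamma expresses tanh through a
  cotangent, and the difference of the two Digamma series is the partial fraction expansion.
\<close>
lemma tanh_half_sums:
  fixes x :: real
  shows "(\<lambda>k. 4 * x / (x\<^sup>2 + ((2 * real k + 1) * pi)\<^sup>2)) sums tanh (x / 2)"
proof -
  define y where "y = x / (2 * pi)"
  define z :: complex where "z = Complex (1/2) (-y)"
  have zZ: "z \<notin> \<int>"
  proof
    assume "z \<in> \<int>"
    then obtain n where "z = of_int n" by (auto elim: Ints_cases)
    hence "1/2 = real_of_int n" by (simp add: z_def complex_eq_iff)
    hence "2 * n = 1" by linarith
    thus False by presburger
  qed
  have nz: "z \<noteq> 0" "1 - z \<noteq> 0" by (auto simp: z_def complex_eq_iff)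
  have "(\<lambda>k. (inverse (of_nat (Suc k)) - inverse ((1 - z) + of_nat k)) - (inverse (of_nat (Suc k)) - inverse (z + of_nat k)))
      sums ((Digamma (1 - z) + euler_mascheroni) - (Digamma z + euler_mascheroni))"
    unfolding Digamma_def using summable_Digamma[OF nz(1)] summable_Digamma[OF nz(2)]
    by (intro sums_diff) (simp_all add: summable_sums)
  also have "((Digamma (1 - z) + euler_mascheroni) - (Digamma z + euler_mascheroni)) = of_real pi * cot (of_real pi * z)"
    using Digamma_reflection[OF zZ] by simp
  also have "cot (of_real pi * z) = \<i> * of_real (tanh (x / 2))"
  proof -
    have "of_real pi * z = of_real pi / 2 - \<i> * of_real (x / 2)"
      by (simp add: z_def y_def complex_eq_iff)
    hence "cot (of_real pi * z) = sin (\<i> * of_real (x/2)) / cos (\<i> * of_real (x/2))"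
      by (simp add: cot_def sin_diff cos_diff del: of_real_divide)
    also have "\<dots> = \<i> * tanh (of_real (x/2))"
      by (simp add: tanh_conv_tan tan_def del: of_real_divide)
    also have "tanh (complex_of_real (x/2)) = of_real (tanh (x/2))"
    proof -
      have "tanh (complex_of_real v) = of_real (tanh v)" for v
        unfolding tanh_def sinh_field_def cosh_field_def by (simp add: exp_of_real flip: of_real_minus)
      thus ?thesis .
    qed
    finally show ?thesis .
  qed
  finally have "(\<lambda>k. (1 / (of_real pi * \<i>)) * ((inverse (of_nat (Suc k)) - inverse ((1 - z) + of_nat k)) - (inverse (of_nat (Suc k)) - inverse (z + of_nat k))))
      sums ((1 / (of_real pi * \<i>)) * (of_real pi * (\<i> * of_real (tanh (x / 2)))))"
    by (rule sums_mult)
  also have "(1 / (of_real pi * \<i>)) * (of_real pi * (\<i> * of_real (tanh (x / 2)))) = complex_of_real (tanh (x / 2))"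
    by simp
  also have "(\<lambda>k. (1 / (of_real pi * \<i>)) * ((inverse (of_nat (Suc k)) - inverse ((1 - z) + of_nat k)) - (inverse (of_nat (Suc k)) - inverse (z + of_nat k))))
     = (\<lambda>k. complex_of_real (4 * x / (x\<^sup>2 + ((2 * real k + 1) * pi)\<^sup>2)))"
  proof
    fix k :: nat
    define a where "a = real k + 1/2"
    have a: "a > 0" by (simp add: a_def)
    have e1: "(1 - z) + of_nat k = of_real a + \<i> * of_real y" "z + of_nat k = of_real a - \<i> * of_real y"
      by (simp_all add: z_def a_def complex_eq_iff)
    have n1: "of_real a + \<i> * of_real y \<noteq> 0" "of_real a - \<i> * of_real y \<noteq> 0"
      using a by (auto simp: complex_eq_iff)
    have pr: "(of_real a + \<i> * of_real y) * (of_real a - \<i> * of_real y) = complex_of_real (a\<^sup>2 + y\<^sup>2)"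
      by (simp add: complex_eq_iff power2_eq_square)
    have "inverse (of_real a - \<i> * of_real y) - inverse (of_real a + \<i> * of_real y)
       = 2 * \<i> * of_real y / ((of_real a + \<i> * of_real y) * (of_real a - \<i> * of_real y))"
      using n1 by (simp add: field_simps)
    hence "(1 / (of_real pi * \<i>)) * ((inverse (of_nat (Suc k)) - inverse ((1 - z) + of_nat k)) - (inverse (of_nat (Suc k)) - inverse (z + of_nat k)))
      = 2 * of_real y / (of_real pi * of_real (a\<^sup>2 + y\<^sup>2))"
      unfolding e1 pr by simp
    also have "\<dots> = of_real (2 * y / (pi * (a\<^sup>2 + y\<^sup>2)))" by simp
    also have "2 * y / (pi * (a\<^sup>2 + y\<^sup>2)) = 4 * x / (x\<^sup>2 + ((2 * real k + 1) * pi)\<^sup>2)"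
    proof -
      have "a\<^sup>2 + y\<^sup>2 = (x\<^sup>2 + ((2 * real k + 1) * pi)\<^sup>2) / (4 * pi\<^sup>2)"
        by (simp add: a_def y_def field_simps power2_eq_square)
      thus ?thesis by (simp add: y_def power2_eq_square)
    qed
    finally show "(1 / (of_real pi * \<i>)) * ((inverse (of_nat (Suc k)) - inverse ((1 - z) + of_nat k)) - (inverse (of_nat (Suc k)) - inverse (z + of_nat k)))
      = complex_of_real (4 * x / (x\<^sup>2 + ((2 * real k + 1) * pi)\<^sup>2))" .
  qed
  finally show ?thesis by (simp only: sums_of_real_iff)
qed

section \<open>The functional equation\<close>

text \<open>
  Dominated convergence in the form used twice below: only the partial sums, not the absolute sums,
  need a common integrable majorant. This matters because in the critical strip the Dirichlet
  series involved do not converge absolutely.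
\<close>
lemma mellin_sums:
  fixes b :: "nat \<Rightarrow> real \<Rightarrow> real"
  assumes I: "\<And>j. has_bochner_integral lborel (\<lambda>x. indicator {0<..} x *\<^sub>R (of_real x powr (s - 1) * of_real (b j x))) (I j)"
    and sums: "\<And>x. x > 0 \<Longrightarrow> (\<lambda>j. b j x) sums F x"
    and bound: "\<And>J x. x > 0 \<Longrightarrow> \<bar>\<Sum>j<J. b j x\<bar> \<le> w x"
    and w: "integrable lborel (\<lambda>x. indicator {0<..} x *\<^sub>R (complex_of_real x powr (s - 1) * of_real (w x)))"
  shows "I sums (LINT x|lborel. indicator {0<..} x *\<^sub>R (complex_of_real x powr (s - 1) * of_real (F x)))"
proof -
  define S where "S = (\<lambda>J x. indicator {0<..} x *\<^sub>R (complex_of_real x powr (s - 1) * of_real (\<Sum>j<J. b j x)))"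
  have S: "has_bochner_integral lborel (S J) (\<Sum>j<J. I j)" for J
  proof -
    have "has_bochner_integral lborel (\<lambda>x. \<Sum>j<J. indicator {0<..} x *\<^sub>R (of_real x powr (s - 1) * of_real (b j x))) (\<Sum>j<J. I j)"
      by (intro has_bochner_integral_sum I)
    also have "(\<lambda>x. \<Sum>j<J. indicator {0<..} x *\<^sub>R (of_real x powr (s - 1) * of_real (b j x))) = S J"
      by (auto simp: S_def sum_distrib_left scaleR_right.sum)
    finally show ?thesis .
  qed
  have lim: "(\<lambda>J. S J x) \<longlonglongrightarrow> indicator {0<..} x *\<^sub>R (complex_of_real x powr (s - 1) * of_real (F x))" for x
  proof (cases "x > 0")
    case True
    show ?thesis unfolding S_def using sums[OF True] unfolding sums_def
      by (intro tendsto_intros)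
  qed (simp add: S_def)
  have meas: "S J \<in> borel_measurable lborel" for J 
  proof -
    have "integrable lborel (S J)" using S[of J] by (simp add: has_bochner_integral_iff)
    thus ?thesis by (rule borel_measurable_integrable)
  qed
  have "(\<lambda>J. integral\<^sup>L lborel (S J)) \<longlonglongrightarrow>
     (LINT x|lborel. indicator {0<..} x *\<^sub>R (complex_of_real x powr (s - 1) * of_real (F x)))"
  proof (rule integral_dominated_convergence)
    show "(\<lambda>x. indicator {0<..} x *\<^sub>R (complex_of_real x powr (s - 1) * of_real (F x))) \<in> borel_measurable lborel"
      by (rule borel_measurable_LIMSEQ_metric[OF meas lim])
    show "integrable lborel (\<lambda>x. norm (indicator {0<..} x *\<^sub>R (complex_of_real x powr (s - 1) * of_real (w x))))"
      by (intro integrable_norm w)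
    show "AE x in lborel. norm (S J x) \<le> norm (indicator {0<..} x *\<^sub>R (complex_of_real x powr (s - 1) * of_real (w x)))" for J
    proof (intro AE_I2)
      fix x :: real
      show "norm (S J x) \<le> norm (indicator {0<..} x *\<^sub>R (complex_of_real x powr (s - 1) * of_real (w x)))"
      proof (cases "x > 0")
        case True
        have "\<bar>\<Sum>j<J. b j x\<bar> \<le> \<bar>w x\<bar>" using bound[OF True, of J] by linarith
        thus ?thesis unfolding S_def using True
          by (simp add: norm_mult mult_left_mono del: of_real_sum)
      qed (simp add: S_def)
    qed
  qed (use meas lim in auto)
  moreover have "integral\<^sup>L lborel (S J) = (\<Sum>j<J. I j)" for J using S by (simp add: has_bochner_integral_iff)
  ultimately show ?thesis unfolding sums_def by simp
qed

text \<open>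
  Four consecutive terms of the Dirichlet series whose coefficients have period 4 and are
  1, -2, 1, 0. This is the series of (1 - 2 powr (-s)) (1 - 2 powr (1 - s)) \<zeta>(s). Being a second difference, the block decays
  fast enough for convergence in the whole critical strip.
\<close>
definition dirichlet_block :: "nat \<Rightarrow> complex \<Rightarrow> complex" where
  "dirichlet_block j s = of_nat (4*j+1) powr (-s) - 2 * of_nat (4*j+2) powr (-s) + of_nat (4*j+3) powr (-s)"

lemma powr_of_nat_mult:
  "complex_of_nat (m * n) powr z = of_nat m powr z * of_nat n powr z"
proof -
  have "complex_of_real (real m * real n) powr z = of_real (real m) powr z * of_real (real n) powr z"
    by (subst of_real_mult, rule powr_times_real) auto
  thus ?thesis by simp
qed

text \<open>
  The sum of the first 4 J coefficients, expressed through partial sums of the zeta series of lengths 4 J, 2 J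
  and J; the terms that grow with J cancel since 4 - 6 + 2 = 0.
\<close>
lemma dirichlet_block_sums:
  assumes s: "0 < Re s" "Re s < 1"
  shows "(\<lambda>j. dirichlet_block j s) sums (zeta_reg s / (s - 1) * (1 - 2 powr (-s)) * (1 - 2 powr (1 - s)))"
proof -
  have s1: "s \<noteq> 1" using s by auto
  define S :: "nat \<Rightarrow> complex" where "S = (\<lambda>M. \<Sum>k=1..M. of_nat k powr (-s))"
  define E :: "nat \<Rightarrow> complex" where "E = (\<lambda>M. (s - 1) * (S M - of_nat M powr (-s) / 2) + of_nat M powr (1 - s))"
  define t where "t = (2::complex) powr (-s)"
  have t4: "(4::complex) powr (-s) = t * t"
    using powr_of_nat_mult[of 2 2 "-s"] by (simp add: t_def)
  have Elim: "E \<longlonglongrightarrow> zeta_reg s"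
  proof (rule LIM_zero_cancel, rule Lim_null_comparison)
    show "\<forall>\<^sub>F M in sequentially. norm (E M - zeta_reg s) \<le> norm (s - 1) * norm s * norm (s + 1) * (2 * real M powr (- Re s - 1))"
      using eventually_ge_at_top[of 1]
    proof eventually_elim
      case (elim M)
      thus ?case using zeta_reg_approx[of s M] s unfolding E_def S_def by (subst norm_minus_commute) auto
    qed
    have "(\<lambda>M. real M powr (- Re s - 1)) \<longlonglongrightarrow> 0"
      by (rule tendsto_neg_powr[OF _ filterlim_real_sequentially]) (use s in simp)
    thus "(\<lambda>M. norm (s - 1) * norm s * norm (s + 1) * (2 * real M powr (- Re s - 1))) \<longlonglongrightarrow> 0"
      by (intro tendsto_mult_right_zero)
  qed
  have part: "(\<Sum>j<J. dirichlet_block j s) = S (4*J) - 3 * t * S (2*J) + 2 * (t * t) * S J" for J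
  proof (induction J)
    case 0
    show ?case by (simp add: S_def)
  next
    case (Suc J)
    have S4: "S (4 * Suc J) = S (4*J) + of_nat (4*J+1) powr (-s) + of_nat (4*J+2) powr (-s) + of_nat (4*J+3) powr (-s) + of_nat (4*J+4) powr (-s)"
    proof -
      have "4 * Suc J = Suc (Suc (Suc (Suc (4*J))))" by simp
      thus ?thesis unfolding S_def by (simp add: algebra_simps numeral_eq_Suc)
    qed
    have S2: "S (2 * Suc J) = S (2*J) + of_nat (2*J+1) powr (-s) + of_nat (2*J+2) powr (-s)"
    proof -
      have "2 * Suc J = Suc (Suc (2*J))" by simp
      thus ?thesis unfolding S_def by (simp add: algebra_simps numeral_eq_Suc)
    qed
    have S1: "S (Suc J) = S J + of_nat (J+1) powr (-s)" unfolding S_def by simp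
    have m1: "t * of_nat (2*J+1) powr (-s) = of_nat (4*J+2) powr (-s)"
      using powr_of_nat_mult[of 2 "2*J+1" "-s"] by (simp add: t_def algebra_simps)
    have m2: "t * of_nat (2*J+2) powr (-s) = of_nat (4*J+4) powr (-s)"
      using powr_of_nat_mult[of 2 "2*J+2" "-s"] by (simp add: t_def algebra_simps)
    have m3: "(t * t) * of_nat (J+1) powr (-s) = of_nat (4*J+4) powr (-s)"
      using powr_of_nat_mult[of 4 "J+1" "-s"] by (simp add: t4 algebra_simps)
    have "S (4 * Suc J) - 3 * t * S (2 * Suc J) + 2 * (t * t) * S (Suc J)
       = (S (4*J) - 3 * t * S (2*J) + 2 * (t * t) * S J) + of_nat (4*J+1) powr (-s) + of_nat (4*J+2) powr (-s) + of_nat (4*J+3) powr (-s) + of_nat (4*J+4) powr (-s)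
         - 3 * (t * of_nat (2*J+1) powr (-s)) - 3 * (t * of_nat (2*J+2) powr (-s)) + 2 * ((t * t) * of_nat (J+1) powr (-s))"
      unfolding S4 S2 S1 by (simp add: algebra_simps del: of_nat_add of_nat_mult of_nat_Suc)
    also have "\<dots> = (\<Sum>j<Suc J. dirichlet_block j s)"
      unfolding m1 m2 m3 sum.lessThan_Suc Suc.IH by (simp add: dirichlet_block_def algebra_simps del: of_nat_add of_nat_mult of_nat_Suc)
    finally show ?case ..
  qed
  have part2: "(s - 1) * (\<Sum>j<J. dirichlet_block j s) = E (4*J) - 3 * t * E (2*J) + 2 * (t * t) * E J" if "J \<ge> 1" for J
  proof -
    define u where "u = complex_of_nat J powr (-s)"
    have J0: "complex_of_nat J \<noteq> 0" using that by simp
    have p1: "of_nat (4*J) powr (-s) = t * t * u" "of_nat (2*J) powr (-s) = t * u"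
      using powr_of_nat_mult[of 4 J "-s"] powr_of_nat_mult[of 2 J "-s"] by (simp_all add: t4 t_def u_def)
    have p2: "complex_of_nat m powr (1 - s) = of_nat m * of_nat m powr (-s)" if "m > 0" for m
      using powr_add[of "of_nat m" 1 "-s"] that by simp
    have q: "of_nat (4*J) powr (1-s) = 4 * of_nat J * (t * t * u)" "of_nat (2*J) powr (1-s) = 2 * of_nat J * (t * u)"
      "of_nat J powr (1-s) = of_nat J * u"
      using that by (simp_all only: p2 p1 u_def) simp_all
    define v where "v = u / 2"
    have v: "u = 2 * v" by (simp add: v_def)
    show ?thesis unfolding part E_def p1 q u_def[symmetric] unfolding v by (simp add: algebra_simps)
  qed
  have "(\<lambda>J. E (4*J) - 3 * t * E (2*J) + 2 * (t * t) * E J) \<longlonglongrightarrow> zeta_reg s - 3 * t * zeta_reg s + 2 * (t * t) * zeta_reg s"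
    by (intro tendsto_intros Elim filterlim_compose[OF Elim] filterlim_subseq) (auto simp: strict_mono_def)
  hence "(\<lambda>J. (E (4*J) - 3 * t * E (2*J) + 2 * (t * t) * E J) / (s - 1)) \<longlonglongrightarrow> (zeta_reg s - 3 * t * zeta_reg s + 2 * (t * t) * zeta_reg s) / (s - 1)"
    by (rule tendsto_divide[OF _ tendsto_const]) (use s1 in auto)
  moreover have "\<forall>\<^sub>F J in sequentially. (E (4*J) - 3 * t * E (2*J) + 2 * (t * t) * E J) / (s - 1) = (\<Sum>j<J. dirichlet_block j s)"
    using eventually_ge_at_top[of 1]
  proof eventually_elim
    case (elim J)
    show ?case using part2[OF elim, symmetric] s1 by simp
  qed
  ultimately have "(\<lambda>J. \<Sum>j<J. dirichlet_block j s) \<longlonglongrightarrow> (zeta_reg s - 3 * t * zeta_reg s + 2 * (t * t) * zeta_reg s) / (s - 1)"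
    by (rule Lim_transform_eventually)
  also have "(zeta_reg s - 3 * t * zeta_reg s + 2 * (t * t) * zeta_reg s) / (s - 1)
     = zeta_reg s / (s - 1) * (1 - t) * (1 - 2 * t)"
    by (simp add: algebra_simps add_divide_distrib diff_divide_distrib)
  also have "2 * t = 2 powr (1 - s)" by (simp add: t_def powr_diff powr_minus field_simps)
  finally show ?thesis unfolding sums_def t_def .
qed

text \<open>
  Expand the integrand in exponentials: with q = exp(-x/2), the function (tanh(x/2) - tanh(x/4)) / 2
  is the power series in q whose coefficients are those of the Dirichlet blocks.
\<close>
lemma mellin_tanh_exp_side:
  assumes s: "0 < Re s" "Re s < 1"
  shows "(\<lambda>j. Gamma s * 2 powr s * dirichlet_block j s) sums
    (LINT x|lborel. indicator {0<..} x *\<^sub>R (complex_of_real x powr (s - 1) * of_real ((tanh (x / 2) - tanh (x / 4)) / 2)))"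
proof (rule mellin_sums[where w = "\<lambda>x. exp (- (1/2 * x))" and
   b = "\<lambda>j x. exp (- (real (4*j+1) / 2 * x)) - 2 * exp (- (real (4*j+2) / 2 * x)) + exp (- (real (4*j+3) / 2 * x))"])
  fix j :: nat
  define G where "G = (\<lambda>k::nat. Gamma s * of_real (real k / 2) powr (-s))"
  have G: "has_bochner_integral lborel (\<lambda>x. indicator {0<..} x *\<^sub>R (of_real x powr (s - 1) * of_real (exp (- (real k / 2 * x))))) (G k)"
    if "k > 0" for k unfolding G_def using that s by (intro Gamma_mellin) auto
  have G2: "G k = Gamma s * 2 powr s * of_nat k powr (-s)" if "k > 0" for k
  proof -
    have "complex_of_real (real k / 2) powr (-s) = of_real (real k) powr (-s) * of_real (1/2) powr (-s)"
      by (subst powr_times_real[symmetric]) auto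
    also have "complex_of_real (1/2) powr (-s) = 2 powr s"
    proof -
      have "Ln (1 / 2 :: complex) = - Ln 2"
        using Ln_inverse[of 2] by (simp add: inverse_eq_divide complex_nonpos_Reals_iff)
      thus ?thesis by (simp add: powr_def)
    qed
    finally show ?thesis unfolding G_def by simp
  qed
  have "has_bochner_integral lborel (\<lambda>x. indicator {0<..} x *\<^sub>R (of_real x powr (s - 1) * of_real (exp (- (real (4*j+1) / 2 * x))))
      - 2 * (indicator {0<..} x *\<^sub>R (of_real x powr (s - 1) * of_real (exp (- (real (4*j+2) / 2 * x)))))
      + indicator {0<..} x *\<^sub>R (of_real x powr (s - 1) * of_real (exp (- (real (4*j+3) / 2 * x))))) (G (4*j+1) - 2 * G (4*j+2) + G (4*j+3))"
    by (intro has_bochner_integral_add has_bochner_integral_diff has_bochner_integral_mult_right G) auto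
  also have "(\<lambda>x. indicator {0<..} x *\<^sub>R (of_real x powr (s - 1) * of_real (exp (- (real (4*j+1) / 2 * x))))
      - 2 * (indicator {0<..} x *\<^sub>R (of_real x powr (s - 1) * of_real (exp (- (real (4*j+2) / 2 * x)))))
      + indicator {0<..} x *\<^sub>R (of_real x powr (s - 1) * of_real (exp (- (real (4*j+3) / 2 * x)))))
    = (\<lambda>x. indicator {0<..} x *\<^sub>R (of_real x powr (s - 1) * complex_of_real (exp (- (real (4*j+1) / 2 * x)) - 2 * exp (- (real (4*j+2) / 2 * x)) + exp (- (real (4*j+3) / 2 * x)))))"
    by (auto simp: indicator_def algebra_simps)
  also have "G (4*j+1) - 2 * G (4*j+2) + G (4*j+3) = Gamma s * 2 powr s * dirichlet_block j s"
    unfolding dirichlet_block_def by (subst (1 2 3) G2) (auto simp: algebra_simps)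
  finally show "has_bochner_integral lborel (\<lambda>x. indicator {0<..} x *\<^sub>R (of_real x powr (s - 1) * complex_of_real (exp (- (real (4*j+1) / 2 * x)) - 2 * exp (- (real (4*j+2) / 2 * x)) + exp (- (real (4*j+3) / 2 * x))))) (Gamma s * 2 powr s * dirichlet_block j s)" .
next
  fix x :: real assume x: "x > 0"
  define q where "q = exp (- (x / 2))"
  have q: "0 < q" "q < 1" using x by (auto simp: q_def)
  have blk: "exp (- (real (4*j+1) / 2 * x)) - 2 * exp (- (real (4*j+2) / 2 * x)) + exp (- (real (4*j+3) / 2 * x)) = q * (1 - q)\<^sup>2 * (q^4)^j" for j
  proof -
    have e: "exp (- (real k / 2 * x)) = q ^ k" for k
      unfolding q_def by (simp add: exp_of_nat_mult[symmetric])
    show ?thesis unfolding e by (simp add: power_add power_mult power2_eq_square algebra_simps numeral_eq_Suc)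
  qed
  have q4: "0 < q^4" "q^4 < 1" using q by (auto simp: power_less_one_iff)
  have F: "(tanh (x / 2) - tanh (x / 4)) / 2 = q * (1 - q)\<^sup>2 / (1 - q^4)"
  proof -
    have t1: "tanh (x / 2) = (1 - q\<^sup>2) / (1 + q\<^sup>2)"
      unfolding tanh_real_altdef q_def by (simp add: exp_of_nat_mult[symmetric])
    have t2: "tanh (x / 4) = (1 - q) / (1 + q)"
      unfolding tanh_real_altdef q_def by simp
    have f: "1 - q^4 = (1 - q) * (1 + q) * (1 + q\<^sup>2)" by (simp add: power2_eq_square algebra_simps numeral_eq_Suc)
    have p: "1 + q\<^sup>2 > 0" "1 + q > 0" "1 - q > 0" using q by (auto intro: add_pos_nonneg)
    have "(tanh (x / 2) - tanh (x / 4)) / 2 = q * (1 - q) / ((1 + q) * (1 + q\<^sup>2))"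
      unfolding t1 t2 using p by (simp add: divide_simps) (simp add: power2_eq_square algebra_simps)
    also have "\<dots> = q * (1 - q)\<^sup>2 / (1 - q^4)"
      unfolding f using p by (simp add: power2_eq_square)
    finally show ?thesis .
  qed
  have sm: "(\<lambda>j. q * (1 - q)\<^sup>2 * (q^4)^j) sums ((tanh (x / 2) - tanh (x / 4)) / 2)"
    unfolding F using sums_mult[OF geometric_sums[of "q^4"], of "q * (1 - q)\<^sup>2"] q4 by simp
  show "(\<lambda>j. exp (- (real (4*j+1) / 2 * x)) - 2 * exp (- (real (4*j+2) / 2 * x)) + exp (- (real (4*j+3) / 2 * x))) sums ((tanh (x / 2) - tanh (x / 4)) / 2)"
    unfolding blk by (rule sm)
  fix J :: nat
  have "(\<Sum>j<J. q * (1 - q)\<^sup>2 * (q^4)^j) \<ge> 0" using q by (intro sum_nonneg) auto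
  moreover have "(\<Sum>j<J. q * (1 - q)\<^sup>2 * (q^4)^j) \<le> (tanh (x / 2) - tanh (x / 4)) / 2"
    using sum_le_suminf[OF sums_summable[OF sm], of "{..<J}"] sums_unique[OF sm] q by auto
  moreover have "(tanh (x / 2) - tanh (x / 4)) / 2 \<le> q"
  proof -
    have "q^4 \<le> q^1" using q by (intro power_decreasing) auto
    moreover have "(1 - q)\<^sup>2 \<le> 1 - q" using q by (simp add: power2_eq_square mult_left_le)
    ultimately have "(1 - q)\<^sup>2 \<le> 1 - q^4" by simp
    hence "q * (1 - q)\<^sup>2 \<le> q * (1 - q^4)" using q by (intro mult_left_mono) auto
    thus ?thesis unfolding F using q4 by (simp add: divide_simps)
  qed
  ultimately show "\<bar>\<Sum>j<J. exp (- (real (4*j+1) / 2 * x)) - 2 * exp (- (real (4*j+2) / 2 * x)) + exp (- (real (4*j+3) / 2 * x))\<bar> \<le> exp (- (1/2 * x))"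
    unfolding blk by (simp add: q_def)
next
  show "integrable lborel (\<lambda>x. indicator {0<..} x *\<^sub>R (complex_of_real x powr (s - 1) * of_real (exp (- (1/2 * x)))))"
    using Gamma_mellin[of s "1/2"] s by (auto simp: has_bochner_integral_iff)
qed

text \<open>
  Expand the same integrand by partial fractions of tanh. The term with index k has Mellin transform
  proportional to k powr (s - 1), so the same block coefficients appear, now at 1 - s.
\<close>
lemma mellin_tanh_fraction_side:
  assumes s: "0 < Re s" "Re s < 1"
  shows "(\<lambda>j. of_real pi powr (s - 1) * (Gamma ((1 + s) / 2) * Gamma ((1 - s) / 2)) * dirichlet_block j (1 - s)) sums
    (LINT x|lborel. indicator {0<..} x *\<^sub>R (complex_of_real x powr (s - 1) * of_real ((tanh (x / 2) - tanh (x / 4)) / 2)))"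
proof -
  define g where "g = (\<lambda>x k. 2 * x / (x\<^sup>2 + (real k * pi)\<^sup>2))"
  define K where "K = Gamma ((1 + s) / 2) * Gamma ((1 - s) / 2)"
  have dec: "g x k \<ge> g x k'" if "k \<le> k'" "x > 0" for x k k'
    unfolding g_def using that by (intro divide_left_mono add_left_mono power_mono mult_right_mono mult_pos_pos)
      (auto intro: add_pos_nonneg)
  have pos: "g x k \<ge> 0" if "x > 0" for x k using that unfolding g_def by (intro divide_nonneg_nonneg add_nonneg_nonneg) auto
  define I where "I = (\<lambda>k::nat. of_real (real k * pi) powr (s - 1) * K)"
  have I: "has_bochner_integral lborel (\<lambda>x. indicator {0<..} x *\<^sub>R (of_real x powr (s - 1) * of_real (g x k))) (I k)"
    if "k > 0" for k unfolding g_def I_def K_def using that s by (intro mellin_kernel) auto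
  have I2: "I k = of_real pi powr (s - 1) * K * of_nat k powr (-(1-s))" for k
  proof -
    have "complex_of_real (real k * pi) powr (s - 1) = of_real (real k) powr (s - 1) * of_real pi powr (s - 1)"
      by (subst of_real_mult, subst powr_times_real) auto
    thus ?thesis unfolding I_def by simp
  qed
  show ?thesis unfolding K_def[symmetric]
  proof (rule mellin_sums[where w = "\<lambda>x. g x 1" and b = "\<lambda>j x. g x (4*j+1) - 2 * g x (4*j+2) + g x (4*j+3)"])
    fix j :: nat
    have "has_bochner_integral lborel (\<lambda>x. indicator {0<..} x *\<^sub>R (of_real x powr (s - 1) * of_real (g x (4*j+1)))
        - 2 * (indicator {0<..} x *\<^sub>R (of_real x powr (s - 1) * of_real (g x (4*j+2))))
        + indicator {0<..} x *\<^sub>R (of_real x powr (s - 1) * of_real (g x (4*j+3)))) (I (4*j+1) - 2 * I (4*j+2) + I (4*j+3))"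
      by (intro has_bochner_integral_add has_bochner_integral_diff has_bochner_integral_mult_right I) auto
    also have "(\<lambda>x. indicator {0<..} x *\<^sub>R (of_real x powr (s - 1) * of_real (g x (4*j+1)))
        - 2 * (indicator {0<..} x *\<^sub>R (of_real x powr (s - 1) * of_real (g x (4*j+2))))
        + indicator {0<..} x *\<^sub>R (of_real x powr (s - 1) * of_real (g x (4*j+3))))
      = (\<lambda>x. indicator {0<..} x *\<^sub>R (of_real x powr (s - 1) * complex_of_real (g x (4*j+1) - 2 * g x (4*j+2) + g x (4*j+3))))"
      by (auto simp: indicator_def algebra_simps)
    also have "I (4*j+1) - 2 * I (4*j+2) + I (4*j+3) = of_real pi powr (s - 1) * K * dirichlet_block j (1 - s)"
      unfolding dirichlet_block_def I2 by (simp only: algebra_simps)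
    finally show "has_bochner_integral lborel (\<lambda>x. indicator {0<..} x *\<^sub>R (of_real x powr (s - 1) * complex_of_real (g x (4*j+1) - 2 * g x (4*j+2) + g x (4*j+3))))
        (of_real pi powr (s - 1) * K * dirichlet_block j (1 - s))" .
  next
    fix x :: real assume x: "x > 0"
    have 1: "(\<lambda>k. 2 * g x (2*k+1)) sums tanh (x / 2)"
      using tanh_half_sums[of x] by (simp add: g_def add.commute)
    have 2: "(\<lambda>k. 4 * g x (4*k+2)) sums tanh (x / 4)"
    proof -
      have "(\<lambda>k. 4 * (x / 2) / ((x / 2)\<^sup>2 + ((2 * real k + 1) * pi)\<^sup>2)) sums tanh ((x/2) / 2)"
        by (rule tanh_half_sums)
      also have "(\<lambda>k. 4 * (x / 2) / ((x / 2)\<^sup>2 + ((2 * real k + 1) * pi)\<^sup>2)) = (\<lambda>k. 4 * g x (4*k+2))"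
      proof
        fix k :: nat
        have "(x / 2)\<^sup>2 + ((2 * real k + 1) * pi)\<^sup>2 = (x\<^sup>2 + (real (4*k+2) * pi)\<^sup>2) / 4"
          by (simp add: field_simps power2_eq_square)
        thus "4 * (x / 2) / ((x / 2)\<^sup>2 + ((2 * real k + 1) * pi)\<^sup>2) = 4 * g x (4*k+2)"
          by (simp only: g_def) simp
      qed
      finally show ?thesis by simp
    qed
    have 3: "(\<lambda>j. 2 * g x (4*j+1) + 2 * g x (4*j+3)) sums tanh (x / 2)"
    proof -
      have "(\<lambda>j. sum (\<lambda>k. 2 * g x (2*k+1)) {j * 2..<j * 2 + 2}) sums tanh (x / 2)"
        by (rule sums_group[OF 1]) simp
      also have "(\<lambda>j. sum (\<lambda>k. 2 * g x (2*k+1)) {j * 2..<j * 2 + 2}) = (\<lambda>j. 2 * g x (4*j+1) + 2 * g x (4*j+3))"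
      proof
        fix j :: nat
        have 1: "{j * 2..<j * 2 + 2} = {2*j, 2*j+1}" by auto
        have 2: "2 * (2 * j) + 1 = 4 * j + 1" "2 * (2 * j + 1) + 1 = 4 * j + 3" by simp_all
        have 3: "sum h {2*j, 2*j+1} = h (2*j) + h (2*j+1)" for h :: "nat \<Rightarrow> real" by simp
        show "sum (\<lambda>k. 2 * g x (2*k+1)) {j * 2..<j * 2 + 2} = 2 * g x (4*j+1) + 2 * g x (4*j+3)"
          by (simp only: 1 3 2)
      qed
      finally show ?thesis .
    qed
    have "(\<lambda>j. ((2 * g x (4*j+1) + 2 * g x (4*j+3)) - 4 * g x (4*j+2)) / 2) sums ((tanh (x / 2) - tanh (x / 4)) / 2)"
      by (intro sums_divide sums_diff 2 3)
    thus "(\<lambda>j. g x (4*j+1) - 2 * g x (4*j+2) + g x (4*j+3)) sums ((tanh (x / 2) - tanh (x / 4)) / 2)"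
      by (simp add: add_divide_distrib diff_divide_distrib algebra_simps)
    fix J :: nat
    have "\<bar>\<Sum>j<J. g x (4*j+1) - 2 * g x (4*j+2) + g x (4*j+3)\<bar> \<le> g x 1 - g x (4*J+1)"
    proof (induction J)
      case (Suc J)
      have "\<bar>g x (4*J+1) - 2 * g x (4*J+2) + g x (4*J+3)\<bar> \<le> g x (4*J+1) - g x (4*Suc J+1)"
        using dec[of "4*J+1" "4*J+2" x] dec[of "4*J+2" "4*J+3" x] dec[of "4*J+3" "4*Suc J+1" x] x by auto
      thus ?case using Suc.IH by simp
    qed auto
    thus "\<bar>\<Sum>j<J. g x (4*j+1) - 2 * g x (4*j+2) + g x (4*j+3)\<bar> \<le> g x 1"
      using pos[OF x, of "4*J+1"] by linarith
  next
    show "integrable lborel (\<lambda>x. indicator {0<..} x *\<^sub>R (complex_of_real x powr (s - 1) * of_real (g x 1)))"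
      using I[of 1] by (auto simp: has_bochner_integral_iff)
  qed
qed

text \<open>
  Equate the two evaluations. The product (1 - 2 powr (-s)) (1 - 2 powr (1 - s)) reproduces itself under s \<rightarrow> 1 - s up to
  a power of 2 and does not vanish inside the strip, so it cancels.
\<close>
lemma zeta_reg_functional_equation:
  assumes s: "0 < Re s" "Re s < 1"
  shows "2 powr (1 - s) * Gamma s * (zeta_reg s / (s - 1)) =
    of_real pi powr (s - 1) * (Gamma ((1 + s) / 2) * Gamma ((1 - s) / 2)) * (zeta_reg (1 - s) / (- s))"
proof -
  define K where "K = of_real pi powr (s - 1) * (Gamma ((1 + s) / 2) * Gamma ((1 - s) / 2))"
  define t where "t = (2::complex) powr s"
  have t0: "t \<noteq> 0" by (simp add: t_def)
  have nt: "norm t = 2 powr Re s" unfolding t_def by (simp add: norm_powr_real_powr)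
  have n1: "norm t > 1" unfolding nt using s powr_less_mono[of 0 "Re s" 2] by simp
  have n2: "norm t < 2" unfolding nt using s powr_less_mono[of "Re s" 1 2] by simp
  have t1: "t \<noteq> 1" "t \<noteq> 2" using n1 n2 by auto
  have pw: "2 powr (-s) = 1 / t" "2 powr (1 - s) = 2 / t" "2 powr (-(1 - s)) = t / 2" "2 powr (1 - (1 - s)) = t"
    by (simp_all add: t_def powr_minus powr_diff field_simps)
  have A: "(\<lambda>j. Gamma s * t * dirichlet_block j s) sums (Gamma s * t * (zeta_reg s / (s - 1) * (1 - 1 / t) * (1 - 2 / t)))"
    using sums_mult[OF dirichlet_block_sums[OF s], of "Gamma s * t"] unfolding pw .
  have B: "(\<lambda>j. K * dirichlet_block j (1 - s)) sums (K * (zeta_reg (1 - s) / ((1 - s) - 1) * (1 - t / 2) * (1 - t)))"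
    using sums_mult[OF dirichlet_block_sums[of "1 - s"], of K] s unfolding pw by simp
  have "Gamma s * t * (zeta_reg s / (s - 1) * (1 - 1 / t) * (1 - 2 / t)) = K * (zeta_reg (1 - s) / ((1 - s) - 1) * (1 - t / 2) * (1 - t))"
    using sums_unique2[OF A mellin_tanh_exp_side[OF s, folded t_def]] 
      sums_unique2[OF B mellin_tanh_fraction_side[OF s, folded K_def]] by simp
  also have "Gamma s * t * (zeta_reg s / (s - 1) * (1 - 1 / t) * (1 - 2 / t)) = 
     (2 / t * Gamma s * (zeta_reg s / (s - 1))) * ((t - 1) * (t - 2) / 2)"
    using t0 by (simp add: divide_simps) 
  also have "K * (zeta_reg (1 - s) / ((1 - s) - 1) * (1 - t / 2) * (1 - t)) = (K * (zeta_reg (1 - s) / (- s))) * ((t - 1) * (t - 2) / 2)"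
    by (simp add: field_simps)
  finally have "2 / t * Gamma s * (zeta_reg s / (s - 1)) = K * (zeta_reg (1 - s) / (- s))"
    using t1 by (subst (asm) mult_right_cancel) auto
  thus ?thesis unfolding pw K_def .
qed

section \<open>The zeta-function and the Hardy function\<close>

definition zeta_left :: "complex \<Rightarrow> complex" where
  "zeta_left s = 2 powr s * of_real pi powr (s - 1) * sin (of_real pi * s / 2) * Gamma (1 - s) * (zeta_reg (1 - s) / (- s))"

lemma zeta_left_strip:
  assumes s: "0 < Re s" "Re s < 1"
  shows "zeta_reg s / (s - 1) = zeta_left s"
proof -
  define C where "C = cos (of_real pi * s / 2)"
  define S where "S = sin (of_real pi * s / 2)"
  define Z where "Z = zeta_reg s / (s - 1)"
  define Z' where "Z' = zeta_reg (1 - s) / (- s)"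
  have sZ: "s \<notin> \<int>" using s by (auto simp: Ints_def)
  have "sin (of_real pi * s) = 2 * S * C"
    using sin_double[of "of_real pi * s / 2"] by (simp add: S_def C_def)
  moreover have "sin (of_real pi * s) \<noteq> 0"
    using sZ by (auto simp: sin_eq_0 Ints_def)
  ultimately have SC: "S \<noteq> 0" "C \<noteq> 0" "Gamma s * Gamma (1 - s) = of_real pi / (2 * S * C)"
    using Gamma_reflection_complex[of s] by auto
  have GC: "Gamma ((1 + s) / 2) * Gamma ((1 - s) / 2) = of_real pi / C"
  proof -
    have e1: "1 - (1 + s) / 2 = (1 - s) / 2" by (simp add: field_simps)
    have e2: "of_real pi * ((1 + s) / 2) = of_real pi / 2 + of_real pi * s / 2" by (simp add: field_simps)
    have "sin (of_real pi * ((1 + s) / 2)) = C"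
      unfolding e2 C_def by (simp add: sin_add)
    thus ?thesis using Gamma_reflection_complex[of "(1 + s) / 2"] unfolding e1 by simp
  qed
  define G' where "G' = Gamma (1 - s)"
  have G': "G' \<noteq> 0" using SC by (auto simp: G'_def)
  have G: "Gamma s = of_real pi / (2 * S * C) / G'" using SC(3) by (simp only: nonzero_eq_divide_eq[OF G']) (simp add: G'_def)
  define t where "t = (2::complex) powr s"
  have t: "t \<noteq> 0" by (simp add: t_def)
  define P where "P = complex_of_real pi powr (s - 1)"
  have "2 / t * (of_real pi / (2 * S * C) / G') * Z = P * (of_real pi / C) * Z'"
    using zeta_reg_functional_equation[OF s] unfolding GC G[symmetric]
    by (simp add: Z_def Z'_def P_def t_def powr_diff)
  hence "Z = t * P * S * G' * Z'"
    using t G' SC by (simp add: field_simps)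
  thus ?thesis unfolding zeta_left_def Z_def Z'_def P_def t_def G'_def S_def .
qed

lemma zeta_reg_quotient_holomorphic: "(\<lambda>s. zeta_reg s / (s - 1)) holomorphic_on ({s. Re s > -1} - {1})"
  using zeta_reg_holomorphic by (auto intro!: holomorphic_intros elim: holomorphic_on_subset)

lemma zeta_left_holomorphic: "zeta_left holomorphic_on ({s. Re s < 1} - {0})"
proof -
  have 1: "(\<lambda>s. zeta_reg (1 - s)) holomorphic_on ({s. Re s < 1} - {0})"
  proof -
    have "(zeta_reg \<circ> (\<lambda>s. 1 - s)) holomorphic_on ({s. Re s < 1} - {0})"
      by (rule holomorphic_on_compose_gen[OF _ zeta_reg_holomorphic]) (auto intro!: holomorphic_intros)
    thus ?thesis by (simp add: o_def)
  qed
  have 2: "1 - s \<notin> \<int>\<^sub>\<le>\<^sub>0" if "Re s < 1" for s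
    using that by (auto simp: nonpos_Ints_def dest: arg_cong[where f = Re])
  show ?thesis unfolding zeta_left_def[abs_def]
    by (intro holomorphic_intros 1) (auto simp: 2)
qed

lemma zeta_left_eq:
  assumes "-1 < Re s" "Re s < 1" "s \<noteq> 0"
  shows "zeta_reg s / (s - 1) = zeta_left s"
proof (rule analytic_continuation_open[where f = "\<lambda>s. zeta_reg s / (s - 1)" and g = zeta_left and s = "{s. 0 < Re s \<and> Re s < 1}" and s' = "{s. -1 < Re s \<and> Re s < 1} - {0}"])
  have op: "open {s. a < Re s \<and> Re s < b}" for a b
    by (intro open_Collect_conj open_halfspace_Re_gt open_halfspace_Re_lt)
  show "open {s. 0 < Re s \<and> Re s < 1}" by (rule op)
  show "open ({s. -1 < Re s \<and> Re s < 1} - {0})" by (intro open_delete op)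
  show "{s. 0 < Re s \<and> Re s < 1} \<noteq> {}" by (auto intro!: exI[of _ "1/2"])
  have "convex {s. -1 < Re s \<and> Re s < 1}"
    using convex_Int[OF convex_halfspace_Re_gt[of "-1"] convex_halfspace_Re_lt[of 1]] by (simp add: Collect_conj_eq)
  thus "connected ({s. -1 < Re s \<and> Re s < 1} - {0})"
    by (intro connected_open_diff_countable op convex_connected) auto
  show "(\<lambda>s. zeta_reg s / (s - 1)) holomorphic_on ({s. -1 < Re s \<and> Re s < 1} - {0})"
    by (rule holomorphic_on_subset[OF zeta_reg_quotient_holomorphic]) auto
  show "zeta_left holomorphic_on ({s. -1 < Re s \<and> Re s < 1} - {0})"
    by (rule holomorphic_on_subset[OF zeta_left_holomorphic]) auto
qed (use assms zeta_left_strip in auto)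

text \<open>
  The two half-plane expressions agree where both are defined, so they glue to a function with the defining
  properties; uniqueness is the identity theorem on the connected set - {1}. The value at 1 comes out right
  since division by zero yields zero.
\<close>
lemma zeta_characterization:
  "zeta holomorphic_on (- {1}) \<and> (\<forall>s. Re s > 1 \<longrightarrow> (\<lambda>n. 1 / of_nat (Suc n) powr s) sums zeta s) \<and> zeta 1 = 0"
  "zeta s = (if Re s > -1 then zeta_reg s / (s - 1) else zeta_left s)"
proof -
  define P :: "(complex \<Rightarrow> complex) \<Rightarrow> bool" where
    "P = (\<lambda>f. f holomorphic_on (- {1}) \<and> (\<forall>s. Re s > 1 \<longrightarrow> (\<lambda>n. 1 / of_nat (Suc n) powr s) sums f s) \<and> f 1 = 0)"
  define g where "g = (\<lambda>s. if Re s > -1 then zeta_reg s / (s - 1) else zeta_left s)"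
  have "P g" unfolding P_def
  proof (intro conjI allI impI)
    have zl: "zeta_left s = zeta_reg s / (s - 1)" if "-1 < Re s" "Re s < 0" for s
      using zeta_left_eq[of s] that by fastforce
    have "g holomorphic_on ({s. Re s > -1} - {1}) \<union> {s. Re s < 0}"
    proof (rule holomorphic_on_Un)
      show "g holomorphic_on ({s. Re s > -1} - {1})"
        by (rule holomorphic_transform[OF zeta_reg_quotient_holomorphic]) (auto simp: g_def)
      show "g holomorphic_on {s. Re s < 0}"
        by (rule holomorphic_transform[OF holomorphic_on_subset[OF zeta_left_holomorphic]])
           (auto simp: g_def zl)
    qed (auto intro: open_delete open_halfspace_Re_gt open_halfspace_Re_lt)
    also have "({s. Re s > -1} - {1}) \<union> {s. Re s < 0} = - {1}" by auto
    finally show "g holomorphic_on - {1}" .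
    show "(\<lambda>n. 1 / of_nat (Suc n) powr s) sums g s" if "Re s > 1" for s
      using zeta_reg_sums[OF that] that by (simp add: g_def)
    show "g 1 = 0" by (simp add: g_def)
  qed
  moreover have "f = g" if "P f" for f
  proof
    fix s
    show "f s = g s"
    proof (cases "s = 1")
      case False
      show ?thesis
      proof (rule analytic_continuation_open[where f = f and g = g and s = "{s. Re s > 1}" and s' = "- {1}"])
        show "open {s. Re s > 1}" by (rule open_halfspace_Re_gt)
        show "{s. Re s > 1} \<noteq> {}" by (auto intro!: exI[of _ 2])
        show "connected (- {1::complex})" by (rule connected_punctured_universe) auto
        show "f z = g z" if "z \<in> {s. Re s > 1}" for z
          using \<open>P f\<close> \<open>P g\<close> that unfolding P_def by (auto intro: sums_unique2)
      qed (use that \<open>P g\<close> False in \<open>auto simp: P_def\<close>)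
    qed (use that \<open>P g\<close> in \<open>auto simp: P_def\<close>)
  qed
  ultimately have "(THE f. P f) = g" by (rule the_equality)
  hence "zeta = g" by (simp add: zeta_def P_def)
  thus "zeta holomorphic_on (- {1}) \<and> (\<forall>s. Re s > 1 \<longrightarrow> (\<lambda>n. 1 / of_nat (Suc n) powr s) sums zeta s) \<and> zeta 1 = 0"
    using \<open>P g\<close> by (auto simp: P_def)
  show "zeta s = (if Re s > -1 then zeta_reg s / (s - 1) else zeta_left s)"
    by (simp only: \<open>zeta = g\<close> g_def)
qed

lemma zeta_eq_zeta_reg: "Re s > -1 \<Longrightarrow> zeta s = zeta_reg s / (s - 1)"
  by (simp add: zeta_characterization(2))

lemma zeta_holomorphic: "zeta holomorphic_on - {1}"
  using zeta_characterization(1) by blast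

lemma cnj_zeta_reg: "Re s > -1 \<Longrightarrow> cnj (zeta_reg s) = zeta_reg (cnj s)"
proof -
  assume s: "Re s > -1"
  have cp: "cnj (of_nat n powr z) = of_nat n powr cnj z" for n z
    by (cases "n = 0") (auto simp: cnj_powr complex_nonpos_Reals_iff)
  have "(\<lambda>n. zeta_step n s) sums (\<Sum>n. zeta_step n s)"
    by (intro summable_sums summable_norm_cancel[OF summable_zeta_step] s)
  hence "(\<lambda>n. cnj (zeta_step n s)) sums cnj (\<Sum>n. zeta_step n s)" by (simp add: sums_cnj)
  also have "(\<lambda>n. cnj (zeta_step n s)) = (\<lambda>n. zeta_step n (cnj s))"
    unfolding zeta_step_def by (simp add: cp del: of_nat_Suc)
  finally have "cnj (\<Sum>n. zeta_step n s) = (\<Sum>n. zeta_step n (cnj s))" by (rule sums_unique)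
  thus ?thesis by (simp add: zeta_reg_def)
qed

text \<open>
  On the critical line the functional equation relates \<zeta>(1/2 + it) to its complex conjugate by the factor
  Gamma(1/4 - it/2) / Gamma(1/4 + it/2) times a power of \<pi>, and that factor is exp(-2 i \<theta>(t)).
\<close>
lemma hardy_Z_complex:
  "complex_of_real (hardy_Z t) = exp (\<i> * of_real (rs_theta t)) * zeta (Complex (1/2) t)"
proof -
  define s where "s = Complex (1/2) t"
  have s: "0 < Re s" "Re s < 1" "s \<noteq> 1" by (auto simp: s_def complex_eq_iff)
  have cs: "1 - s = cnj s" by (auto simp: s_def complex_eq_iff)
  have n1: "s / 2 \<notin> \<int>\<^sub>\<le>\<^sub>0" "s / 2 + 1/2 \<notin> \<int>\<^sub>\<le>\<^sub>0"
  proof -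
    have "z \<notin> \<int>\<^sub>\<le>\<^sub>0" if "Re z > 0" for z using that by (auto simp: nonpos_Ints_def)
    thus "s / 2 \<notin> \<int>\<^sub>\<le>\<^sub>0" "s / 2 + 1/2 \<notin> \<int>\<^sub>\<le>\<^sub>0" by (auto simp: s_def)
  qed
  define g where "g = Gamma (s / 2)"
  have g0: "g \<noteq> 0" using n1 by (simp add: g_def Gamma_eq_zero_iff)
  define h where "h = Gamma (s / 2 + 1/2)"
  have h0: "h \<noteq> 0" using n1 by (simp add: h_def Gamma_eq_zero_iff)
  define L where "L = ln_Gamma (s / 2)"
  have gL: "g = exp L" using n1 by (simp add: g_def L_def Gamma_complex_altdef)
  have dup: "g * h = 2 powr (1 - s) * of_real (sqrt pi) * Gamma s"
    using Gamma_legendre_duplication[OF n1] unfolding g_def h_def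
    using Ln_of_real[of 2] by (simp add: powr_def)
  have zs: "zeta s = zeta_reg s / (s - 1)" using s by (intro zeta_eq_zeta_reg) auto
  have zc: "cnj (zeta s) = zeta_reg (1 - s) / (- s)"
  proof -
    have "cnj (zeta s) = zeta_reg (cnj s) / (cnj s - 1)"
      using cnj_zeta_reg[of s] s(1) unfolding zs by simp
    thus ?thesis unfolding cs[symmetric] by simp
  qed
  have gc: "cnj g = Gamma ((1 - s) / 2)" by (simp add: g_def cnj_Gamma cs)
  have h': "h = Gamma ((1 + s) / 2)" by (simp add: h_def add_divide_distrib add.commute)
  have "2 powr (1 - s) * Gamma s * zeta s = of_real pi powr (s - 1) * (h * cnj g) * cnj (zeta s)"
    using zeta_reg_functional_equation[OF s(1,2)] unfolding zc unfolding zs gc h' .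
  hence "g * h * zeta s = of_real (sqrt pi) * of_real pi powr (s - 1) * (h * cnj g) * cnj (zeta s)"
    unfolding dup by (simp add: mult_ac)
  moreover have "of_real (sqrt pi) * of_real pi powr (s - 1) = complex_of_real pi powr (\<i> * of_real t)"
  proof -
    have "complex_of_real (sqrt pi) = of_real pi powr (1/2)"
      using powr_of_real[of pi "1/2"] by (simp add: powr_half_sqrt)
    moreover have "1/2 + (s - 1) = \<i> * of_real t" by (simp add: s_def complex_eq_iff)
    ultimately show ?thesis by (simp only: powr_add[symmetric])
  qed
  ultimately have fe: "g * zeta s = of_real pi powr (\<i> * of_real t) * cnj (g * zeta s)"
  proof -
    assume "g * h * zeta s = of_real (sqrt pi) * of_real pi powr (s - 1) * (h * cnj g) * cnj (zeta s)"
      and e: "of_real (sqrt pi) * of_real pi powr (s - 1) = complex_of_real pi powr (\<i> * of_real t)"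
    hence "h * (g * zeta s) = h * (of_real pi powr (\<i> * of_real t) * cnj (g * zeta s))"
      by (simp only: e complex_cnj_mult mult_ac)
    thus ?thesis by (rule mult_left_cancel[OF h0, THEN iffD1])
  qed
  define W where "W = exp (\<i> * of_real (rs_theta t)) * zeta s"
  define q where "q = exp (- \<i> * of_real (t / 2 * ln pi))"
  have q: "of_real pi powr (\<i> * of_real t) * q = cnj q" 
    unfolding q_def by (simp add: powr_def Ln_of_real exp_cnj exp_add[symmetric])
  have gabs: "g = exp (\<i> * of_real (Im L)) * of_real (norm g)"
  proof -
    have "L = of_real (Re L) + \<i> * of_real (Im L)" by (simp add: complex_eq_iff)
    hence e: "exp L = exp (of_real (Re L)) * exp (\<i> * of_real (Im L))" by (metis exp_add)
    show ?thesis unfolding gL norm_exp_eq_Re by (subst e) (simp add: exp_of_real)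
  qed
  have "s / 2 = Complex (1/4) (t/2)" by (simp add: s_def complex_eq_iff)
  hence th: "exp (\<i> * of_real (rs_theta t)) = exp (\<i> * of_real (Im L)) * q"
    unfolding rs_theta_def q_def L_def exp_add[symmetric] by (simp add: algebra_simps)
  have Wg: "W * of_real (norm g) = g * zeta s * q"
    unfolding W_def th by (subst (2) gabs) simp
  have "cnj (W * of_real (norm g)) = cnj (g * zeta s) * cnj q"
    unfolding Wg by simp
  also have "\<dots> = W * of_real (norm g)"
    unfolding Wg q[symmetric] by (subst (2) fe) (simp add: mult_ac)
  finally have "cnj W = W" using g0 by simp
  hence "of_real (Re W) = W" by (simp add: complex_eq_iff)
  thus ?thesis unfolding hardy_Z_def W_def s_def .
qed

lemma abs_hardy_Z: "\<bar>hardy_Z t\<bar> = norm (zeta (Complex (1/2) t))"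
proof -
  have "\<bar>hardy_Z t\<bar> = norm (complex_of_real (hardy_Z t))" by simp
  thus ?thesis unfolding hardy_Z_complex by (simp add: norm_mult)
qed

lemma continuous_on_zeta_line [continuous_intros]: "continuous_on A (\<lambda>t. zeta (Complex (1/2) t))"
proof -
  have "continuous_on (- {1}) zeta" using zeta_holomorphic by (rule holomorphic_on_imp_continuous_on)
  thus ?thesis 
    by (rule continuous_on_compose2) (auto simp: complex_eq_iff intro!: continuous_on_Complex continuous_intros)
qed

lemma continuous_on_rs_theta [continuous_intros]: "continuous_on A rs_theta"
proof -
  have "continuous_on {z. Re z > 0} (ln_Gamma :: complex \<Rightarrow> complex)"
    by (intro continuous_on_ln_Gamma_complex) (auto simp: complex_nonpos_Reals_iff)
  hence "continuous_on A (\<lambda>t. ln_Gamma (Complex (1/4) (t/2)))"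
    by (rule continuous_on_compose2) (auto intro!: continuous_on_Complex continuous_intros)
  thus ?thesis unfolding rs_theta_def[abs_def] by (intro continuous_intros) auto
qed

lemma continuous_on_hardy_Z: "continuous_on A hardy_Z"
  unfolding hardy_Z_def[abs_def] by (intro continuous_intros)

section \<open>The Chebyshev function\<close>

definition psi :: "nat \<Rightarrow> real" where "psi n = (\<Sum>k=1..n. mangoldt k)"

lemma card_multiples: "d > 0 \<Longrightarrow> card {k\<in>{1..m}. d dvd k} = m div (d::nat)"
proof -
  assume d: "d > 0"
  have "bij_betw (\<lambda>j. d * j) {1..m div d} {k\<in>{1..m}. d dvd k}"
  proof (rule bij_betwI[where g = "\<lambda>k. k div d"])
    show "(\<lambda>j. d * j) \<in> {1..m div d} \<rightarrow> {k\<in>{1..m}. d dvd k}"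
      using d by (auto simp: less_eq_div_iff_mult_less_eq mult.commute)
    show "(\<lambda>k. k div d) \<in> {k\<in>{1..m}. d dvd k} \<rightarrow> {1..m div d}"
      using d div_le_mono[of "d * _" m d] by (auto elim!: dvdE)
  qed (use d in auto)
  thus ?thesis by (simp add: bij_betw_same_card[symmetric])
qed

lemma ln_fact_mangoldt:
  assumes "m \<le> N"
  shows "ln (fact m) = (\<Sum>d=1..N. mangoldt d * real (m div d))"
proof -
  have "ln (fact m) = (\<Sum>k=1..m. ln (real k))"
    unfolding fact_prod by (subst of_nat_prod, subst ln_prod) auto
  also have "\<dots> = (\<Sum>k=1..m. \<Sum>d | d dvd k. mangoldt d)"
    using mangoldt_sum[where 'a = real] by (intro sum.cong) auto
  also have "\<dots> = (\<Sum>k=1..m. \<Sum>d=1..N. if d dvd k then mangoldt d else 0)"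
  proof (rule sum.cong[OF refl])
    fix k assume k: "k \<in> {1..m}"
    have "{d. d dvd k} = {1..N} \<inter> {d. d dvd k}"
    proof -
      have "d \<ge> 1 \<and> d \<le> N" if "d dvd k" for d
        using that k assms dvd_imp_le[of d k] dvd_pos_nat[of k d] by auto
      thus ?thesis by auto
    qed
    thus "(\<Sum>d | d dvd k. mangoldt d) = (\<Sum>d=1..N. if d dvd k then (mangoldt d :: real) else 0)"
      by (simp add: sum.If_cases)
  qed
  also have "\<dots> = (\<Sum>d=1..N. \<Sum>k=1..m. if d dvd k then mangoldt d else 0)" by (rule sum.swap)
  also have "\<dots> = (\<Sum>d=1..N. mangoldt d * real (m div d))"
  proof (intro sum.cong refl)
    fix d assume d: "d \<in> {1..N}"
    have "{1..m} \<inter> {k. d dvd k} = {k\<in>{1..m}. d dvd k}" by auto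
    thus "(\<Sum>k=1..m. if d dvd k then (mangoldt d::real) else 0) = mangoldt d * real (m div d)"
      using card_multiples[of d m] d by (simp add: sum.If_cases)
  qed
  finally show ?thesis .
qed

lemma psi_nonneg: "psi n \<ge> 0" and psi_mono: "m \<le> n \<Longrightarrow> psi m \<le> psi n"
  unfolding psi_def by (auto intro!: sum_nonneg sum_mono2 mangoldt_nonneg)

text \<open>
  The weights floor(2m/d) - 2 floor(m/d) are nonnegative, and equal 1 for m < d; summed against the
  Mangoldt function they give the logarithm of the central binomial coefficient, which is at
  most 2 m ln 2.
\<close>
lemma psi_double: "psi (2 * m) - psi m \<le> 2 * real m"
proof -
  have "psi (2 * m) - psi m = (\<Sum>d=m+1..2*m. mangoldt d)"
  proof -
    have "{1..2*m} = {1..m} \<union> {m+1..2*m}" by auto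
    hence "(\<Sum>d=1..2*m. mangoldt d) = (\<Sum>d=1..m. mangoldt d) + (\<Sum>d=m+1..2*m. mangoldt d :: real)"
      by (simp only:) (rule sum.union_disjoint, auto)
    thus ?thesis unfolding psi_def by simp
  qed
  also have "\<dots> = (\<Sum>d=m+1..2*m. mangoldt d * (real (2*m div d) - 2 * real (m div d)))"
  proof (intro sum.cong refl)
    fix d assume d: "d \<in> {m+1..2*m}"
    hence "m div d = 0" by auto
    moreover have "2 * m div d = 1" using d by (intro div_nat_eqI) auto
    ultimately show "mangoldt d = mangoldt d * (real (2*m div d) - 2 * real (m div d))" by simp
  qed
  also have "\<dots> \<le> (\<Sum>d=1..2*m. mangoldt d * (real (2*m div d) - 2 * real (m div d)))"
  proof (intro sum_mono2)
    fix d assume "d \<in> {1..2*m} - {m+1..2*m}"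
    have "2 * (m div d) \<le> 2 * m div d"
    proof (cases "d = 0")
      case False
      have "2 * (m div d) * d \<le> 2 * m" using div_times_less_eq_dividend[of m d] by simp
      thus ?thesis using False by (simp add: less_eq_div_iff_mult_less_eq)
    qed auto
    hence "real (2*m div d) - 2 * real (m div d) \<ge> 0" by linarith
    thus "0 \<le> mangoldt d * (real (2*m div d) - 2 * real (m div d))"
      by (intro mult_nonneg_nonneg mangoldt_nonneg)
  qed auto
  also have "\<dots> = ln (fact (2 * m)) - 2 * ln (fact m)"
  proof -
    have 1: "ln (fact (2 * m)) = (\<Sum>d=1..2*m. mangoldt d * real (2 * m div d))"
      by (rule ln_fact_mangoldt) simp
    have 2: "ln (fact m) = (\<Sum>d=1..2*m. mangoldt d * real (m div d))"
      by (rule ln_fact_mangoldt) simp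
    show ?thesis unfolding 1 2
      by (simp add: sum_subtractf sum_distrib_left right_diff_distrib mult.left_commute)
  qed
  also have "\<dots> = ln (fact (2 * m) / (fact m * fact m))"
    by (simp add: ln_div ln_mult)
  also have "fact (2 * m) / (fact m * fact m) = real ((2 * m) choose m)"
    using binomial_fact[of m "2*m", where 'a = real] by simp
  also have "ln \<dots> \<le> ln (2 ^ (2 * m))"
  proof -
    have "real ((2 * m) choose m) \<le> real (2 ^ (2 * m))"
      using binomial_le_pow2[of "2*m" m] by (simp only: of_nat_le_iff)
    moreover have "real ((2 * m) choose m) > 0" by simp
    ultimately show ?thesis by (subst ln_le_cancel_iff) auto
  qed
  also have "\<dots> = 2 * real m * ln 2" by (simp add: ln_realpow)
  also have "\<dots> \<le> 2 * real m * 1" using ln_2_less_1 by (intro mult_left_mono) auto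
  finally show ?thesis by simp
qed

lemma psi_le: "psi n \<le> 6 * real n"
proof (induction n rule: less_induct)
  case (less n)
  show ?case
  proof (cases "n < 2")
    case True
    hence "n = 0 \<or> n = 1" by auto
    thus ?thesis by (auto simp: psi_def)
  next
    case False
    define m where "m = (n + 1) div 2"
    have m: "m < n" "n \<le> 2 * m" "2 * m \<le> n + 1" using False by (auto simp: m_def)
    have "psi n \<le> psi (2 * m)" by (rule psi_mono) (use m in auto)
    also have "\<dots> \<le> 6 * real m + 2 * real m" using psi_double[of m] less.IH[OF m(1)] by linarith
    also have "\<dots> \<le> 6 * real n" using m False by linarith
    finally show ?thesis .
  qed
qed

lemma Abel_psi:
  fixes w :: "nat \<Rightarrow> complex"
  shows "(\<Sum>n=1..N. (of_real (mangoldt n) - 1) * w n) = 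
    (\<Sum>n=1..N. of_real (psi n - real n) * (w n - w (Suc n))) + of_real (psi N - real N) * w (Suc N)"
proof (induction N)
  case (Suc N)
  have p: "psi (Suc N) = psi N + mangoldt (Suc N)" by (simp add: psi_def)
  define A where "A = (\<Sum>n=1..N. of_real (psi n - real n) * (w n - w (Suc n)))"
  have 1: "(\<Sum>n=1..Suc N. (of_real (mangoldt n) - 1) * w n) = 
     A + of_real (psi N - real N) * w (Suc N) + (of_real (mangoldt (Suc N)) - 1) * w (Suc N)"
    using Suc.IH by (simp add: A_def)
  have 2: "(\<Sum>n=1..Suc N. of_real (psi n - real n) * (w n - w (Suc n))) =
     A + of_real (psi (Suc N) - real (Suc N)) * (w (Suc N) - w (Suc (Suc N)))"
    by (simp add: A_def)
  show ?case unfolding 1 2 p by (simp add: algebra_simps)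
qed (simp add: psi_def)

section \<open>The logarithmic derivative of the zeta-function\<close>

abbreviation mangoldt_series :: "complex \<Rightarrow> complex" where "mangoldt_series s \<equiv> (\<Sum>n. of_real (mangoldt n) * of_nat n powr (-s))"

lemma summable_ln_powr:
  assumes "a > 1"
  shows "summable (\<lambda>n. ln (real n) * real n powr (-a))"
proof (rule summable_comparison_test')
  define b where "b = (a - 1) / 2"
  have b: "b > 0" using assms by (simp add: b_def)
  show "summable (\<lambda>n. 1 / b * real n powr (b - a))"
    using b assms by (intro summable_mult) (auto simp: summable_real_powr_iff b_def field_simps)
  fix n :: nat assume n: "n \<ge> 1"
  have "ln (real n) \<le> real n powr b / b" using n b by (intro ln_powr_bound) auto
  hence "ln (real n) * real n powr (-a) \<le> (real n powr b / b) * real n powr (-a)"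
    by (intro mult_right_mono) auto
  also have "\<dots> = 1 / b * real n powr (b - a)" by (simp add: powr_diff powr_minus field_simps)
  finally show "norm (ln (real n) * real n powr (-a)) \<le> 1 / b * real n powr (b - a)"
    using n by simp
qed

lemma summable_mangoldt:
  assumes "Re s > 1"
  shows "summable (\<lambda>n. norm (of_real (mangoldt n) * of_nat n powr (-s) :: complex))"
proof (rule summable_comparison_test')
  show "summable (\<lambda>n. ln (real n) * real n powr (- Re s))" by (rule summable_ln_powr[OF assms])
  fix n :: nat assume n: "n \<ge> 1"
  have "mangoldt n * real n powr (- Re s) \<le> ln (real n) * real n powr (- Re s)"
    using mangoldt_le[of n] n by (intro mult_right_mono) auto
  thus "norm (norm (of_real (mangoldt n) * of_nat n powr (-s) :: complex)) \<le> ln (real n) * real n powr (- Re s)"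
    by (simp add: norm_mult norm_powr_real_powr abs_mult)
qed

lemma summable_zeta_norm:
  assumes "Re s > 1"
  shows "summable (\<lambda>n. norm (of_nat n powr (-s) :: complex))"
proof -
  have "summable (\<lambda>n. real n powr (- Re s))" using assms by (simp add: summable_real_powr_iff)
  thus ?thesis by (simp add: norm_powr_real_powr)
qed

lemma mangoldt_series_times_zeta:
  assumes s: "Re s > 1"
  shows "(\<lambda>n. of_real (ln (real n)) * of_nat n powr (-s)) sums (mangoldt_series s * (zeta_reg s / (s - 1)))"
proof -
  define f where "f = (\<lambda>n. of_real (mangoldt n) * of_nat n powr (-s) :: complex)"
  define g where "g = (\<lambda>n. of_nat n powr (-s) :: complex)"
  have f: "(f has_sum mangoldt_series s) UNIV"
    unfolding f_def using summable_mangoldt[OF s]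
    by (intro norm_summable_imp_has_sum) (auto intro: summable_sums summable_norm_cancel)
  have "(\<lambda>n. g (Suc n)) sums (zeta_reg s / (s - 1))"
    using zeta_reg_sums[OF s] by (simp add: g_def powr_minus inverse_eq_divide del: of_nat_Suc)
  hence "g sums (zeta_reg s / (s - 1))" by (subst (asm) sums_Suc_iff) (simp add: g_def)
  hence g: "(g has_sum (zeta_reg s / (s - 1))) UNIV"
    using summable_zeta_norm[OF s] unfolding g_def by (intro norm_summable_imp_has_sum)
  have fa: "(\<lambda>x. norm (f x)) summable_on UNIV" and ga: "(\<lambda>x. norm (g x)) summable_on UNIV"
    using summable_mangoldt[OF s] summable_zeta_norm[OF s] unfolding f_def g_def
    by (auto simp: summable_on_UNIV_nonneg_real_iff)
  define h where "h = (\<lambda>(a, b). f a * g b)"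
  have ha: "(\<lambda>p. norm (h p)) summable_on UNIV \<times> UNIV"
  proof -
    have 1: "(\<lambda>b. norm (h (a, b))) summable_on UNIV" for a
      using summable_on_cmult_right[OF ga, of "norm (f a)"] by (simp add: h_def norm_mult)
    have "(\<Sum>\<^sub>\<infinity>b. norm (h (a, b))) = norm (f a) * (\<Sum>\<^sub>\<infinity>b. norm (g b))" for a
      by (simp add: h_def norm_mult infsum_cmult_right' )
    hence "(\<lambda>a. norm (\<Sum>\<^sub>\<infinity>b. norm (h (a, b)))) summable_on UNIV"
      using summable_on_cmult_left[OF fa, of "\<Sum>\<^sub>\<infinity>b. norm (g b)"]
      by (simp add: abs_mult infsum_nonneg)
    thus ?thesis using 1 by (subst Infinite_Sum.abs_summable_on_Sigma_iff) auto
  qed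
  have hs: "(h has_sum (mangoldt_series s * (zeta_reg s / (s - 1)))) (UNIV \<times> UNIV)"
  proof (rule has_sum_SigmaI)
    show "((\<lambda>y. h (x, y)) has_sum (f x * (zeta_reg s / (s - 1)))) UNIV" for x
      unfolding h_def using has_sum_cmult_right[OF g, of "f x"] by simp
    show "((\<lambda>x. f x * (zeta_reg s / (s - 1))) has_sum (mangoldt_series s * (zeta_reg s / (s - 1)))) UNIV"
      by (rule has_sum_cmult_left[OF f])
    show "h summable_on UNIV \<times> UNIV" by (rule abs_summable_summable[OF ha])
  qed
  have h0: "h (a, b) = 0" if "a = 0 \<or> b = 0" for a b
    using that by (auto simp: h_def f_def g_def)
  have "(h has_sum (mangoldt_series s * (zeta_reg s / (s - 1)))) ({1..} \<times> {1..})"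
    by (rule has_sum_cong_neutral[THEN iffD1, OF _ _ _ hs]) (auto simp: Suc_le_eq intro!: h0)
  also have "?this \<longleftrightarrow> ((\<lambda>(n, d). f d * g (n div d)) has_sum (mangoldt_series s * (zeta_reg s / (s - 1)))) (SIGMA n:{1..}. {d. d dvd n})"
    by (rule has_sum_reindex_bij_witness[where j = "\<lambda>(a, b). (a * b, a)" and i = "\<lambda>(n, d). (d, n div d)"])
       (auto simp: h_def Suc_le_eq elim!: dvdE)
  finally have 2: "((\<lambda>(n, d). f d * g (n div d)) has_sum (mangoldt_series s * (zeta_reg s / (s - 1)))) (SIGMA n:{1..}. {d. d dvd n})" .
  have "((\<lambda>n. of_real (ln (real n)) * of_nat n powr (-s)) has_sum (mangoldt_series s * (zeta_reg s / (s - 1)))) {1..}"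
  proof (rule has_sum_SigmaD[OF 2])
    fix n :: nat assume n: "n \<in> {1..}"
    have "(\<Sum>d | d dvd n. f d * g (n div d)) = (\<Sum>d | d dvd n. of_real (mangoldt d) * of_nat n powr (-s))"
    proof (intro sum.cong refl)
      fix d assume "d \<in> {d. d dvd n}"
      then obtain k where k: "n = d * k" by auto
      have "k > 0" "d > 0" using n k by (auto intro!: Nat.gr0I)
      thus "f d * g (n div d) = of_real (mangoldt d) * of_nat n powr (-s)"
        unfolding f_def g_def k using powr_of_nat_mult[of d k "-s"] by simp
    qed
    also have "\<dots> = of_real (ln (real n)) * of_nat n powr (-s)"
      using mangoldt_sum[of n, where 'a = complex] n by (simp add: sum_distrib_right[symmetric])
    finally show "((\<lambda>y. case (n, y) of (n, d) \<Rightarrow> f d * g (n div d)) has_sum (of_real (ln (real n)) * of_nat n powr (-s))) {d. d dvd n}"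
      using n by (simp add: has_sum_finite_iff finite_divisors_nat)
  qed
  hence "((\<lambda>n. of_real (ln (real n)) * of_nat n powr (-s)) has_sum (mangoldt_series s * (zeta_reg s / (s - 1)))) UNIV"
    by (rule has_sum_cong_neutral[THEN iffD1, rotated 3]) (auto simp: Suc_le_eq)
  thus ?thesis by (rule has_sum_imp_sums)
qed

lemma deriv_zeta_series:
  assumes s: "Re s > 1"
  shows "((\<lambda>s. zeta_reg s / (s - 1)) has_field_derivative - (mangoldt_series s * (zeta_reg s / (s - 1)))) (at s)"
proof -
  define c where "c = (1 + Re s) / 2"
  have c: "c > 1" "c < Re s" using s by (auto simp: c_def)
  define S where "S = {z. Re z > c}"
  have S: "open S" "convex S" "s \<in> S" using c by (auto simp: S_def open_halfspace_Re_gt convex_halfspace_Re_gt)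
  have Re1: "Re z > 1" if "z \<in> S" for z using that c by (auto simp: S_def)
  define f where "f = (\<lambda>n z. of_nat n powr (-z) :: complex)"
  define f' where "f' = (\<lambda>n z. - (of_real (ln (real n)) * of_nat n powr (-z)) :: complex)"
  have d: "(f n has_field_derivative f' n z) (at z within S)" for n z
  proof (cases "n = 0")
    case False
    show ?thesis unfolding f_def f'_def powr_def using False
      by (auto intro!: derivative_eq_intros)
  qed (simp add: f_def f'_def)
  have u: "uniformly_convergent_on S (\<lambda>N z. \<Sum>n<N. f' n z)"
  proof (rule Weierstrass_m_test')
    show "summable (\<lambda>n. ln (real n) * real n powr (-c))" by (rule summable_ln_powr[OF c(1)])
    fix n z assume z: "z \<in> S"
    show "norm (f' n z) \<le> ln (real n) * real n powr (-c)"
    proof (cases "n = 0")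
      case False
      have "real n powr (- Re z) \<le> real n powr (-c)" using z False by (intro powr_mono) (auto simp: S_def)
      thus ?thesis using False unfolding f'_def by (simp add: norm_mult norm_powr_real_powr mult_left_mono)
    qed (simp add: f'_def)
  qed
  have sums: "(\<lambda>n. f n z) sums (zeta_reg z / (z - 1))" if "Re z > 1" for z
  proof -
    have "(\<lambda>n. f (Suc n) z) sums (zeta_reg z / (z - 1))"
      using zeta_reg_sums[OF that] by (simp add: f_def powr_minus inverse_eq_divide del: of_nat_Suc)
    thus ?thesis by (subst (asm) sums_Suc_iff) (simp add: f_def)
  qed
  have "((\<lambda>z. \<Sum>n. f n z) has_field_derivative (\<Sum>n. f' n s)) (at s)"
    by (rule has_field_derivative_series'(2)[OF S(2) d u S(3)])
       (use sums[OF s] S in \<open>auto simp: interior_open sums_iff\<close>)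
  hence 1: "((\<lambda>z. \<Sum>n. f n z) has_field_derivative - (mangoldt_series s * (zeta_reg s / (s - 1)))) (at s)"
    using sums_minus[OF mangoldt_series_times_zeta[OF s]] by (simp add: f'_def sums_iff)
  show ?thesis
    by (rule has_field_derivative_transform_within_open[OF 1 S(1,3)]) (use sums[OF Re1] in \<open>auto simp: sums_iff\<close>)
qed

text \<open>
  Near a zero of order m, f is (z - z0)^m times a nonvanishing factor.
\<close>
lemma log_deriv_zero_limit:
  assumes hol: "f holomorphic_on S" and S: "open S" "connected S" "z0 \<in> S" and f0: "f z0 = 0"
    and nc: "\<not> f constant_on S"
  obtains m :: nat where "m > 0" "((\<lambda>z. (z - z0) * deriv f z / f z) \<longlongrightarrow> of_nat m) (at z0)"
    "eventually (\<lambda>z. f z \<noteq> 0) (at z0)"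
proof -
  obtain g r n where n: "0 < n" "0 < r" "ball z0 r \<subseteq> S" and g: "g holomorphic_on ball z0 r"
    and fg: "\<And>w. w \<in> ball z0 r \<Longrightarrow> f w = (w - z0)^n * g w" and g0: "\<And>w. w \<in> ball z0 r \<Longrightarrow> g w \<noteq> 0"
    using holomorphic_factor_zero_nonconstant[OF hol S(1,2,3) f0 nc] by metis
  have ev: "eventually (\<lambda>z. z \<in> ball z0 r - {z0}) (at z0)"
    using n by (intro eventually_at_in_open) auto
  have d: "(z - z0) * deriv f z / f z = of_nat n + (z - z0) * deriv g z / g z" if "z \<in> ball z0 r - {z0}" for z
  proof -
    have z: "z \<in> ball z0 r" "z \<noteq> z0" using that by auto
    have dg: "(g has_field_derivative deriv g z) (at z)" 
      using holomorphic_derivI[OF g _ z(1)] by simp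
    have "((\<lambda>w. (w - z0)^n * g w) has_field_derivative (of_nat n * (z - z0)^(n-1) * g z + (z - z0)^n * deriv g z)) (at z)"
      by (auto intro!: derivative_eq_intros dg)
    hence "(f has_field_derivative (of_nat n * (z - z0)^(n-1) * g z + (z - z0)^n * deriv g z)) (at z)"
      by (rule has_field_derivative_transform_within_open[of _ _ _ "ball z0 r"]) (use z fg in auto)
    hence df: "deriv f z = of_nat n * (z - z0)^(n-1) * g z + (z - z0)^n * deriv g z" by (rule DERIV_imp_deriv)
    have p: "(z - z0)^n = (z - z0) * (z - z0)^(n-1)" using n(1) by (cases n) auto
    show ?thesis unfolding df fg[OF z(1)] p using z g0[OF z(1)] by (simp add: field_simps)
  qed
  have "((\<lambda>z. of_nat n + (z - z0) * deriv g z / g z) \<longlongrightarrow> of_nat n + (z0 - z0) * deriv g z0 / g z0) (at z0)"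
  proof -
    have z0: "z0 \<in> ball z0 r" using n by simp
    have "isCont g z0" 
      using holomorphic_on_imp_continuous_on[OF g] z0 by (simp add: continuous_on_eq_continuous_at)
    moreover have "isCont (deriv g) z0"
      using holomorphic_on_imp_continuous_on[OF holomorphic_deriv[OF g]] z0 by (simp add: continuous_on_eq_continuous_at)
    ultimately show ?thesis using g0[OF z0] by (intro tendsto_intros) (auto simp: isCont_def)
  qed
  hence "((\<lambda>z. of_nat n + (z - z0) * deriv g z / g z) \<longlongrightarrow> of_nat n) (at z0)" by simp
  moreover have "eventually (\<lambda>z. of_nat n + (z - z0) * deriv g z / g z = (z - z0) * deriv f z / f z) (at z0)"
    using ev by eventually_elim (use d in auto)
  ultimately have "((\<lambda>z. (z - z0) * deriv f z / f z) \<longlongrightarrow> of_nat n) (at z0)" by (rule Lim_transform_eventually)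
  moreover have "eventually (\<lambda>z. f z \<noteq> 0) (at z0)"
    using ev by eventually_elim (use fg g0 in auto)
  ultimately show ?thesis using that n(1) by blast
qed

lemma deriv_zeta_reg:
  assumes s: "Re s > 1"
  shows "deriv zeta_reg s = zeta_reg s * (1 / (s - 1) - mangoldt_series s)"
proof -
  have s1: "s \<noteq> 1" using s by auto
  have 1: "((\<lambda>z. (z - 1) * (zeta_reg z / (z - 1))) has_field_derivative
     (1 * (zeta_reg s / (s - 1)) + - (mangoldt_series s * (zeta_reg s / (s - 1))) * (s - 1))) (at s)"
    by (rule DERIV_mult[OF _ deriv_zeta_series[OF s]]) (auto intro!: derivative_eq_intros)
  have "(zeta_reg has_field_derivative
     (1 * (zeta_reg s / (s - 1)) + - (mangoldt_series s * (zeta_reg s / (s - 1))) * (s - 1))) (at s)"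
    by (rule has_field_derivative_transform_within_open[OF 1, of "- {1}"]) (use s1 in auto)
  hence "deriv zeta_reg s = 1 * (zeta_reg s / (s - 1)) + - (mangoldt_series s * (zeta_reg s / (s - 1))) * (s - 1)"
    by (rule DERIV_imp_deriv)
  also have "\<dots> = zeta_reg s * (1 / (s - 1) - mangoldt_series s)"
  proof -
    define P where "P = mangoldt_series s"
    have "P * (zeta_reg s / (s - 1)) * (s - 1) = P * zeta_reg s" using s1 by simp
    thus ?thesis unfolding P_def[symmetric] by (simp add: right_diff_distrib mult.commute)
  qed
  finally show ?thesis .
qed

lemma zeta_reg_right_domain: "open {s. Re s > -1}" "connected {s. Re s > -1}"
  by (auto intro: open_halfspace_Re_gt convex_connected convex_halfspace_Re_gt)

lemma zeta_reg_log_deriv_zero: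
  assumes "Re z0 > -1" "zeta_reg z0 = 0"
  obtains m :: nat where "m > 0" "((\<lambda>z. (z - z0) * deriv zeta_reg z / zeta_reg z) \<longlongrightarrow> of_nat m) (at z0)"
    "eventually (\<lambda>z. zeta_reg z \<noteq> 0) (at z0)"
proof -
  have "\<not> zeta_reg constant_on {s. Re s > -1}"
  proof
    assume "zeta_reg constant_on {s. Re s > -1}"
    then obtain c where "\<And>z. Re z > -1 \<Longrightarrow> zeta_reg z = c" by (auto simp: constant_on_def)
    from this[of 1] this[of z0] assms show False by simp
  qed
  thus ?thesis
    using log_deriv_zero_limit[OF zeta_reg_holomorphic zeta_reg_right_domain, of z0] assms that by auto
qed

lemma mangoldt_series_bound:
  assumes "Re s \<ge> c" "c > 1"
  shows "norm (mangoldt_series s) \<le> (\<Sum>n. mangoldt n * real n powr (-c))"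
proof -
  have 1: "summable (\<lambda>n. norm (of_real (mangoldt n) * of_nat n powr (- s) :: complex))"
    using assms by (intro summable_mangoldt) auto
  have 2: "summable (\<lambda>n. mangoldt n * real n powr (-c))"
    using summable_mangoldt[of "of_real c"] assms by (simp add: norm_mult norm_powr_real_powr)
  have "norm (mangoldt_series s) \<le> (\<Sum>n. norm (of_real (mangoldt n) * of_nat n powr (- s) :: complex))"
    by (rule summable_norm[OF 1])
  also have "\<dots> \<le> (\<Sum>n. mangoldt n * real n powr (-c))"
  proof (rule suminf_le[OF _ 1 2])
    fix n
    show "norm (of_real (mangoldt n) * of_nat n powr (- s) :: complex) \<le> mangoldt n * real n powr (-c)"
    proof (cases "n = 0")
      case False
      have "real n powr (- Re s) \<le> real n powr (-c)" using False assms by (intro powr_mono) auto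
      thus ?thesis by (simp add: norm_mult norm_powr_real_powr mult_left_mono mangoldt_nonneg)
    qed simp
  qed
  finally show ?thesis .
qed

text \<open>
  A zero would give the logarithmic derivative a pole, whereas the Mangoldt series is bounded near it.
\<close>
lemma zeta_reg_nonzero_right:
  assumes s: "Re s > 1"
  shows "zeta_reg s \<noteq> 0"
proof
  assume z: "zeta_reg s = 0"
  then obtain m :: nat where m: "m > 0" "((\<lambda>z. (z - s) * deriv zeta_reg z / zeta_reg z) \<longlongrightarrow> of_nat m) (at s)"
    and ev: "eventually (\<lambda>z. zeta_reg z \<noteq> 0) (at s)"
    using zeta_reg_log_deriv_zero[of s] s by auto
  define c where "c = (1 + Re s) / 2"
  have c: "c > 1" "c < Re s" using s by (auto simp: c_def)
  have ev2: "eventually (\<lambda>z. Re z > c) (at s)"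
    using c(2) by (intro eventually_at_in_open'[of "{z. Re z > c}", simplified]) (auto simp: open_halfspace_Re_gt)
  define B where "B = 1 / (c - 1) + (\<Sum>n. mangoldt n * real n powr (-c))"
  have "((\<lambda>z. (z - s) * deriv zeta_reg z / zeta_reg z) \<longlongrightarrow> 0) (at s)"
  proof (rule Lim_null_comparison)
    show "eventually (\<lambda>z. norm ((z - s) * deriv zeta_reg z / zeta_reg z) \<le> norm (z - s) * B) (at s)"
      using ev ev2
    proof eventually_elim
      case (elim z)
      have z1: "norm (z - 1) \<ge> c - 1" using abs_Re_le_cmod[of "z - 1"] elim by simp
      have "norm (1 / (z - 1) - mangoldt_series z) \<le> norm (1 / (z - 1)) + norm (mangoldt_series z)" by (rule norm_triangle_ineq4)
      also have "norm (1 / (z - 1)) \<le> 1 / (c - 1)" using z1 c by (simp add: norm_divide frac_le)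
      also have "norm (mangoldt_series z) \<le> (\<Sum>n. mangoldt n * real n powr (-c))" using elim c by (intro mangoldt_series_bound) auto
      finally have "norm (1 / (z - 1) - mangoldt_series z) \<le> B" by (simp add: B_def)
      moreover have "deriv zeta_reg z / zeta_reg z = 1 / (z - 1) - mangoldt_series z"
        using deriv_zeta_reg[of z] elim c by simp
      ultimately show ?case by (simp add: norm_mult mult_left_mono flip: times_divide_eq_right)
    qed
    have "((\<lambda>z. norm (z - s) * B) \<longlongrightarrow> norm (s - s) * B) (at s)" by (intro tendsto_intros)
    thus "((\<lambda>z. norm (z - s) * B) \<longlongrightarrow> 0) (at s)" by simp
  qed
  with m(2) have "of_nat m = (0::complex)" by (rule tendsto_unique[rotated]) auto
  thus False using m(1) by simp
qed

lemma mangoldt_series_eq: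
  assumes s: "Re s > 1"
  shows "mangoldt_series s = 1 / (s - 1) - deriv zeta_reg s / zeta_reg s"
  using deriv_zeta_reg[OF s] zeta_reg_nonzero_right[OF s] by simp

lemma isCont_zeta_reg: "Re s > -1 \<Longrightarrow> isCont zeta_reg s" "Re s > -1 \<Longrightarrow> isCont (deriv zeta_reg) s"
  using holomorphic_on_imp_continuous_on[OF zeta_reg_holomorphic]
    holomorphic_on_imp_continuous_on[OF holomorphic_deriv[OF zeta_reg_holomorphic zeta_reg_right_domain(1)]]
  by (auto simp: continuous_on_eq_continuous_at zeta_reg_right_domain(1))

text \<open>
  The classical inequality 3 + 4 cos a + cos 2a = 2 (1 + cos a)^2 \<ge> 0, applied to each term
  with a = t ln n.
\<close>
lemma mangoldt_series_341:
  assumes "x > 0"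
  shows "3 * Re (mangoldt_series (of_real (1 + x))) + 4 * Re (mangoldt_series (Complex (1 + x) t)) + Re (mangoldt_series (Complex (1 + x) (2 * t))) \<ge> 0"
proof -
  define a where "a = (\<lambda>n. mangoldt n * real n powr (- (1 + x)))"
  have c: "(\<lambda>n. a n * cos (u * ln (real n))) sums Re (mangoldt_series (Complex (1 + x) u))" for u
  proof -
    have "(\<lambda>n. of_real (mangoldt n) * of_nat n powr (- Complex (1 + x) u)) sums mangoldt_series (Complex (1 + x) u)"
      using assms by (intro summable_sums summable_norm_cancel[OF summable_mangoldt]) auto
    hence "(\<lambda>n. Re (of_real (mangoldt n) * of_nat n powr (- Complex (1 + x) u))) sums Re (mangoldt_series (Complex (1 + x) u))"
      by (rule sums_Re)
    also have "(\<lambda>n. Re (of_real (mangoldt n) * of_nat n powr (- Complex (1 + x) u))) = (\<lambda>n. a n * cos (u * ln (real n)))"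
    proof
      fix n :: nat
      show "Re (of_real (mangoldt n) * of_nat n powr (- Complex (1 + x) u)) = a n * cos (u * ln (real n))"
      proof (cases "n = 0")
        case False
        have "of_nat n powr (- Complex (1 + x) u) = exp (of_real (- (1 + x) * ln (real n)) + \<i> * of_real (- u * ln (real n)))"
        proof -
          have "- Complex (1 + x) u * of_real (ln (real n)) = of_real (- (1 + x) * ln (real n)) + \<i> * of_real (- u * ln (real n))"
            by (simp add: complex_eq_iff) (simp add: algebra_simps)
          thus ?thesis unfolding powr_def using False by (simp add: Ln_of_nat)
        qed
        hence "Re (of_nat n powr (- Complex (1 + x) u)) = exp (- (1 + x) * ln (real n)) * cos (- u * ln (real n))"
          by (simp add: Re_exp)
        also have "\<dots> = real n powr (- (1 + x)) * cos (u * ln (real n))" using False by (simp add: powr_def)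
        finally have e: "Re (of_nat n powr (- Complex (1 + x) u)) = real n powr (- (1 + x)) * cos (u * ln (real n))" .
        show ?thesis unfolding a_def by (subst times_complex.sel(1)) (simp add: e)
      qed (simp add: a_def)
    qed
    finally show ?thesis .
  qed
  have c0: "a sums Re (mangoldt_series (of_real (1 + x)))"
    using c[of 0] by (simp flip: complex_of_real_def)
  have S: "(\<lambda>n. 3 * a n + 4 * (a n * cos (t * ln (real n))) + a n * cos (2 * t * ln (real n))) sums
     (3 * Re (mangoldt_series (of_real (1 + x))) + 4 * Re (mangoldt_series (Complex (1 + x) t)) + Re (mangoldt_series (Complex (1 + x) (2 * t))))"
    by (intro sums_add sums_mult c c0)
  have nn: "0 \<le> 3 * a n + 4 * (a n * cos (t * ln (real n))) + a n * cos (2 * t * ln (real n))" for n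
  proof -
    define \<theta> where "\<theta> = t * ln (real n)"
    have "3 * a n + 4 * (a n * cos \<theta>) + a n * cos (2 * \<theta>) = 2 * a n * (1 + cos \<theta>)\<^sup>2"
      unfolding cos_double_cos by (simp add: power2_eq_square algebra_simps)
    moreover have "a n \<ge> 0" by (simp add: a_def mangoldt_nonneg)
    ultimately show ?thesis by (simp add: \<theta>_def mult.assoc)
  qed
  show ?thesis by (rule sums_le[OF nn sums_zero S])
qed

text \<open>
  Let x tend to 0 from the right in the inequality above, multiplied by x. The pole at 1 contributes
  3, a zero of order m at 1 + it contributes -4 m, and the point 1 + 2it contributes at most 0;
  the total 3 - 4 m would be negative.
\<close>
lemma zeta_reg_nonzero_line: "zeta_reg (Complex 1 t) \<noteq> 0"
proof (cases "t = 0")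
  case True
  thus ?thesis by (simp flip: complex_of_real_def)
next
  case t: False
  show ?thesis
  proof
    assume z0: "zeta_reg (Complex 1 t) = 0"
    define L where "L = (\<lambda>u x. of_real x * deriv zeta_reg (Complex (1 + x) u) / zeta_reg (Complex (1 + x) u))"
    have fl: "filterlim (\<lambda>x. Complex (1 + x) u) (at (Complex 1 u)) (at_right 0)" for u
    proof (rule filterlim_atI)
      have "((\<lambda>x. Complex (1 + x) u) \<longlongrightarrow> Complex (1 + 0) u) (at_right 0)"
        by (intro tendsto_intros tendsto_Complex)
      thus "((\<lambda>x. Complex (1 + x) u) \<longlongrightarrow> Complex 1 u) (at_right 0)" by simp
      show "\<forall>\<^sub>F x in at_right 0. Complex (1 + x) u \<noteq> Complex 1 u"
        using eventually_at_right_less[of 0] by eventually_elim auto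
    qed
    have L0: "(L u \<longlongrightarrow> 0) (at_right 0)" if "zeta_reg (Complex 1 u) \<noteq> 0" for u
    proof -
      have 1: "((\<lambda>x. zeta_reg (Complex (1 + x) u)) \<longlongrightarrow> zeta_reg (Complex 1 u)) (at_right 0)"
        by (rule filterlim_compose[OF _ fl]) (use isCont_zeta_reg(1)[of "Complex 1 u"] in \<open>simp add: isCont_def\<close>)
      have 2: "((\<lambda>x. deriv zeta_reg (Complex (1 + x) u)) \<longlongrightarrow> deriv zeta_reg (Complex 1 u)) (at_right 0)"
        by (rule filterlim_compose[OF _ fl]) (use isCont_zeta_reg(2)[of "Complex 1 u"] in \<open>simp add: isCont_def\<close>)
      have "(L u \<longlongrightarrow> of_real 0 * deriv zeta_reg (Complex 1 u) / zeta_reg (Complex 1 u)) (at_right 0)"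
        unfolding L_def by (intro tendsto_intros 1 2 that)
      thus ?thesis by simp
    qed
    have Lm: "\<exists>m::nat. m > 0 \<and> (L u \<longlongrightarrow> of_nat m) (at_right 0)" if zu: "zeta_reg (Complex 1 u) = 0" for u
    proof -
      obtain m :: nat where m: "m > 0" "((\<lambda>z. (z - Complex 1 u) * deriv zeta_reg z / zeta_reg z) \<longlongrightarrow> of_nat m) (at (Complex 1 u))"
        by (rule zeta_reg_log_deriv_zero[of "Complex 1 u"]) (use zu in auto)
      have "((\<lambda>x. (Complex (1 + x) u - Complex 1 u) * deriv zeta_reg (Complex (1 + x) u) / zeta_reg (Complex (1 + x) u)) \<longlongrightarrow> of_nat m) (at_right 0)"
        by (rule filterlim_compose[OF m(2) fl])
      moreover have "Complex (1 + x) u - Complex 1 u = of_real x" for x by (simp add: complex_eq_iff)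
      ultimately show ?thesis using m(1) unfolding L_def by auto
    qed
    obtain m where m: "m > 0" "(L t \<longlongrightarrow> of_nat m) (at_right 0)" using Lm[OF z0] by auto
    obtain m' :: nat where m': "(L (2 * t) \<longlongrightarrow> of_nat m') (at_right 0)"
      using Lm[of "2 * t"] L0[of "2 * t"] by (metis of_nat_0)
    have l0: "(L 0 \<longlongrightarrow> 0) (at_right 0)" by (rule L0) (simp flip: complex_of_real_def)
    have xP: "of_real x * mangoldt_series (Complex (1 + x) u) = of_real x / Complex x u - L u x" if "x > 0" for x u
    proof -
      have "Complex (1 + x) u - 1 = Complex x u" by (simp add: complex_eq_iff)
      thus ?thesis using mangoldt_series_eq[of "Complex (1 + x) u"] that by (simp add: L_def right_diff_distrib)
    qed
    have lim0: "((\<lambda>x. of_real x / Complex x u) \<longlongrightarrow> 0) (at_right 0)" if "u \<noteq> 0" for u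
    proof -
      have "((\<lambda>x. of_real x / Complex x u) \<longlongrightarrow> of_real 0 / Complex 0 u) (at_right 0)"
        using that by (intro tendsto_intros tendsto_Complex) (auto simp: complex_eq_iff)
      thus ?thesis by simp
    qed
    define F where "F = (\<lambda>x. 3 * Re (1 - L 0 x) + 4 * Re (of_real x / Complex x t - L t x) + Re (of_real x / Complex x (2 * t) - L (2 * t) x))"
    have "(F \<longlongrightarrow> 3 * Re (1 - 0) + 4 * Re (0 - of_nat m) + Re (0 - of_nat m')) (at_right 0)"
      unfolding F_def using t by (intro tendsto_intros l0 m m' lim0) auto
    moreover have "eventually (\<lambda>x. F x \<ge> 0) (at_right 0)"
      using eventually_at_right_less[of 0]
    proof eventually_elim
      case (elim x)
      have "0 \<le> x * (3 * Re (mangoldt_series (of_real (1 + x))) + 4 * Re (mangoldt_series (Complex (1 + x) t)) + Re (mangoldt_series (Complex (1 + x) (2 * t))))"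
        using elim mangoldt_series_341[OF elim, of t] by (intro mult_nonneg_nonneg) auto
      also have "\<dots> = 3 * Re (of_real x * mangoldt_series (Complex (1 + x) 0)) + 4 * Re (of_real x * mangoldt_series (Complex (1 + x) t)) + Re (of_real x * mangoldt_series (Complex (1 + x) (2 * t)))"
        by (simp add: algebra_simps flip: complex_of_real_def)
      also have "\<dots> = F x" unfolding xP[OF elim] F_def using elim by (simp flip: complex_of_real_def)
      finally show ?case .
    qed
    ultimately have "3 * Re (1 - 0) + 4 * Re (0 - of_nat m) + Re (0 - of_nat m') \<ge> 0"
      by (rule tendsto_lowerbound) auto
    thus False using m(1) by simp
  qed
qed

lemma zeta_reg_nonzero: "Re s \<ge> 1 \<Longrightarrow> zeta_reg s \<noteq> 0"
proof (cases "Re s = 1")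
  case True
  hence "s = Complex 1 (Im s)" by (simp add: complex_eq_iff)
  thus ?thesis using zeta_reg_nonzero_line[of "Im s"] by simp
qed (use zeta_reg_nonzero_right[of s] in auto)

section \<open>A transform of the error in the prime number theorem\<close>

text \<open>
  The difference of -\<zeta>'(s)/\<zeta>(s) and \<zeta>(s), that is, the Dirichlet series with coefficients
  \<Lambda>(n) - 1. The poles at 1 cancel; the formula through \<open>zeta_reg\<close> makes this visible, and the
  case distinction fills the removable singularity.
\<close>
definition psi_error_mellin :: "complex \<Rightarrow> complex" where
  "psi_error_mellin s = - deriv zeta_reg s / zeta_reg s - (if s = 1 then deriv zeta_reg 1 else (zeta_reg s - 1) / (s - 1))"

lemma psi_error_mellin_holomorphic: "psi_error_mellin holomorphic_on ({s. Re s > -1} - {s. zeta_reg s = 0})"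
proof -
  have "(\<lambda>z. if z = 1 then deriv zeta_reg 1 else (zeta_reg z - zeta_reg 1) / (z - 1)) holomorphic_on {s. Re s > -1}"
    by (rule pole_lemma_open[OF zeta_reg_holomorphic zeta_reg_right_domain(1)])
  hence "(\<lambda>z. if z = 1 then deriv zeta_reg 1 else (zeta_reg z - 1) / (z - 1)) holomorphic_on {s. Re s > -1}"
    unfolding zeta_reg_1 .
  hence 1: "(\<lambda>z. if z = 1 then deriv zeta_reg 1 else (zeta_reg z - 1) / (z - 1)) holomorphic_on ({s. Re s > -1} - {s. zeta_reg s = 0})"
    by (rule holomorphic_on_subset) auto
  have 2: "zeta_reg holomorphic_on ({s. Re s > -1} - {s. zeta_reg s = 0})"
    using zeta_reg_holomorphic by (auto elim: holomorphic_on_subset)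
  have 3: "deriv zeta_reg holomorphic_on ({s. Re s > -1} - {s. zeta_reg s = 0})"
    using holomorphic_deriv[OF zeta_reg_holomorphic zeta_reg_right_domain(1)] by (auto elim: holomorphic_on_subset)
  show ?thesis unfolding psi_error_mellin_def[abs_def] by (intro holomorphic_intros 1 2 3) auto
qed

lemma psi_error_mellin_domain: "open ({s. Re s > -1} - {s. zeta_reg s = 0})"
proof -
  have "open ({s. Re s > -1} \<inter> zeta_reg -` (- {0}))"
    by (rule continuous_open_preimage[OF holomorphic_on_imp_continuous_on[OF zeta_reg_holomorphic] zeta_reg_right_domain(1)]) auto
  also have "{s. Re s > -1} \<inter> zeta_reg -` (- {0}) = {s. Re s > -1} - {s. zeta_reg s = 0}" by auto
  finally show ?thesis .
qed

text \<open>
  Abel summation; the boundary term vanishes in the limit because \<psi>(N) = O(N) and Re s > 1.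
\<close>
lemma psi_error_mellin_sums:
  assumes s: "Re s > 1"
  shows "(\<lambda>n. of_real (psi (Suc n) - real (Suc n)) * (of_nat (Suc n) powr (-s) - of_nat (Suc (Suc n)) powr (-s))) sums psi_error_mellin s"
proof -
  have s1: "s \<noteq> 1" using s by auto
  have e: "psi_error_mellin s = mangoldt_series s - zeta_reg s / (s - 1)"
    unfolding mangoldt_series_eq[OF s] psi_error_mellin_def using s1 by (simp add: diff_divide_distrib)
  have A: "(\<lambda>n. of_real (mangoldt (Suc n)) * of_nat (Suc n) powr (-s)) sums mangoldt_series s"
  proof -
    have "(\<lambda>n. of_real (mangoldt n) * of_nat n powr (-s)) sums mangoldt_series s"
      by (intro summable_sums summable_norm_cancel[OF summable_mangoldt] s)
    thus ?thesis by (subst sums_Suc_iff) simp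
  qed
  have B: "(\<lambda>n. of_nat (Suc n) powr (-s)) sums (zeta_reg s / (s - 1))"
    using zeta_reg_sums[OF s] by (simp add: powr_minus inverse_eq_divide del: of_nat_Suc)
  have C: "(\<lambda>n. (of_real (mangoldt (Suc n)) - 1) * of_nat (Suc n) powr (-s)) sums psi_error_mellin s"
    using sums_diff[OF A B] unfolding e by (simp add: left_diff_distrib)
  have lim: "(\<lambda>N. of_real (psi N - real N) * of_nat (Suc N) powr (-s) :: complex) \<longlonglongrightarrow> 0"
  proof (rule Lim_null_comparison)
    show "\<forall>\<^sub>F N in sequentially. norm (of_real (psi N - real N) * of_nat (Suc N) powr (-s) :: complex) \<le> 6 * real (Suc N) powr (1 - Re s)"
    proof (intro always_eventually allI)
      fix N
      have "\<bar>psi N - real N\<bar> \<le> 6 * real (Suc N)" using psi_le[of N] psi_nonneg[of N] by auto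
      hence "\<bar>psi N - real N\<bar> * real (Suc N) powr (- Re s) \<le> 6 * real (Suc N) * real (Suc N) powr (- Re s)"
        by (intro mult_right_mono) auto
      also have "\<dots> = 6 * real (Suc N) powr (1 - Re s)" by (simp add: powr_diff powr_minus field_simps)
      finally show "norm (of_real (psi N - real N) * of_nat (Suc N) powr (-s) :: complex) \<le> 6 * real (Suc N) powr (1 - Re s)"
        by (simp add: norm_mult norm_powr_real_powr del: of_nat_Suc of_real_diff)
    qed
    have "(\<lambda>N. real (Suc N) powr (1 - Re s)) \<longlonglongrightarrow> 0"
      by (rule tendsto_neg_powr[OF _ filterlim_compose[OF filterlim_real_sequentially filterlim_Suc]]) (use s in simp)
    thus "(\<lambda>N. 6 * real (Suc N) powr (1 - Re s)) \<longlonglongrightarrow> 0" by (rule tendsto_mult_right_zero)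
  qed
  have sh: "(\<Sum>n<N. f (Suc n)) = (\<Sum>n=1..N. f n)" for f :: "nat \<Rightarrow> complex" and N
    by (induction N) auto
  have "(\<lambda>N. (\<Sum>n<N. (of_real (mangoldt (Suc n)) - 1) * of_nat (Suc n) powr (-s)) - of_real (psi N - real N) * of_nat (Suc N) powr (-s)) \<longlonglongrightarrow> psi_error_mellin s - 0"
    using C unfolding sums_def by (intro tendsto_diff lim)
  also have "(\<lambda>N. (\<Sum>n<N. (of_real (mangoldt (Suc n)) - 1) * of_nat (Suc n) powr (-s)) - of_real (psi N - real N) * of_nat (Suc N) powr (-s))
     = (\<lambda>N. \<Sum>n<N. of_real (psi (Suc n) - real (Suc n)) * (of_nat (Suc n) powr (-s) - of_nat (Suc (Suc n)) powr (-s)))"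
  proof
    fix N
    show "(\<Sum>n<N. (of_real (mangoldt (Suc n)) - 1) * of_nat (Suc n) powr (-s)) - of_real (psi N - real N) * of_nat (Suc N) powr (-s)
       = (\<Sum>n<N. of_real (psi (Suc n) - real (Suc n)) * (of_nat (Suc n) powr (-s) - of_nat (Suc (Suc n)) powr (-s) :: complex))"
      unfolding sh[of "\<lambda>n. (of_real (mangoldt n) - 1) * of_nat n powr (-s)"]
        sh[of "\<lambda>n. of_real (psi n - real n) * (of_nat n powr (-s) - of_nat (Suc n) powr (-s))"]
      using Abel_psi[of "\<lambda>n. of_nat n powr (-s)" N] by simp
  qed
  finally show ?thesis unfolding sums_def by simp
qed

section \<open>Smoothing by the Fejer kernel\<close>

text \<open>
  The Fejer kernel, normalised so that its peak value is \<open>lam\<close>/2. Its three properties used below are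
  nonnegativity, quadratic decay away from 0, and a lower bound near 0.
\<close>
definition fejer :: "real \<Rightarrow> real \<Rightarrow> real" where
  "fejer lam v = integral {0..lam} (\<lambda>\<tau>. (1 - \<tau> / lam) * cos (\<tau> * v))"

lemma fejer_eq:
  assumes lam: "lam > 0" and v: "v \<noteq> 0"
  shows "fejer lam v = (1 - cos (lam * v)) / (lam * v\<^sup>2)"
proof -
  define F where "F = (\<lambda>\<tau>. (1 - \<tau> / lam) * sin (\<tau> * v) / v - cos (\<tau> * v) / (lam * v\<^sup>2))"
  have "((\<lambda>\<tau>. (1 - \<tau> / lam) * cos (\<tau> * v)) has_integral (F lam - F 0)) {0..lam}"
  proof (rule fundamental_theorem_of_calculus)
    fix \<tau> assume "\<tau> \<in> {0..lam}"
    have "(F has_real_derivative ((1 - \<tau> / lam) * cos (\<tau> * v))) (at \<tau>)"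
      unfolding F_def using lam v
      by (auto intro!: derivative_eq_intros simp: power2_eq_square field_simps)
    thus "(F has_vector_derivative ((1 - \<tau> / lam) * cos (\<tau> * v))) (at \<tau> within {0..lam})"
      by (simp add: has_real_derivative_iff_has_vector_derivative has_vector_derivative_at_within)
  qed (use lam in auto)
  hence "fejer lam v = F lam - F 0" unfolding fejer_def by (rule integral_unique)
  also have "\<dots> = (1 - cos (lam * v)) / (lam * v\<^sup>2)" using lam v by (simp add: F_def diff_divide_distrib)
  finally show ?thesis .
qed

lemma fejer_integrand_continuous: 
  fixes lam v :: real
  shows "lam > 0 \<Longrightarrow> continuous_on A (\<lambda>\<tau>. (1 - \<tau> / lam) * cos (\<tau> * v))"
  by (auto intro!: continuous_intros)

lemma Re_of_real_mult: "Re (of_real r * z) = r * Re z"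
  by simp

lemma fejer_nonneg: "lam > 0 \<Longrightarrow> fejer lam v \<ge> 0"
proof (cases "v = 0")
  case True
  assume lam: "lam > 0"
  show ?thesis unfolding fejer_def True using lam
    by (intro integral_nonneg integrable_continuous_real fejer_integrand_continuous) auto
next
  case False
  assume lam: "lam > 0"
  show ?thesis unfolding fejer_eq[OF lam False] using lam by (intro divide_nonneg_nonneg) auto
qed

lemma fejer_le:
  assumes "lam > 0" "v \<noteq> 0"
  shows "fejer lam v \<le> 2 / (lam * v\<^sup>2)"
proof -
  have "1 - cos (lam * v) \<le> 2" using cos_ge_minus_one[of "lam * v"] by linarith
  thus ?thesis unfolding fejer_eq[OF assms] using assms by (intro divide_right_mono) auto
qed

lemma fejer_ge:
  assumes lam: "lam > 0" and v: "\<bar>v\<bar> \<le> 1 / lam"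
  shows "fejer lam v \<ge> lam / 4"
proof -
  have i: "((\<lambda>\<tau>. (1 - \<tau> / lam) * (1/2)) has_integral (lam / 4)) {0..lam}"
  proof -
    define F where "F = (\<lambda>\<tau>. (\<tau> - \<tau>\<^sup>2 / (2 * lam)) / 2)"
    have "((\<lambda>\<tau>. (1 - \<tau> / lam) * (1/2)) has_integral (F lam - F 0)) {0..lam}"
    proof (rule fundamental_theorem_of_calculus)
      fix \<tau> assume "\<tau> \<in> {0..lam}"
      have "(F has_real_derivative ((1 - \<tau> / lam) * (1/2))) (at \<tau>)"
        unfolding F_def using lam by (auto intro!: derivative_eq_intros simp: field_simps)
      thus "(F has_vector_derivative ((1 - \<tau> / lam) * (1/2))) (at \<tau> within {0..lam})"
        by (simp add: has_real_derivative_iff_has_vector_derivative has_vector_derivative_at_within)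
    qed (use lam in auto)
    also have "F lam - F 0 = lam / 4" using lam by (simp add: F_def power2_eq_square)
    finally show ?thesis .
  qed
  show ?thesis unfolding fejer_def
  proof (rule has_integral_le[OF i integrable_integral])
    show "(\<lambda>\<tau>. (1 - \<tau> / lam) * cos (\<tau> * v)) integrable_on {0..lam}"
      by (intro integrable_continuous_real fejer_integrand_continuous lam)
    fix \<tau> assume t: "\<tau> \<in> {0..lam}"
    have "\<bar>\<tau> * v\<bar> \<le> lam * (1 / lam)" unfolding abs_mult using t v lam by (intro mult_mono) auto
    hence "\<bar>\<tau> * v\<bar> \<le> 1" using lam by simp
    also have "1 \<le> pi / 3" using pi_gt3 by simp
    finally have a: "\<bar>\<tau> * v\<bar> \<le> pi / 3" .
    have "cos (pi / 3) \<le> cos \<bar>\<tau> * v\<bar>" using a by (intro cos_monotone_0_pi_le) auto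
    hence "1/2 \<le> cos (\<tau> * v)" by (simp add: cos_60)
    thus "(1 - \<tau> / lam) * (1/2) \<le> (1 - \<tau> / lam) * cos (\<tau> * v)"
      using t lam by (intro mult_left_mono) auto
  qed
qed

lemma fejer_continuous: 
  assumes "lam > 0"
  shows "continuous_on A (fejer lam)"
proof -
  have "continuous_on A (\<lambda>v. integral (cbox 0 lam) (\<lambda>\<tau>. (1 - \<tau> / lam) * cos (\<tau> * v)))"
    using assms by (intro integral_continuous_on_param) (auto intro!: continuous_intros simp: case_prod_unfold)
  thus ?thesis by (simp add: fejer_def[abs_def])
qed

definition fejer_weight :: "real \<Rightarrow> real \<Rightarrow> real \<Rightarrow> nat \<Rightarrow> real" where
  "fejer_weight lam y e m = integral {real m..real m + 1} (\<lambda>x. x powr (- 2 - e) * fejer lam (y - ln x))"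

text \<open>
  The integral of x powr (-s-1) over [m, m+1] is the difference quotient on the right; exchange it with the
  integral defining the kernel.
\<close>
lemma fejer_weight_eq:
  assumes lam: "lam > 0" and m: "m \<ge> 1" and e: "e > 0"
  shows "fejer_weight lam y e m = integral {0..lam} (\<lambda>\<tau>. (1 - \<tau> / lam) *
     Re (exp (\<i> * of_real (\<tau> * y)) * ((of_nat m powr (- Complex (1 + e) \<tau>) - of_nat (Suc m) powr (- Complex (1 + e) \<tau>)) / Complex (1 + e) \<tau>)))"
proof -
  define h where "h = (\<lambda>x \<tau>. (1 - \<tau> / lam) * (x powr (- 2 - e) * cos (\<tau> * (y - ln x))))"
  have "fejer_weight lam y e m = integral {real m..real m + 1} (\<lambda>x. integral {0..lam} (h x))"
    unfolding fejer_weight_def fejer_def h_def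
    by (subst integral_mult_right[symmetric]) (simp add: algebra_simps)
  also have "\<dots> = integral {0..lam} (\<lambda>\<tau>. integral {real m..real m + 1} (\<lambda>x. h x \<tau>))"
  proof -
    have "continuous_on (cbox (real m, 0) (real m + 1, lam)) (\<lambda>(x, \<tau>). h x \<tau>)"
      unfolding h_def case_prod_unfold using m lam by (intro continuous_intros) (auto simp: cbox_Pair_eq)
    from integral_swap_continuous[OF this] show ?thesis by simp
  qed
  also have "\<dots> = integral {0..lam} (\<lambda>\<tau>. (1 - \<tau> / lam) *
     Re (exp (\<i> * of_real (\<tau> * y)) * ((of_nat m powr (- Complex (1 + e) \<tau>) - of_nat (Suc m) powr (- Complex (1 + e) \<tau>)) / Complex (1 + e) \<tau>)))"
  proof (rule integral_cong)
    fix \<tau> assume "\<tau> \<in> {0..lam}"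
    define s where "s = Complex (1 + e) \<tau>"
    have s0: "s \<noteq> 0" using e by (auto simp: s_def complex_eq_iff)
    define c where "c = exp (\<i> * of_real (\<tau> * y))"
    define F where "F = (\<lambda>x::real. - (c * (of_real x powr (-s)) / s))"
    have hi: "((\<lambda>x. c * of_real x powr (-s-1)) has_integral (F (real m + 1) - F (real m))) {real m..real m + 1}"
    proof (rule fundamental_theorem_of_calculus)
      fix x assume x: "x \<in> {real m..real m + 1}"
      hence x0: "x > 0" using m by auto
      have "((\<lambda>z. - (c * z powr (-s) / s)) has_field_derivative c * of_real x powr (-s-1)) (at (of_real x))"
        using x0 s0 by (auto intro!: derivative_eq_intros simp: complex_nonpos_Reals_iff)
      thus "(F has_vector_derivative c * of_real x powr (-s-1)) (at x within {real m..real m + 1})"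
        unfolding F_def by (intro has_vector_derivative_real_field)
    qed auto
    have re: "Re (c * of_real x powr (-s-1)) = x powr (- 2 - e) * cos (\<tau> * (y - ln x))" if "x > 0" for x
    proof -
      have "c * of_real x powr (-s-1) = exp (of_real ((- 2 - e) * ln x) + \<i> * of_real (\<tau> * (y - ln x)))"
        using that by (simp add: c_def powr_def exp_add[symmetric] s_def Complex_eq Ln_of_real algebra_simps)
      hence "Re (c * of_real x powr (-s-1)) = exp ((- 2 - e) * ln x) * cos (\<tau> * (y - ln x))"
        by (simp add: Re_exp)
      thus ?thesis using that by (simp add: powr_def)
    qed
    have "((\<lambda>x. Re (c * of_real x powr (-s-1))) has_integral Re (F (real m + 1) - F (real m))) {real m..real m + 1}"
      using has_integral_linear[OF hi bounded_linear_Re] by (simp add: o_def)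
    hence "((\<lambda>x. x powr (- 2 - e) * cos (\<tau> * (y - ln x))) has_integral Re (F (real m + 1) - F (real m))) {real m..real m + 1}"
      by (rule has_integral_eq[rotated]) (use m re in auto)
    hence "((\<lambda>x. h x \<tau>) has_integral (1 - \<tau> / lam) * Re (F (real m + 1) - F (real m))) {real m..real m + 1}"
      unfolding h_def by (rule has_integral_mult_right)
    hence "integral {real m..real m + 1} (\<lambda>x. h x \<tau>) = (1 - \<tau> / lam) * Re (F (real m + 1) - F (real m))"
      by (rule integral_unique)
    also have "F (real m + 1) - F (real m) = c * ((of_nat m powr (-s) - of_nat (Suc m) powr (-s)) / s)"
      using s0 by (simp add: F_def field_simps)
    finally show "integral {real m..real m + 1} (\<lambda>x. h x \<tau>) = (1 - \<tau> / lam) *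
     Re (exp (\<i> * of_real (\<tau> * y)) * ((of_nat m powr (- Complex (1 + e) \<tau>) - of_nat (Suc m) powr (- Complex (1 + e) \<tau>)) / Complex (1 + e) \<tau>))"
      by (simp add: c_def s_def)
  qed
  finally show ?thesis .
qed

lemma norm_powr_diff_le:
  assumes "m \<ge> 1" "Re s \<ge> 0"
  shows "norm (of_nat m powr (-s) - of_nat (Suc m) powr (-s) :: complex) \<le> norm s * real m powr (- Re s - 1)"
proof -
  define S where "S = closed_segment (complex_of_real (real m)) (complex_of_real (real m + 1))"
  have S: "\<exists>x. w = of_real x \<and> real m \<le> x" if "w \<in> S" for w
    using that unfolding S_def closed_segment_of_real closed_segment_eq_real_ivl by auto
  have "norm ((complex_of_real (real m + 1)) powr (-s) - of_real (real m) powr (-s)) \<le> norm s * real m powr (- Re s - 1) * norm (complex_of_real (real m + 1) - of_real (real m))"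
  proof (rule field_differentiable_bound[where S = S and f' = "\<lambda>w. -s * w powr (-s-1)"])
    fix w assume "w \<in> S"
    then obtain x where x: "w = of_real x" "real m \<le> x" using S by blast
    show "((\<lambda>w. w powr (-s)) has_field_derivative -s * w powr (-s-1)) (at w within S)"
      using x assms by (auto intro!: derivative_eq_intros simp: complex_nonpos_Reals_iff)
    have "x powr (- Re s - 1) \<le> real m powr (- Re s - 1)" using x assms by (intro powr_mono2') auto
    thus "norm (-s * w powr (-s-1)) \<le> norm s * real m powr (- Re s - 1)"
      using x assms by (simp add: norm_mult norm_powr_real_powr mult_left_mono)
  qed (auto simp: S_def)
  thus ?thesis by (subst norm_minus_commute) (simp add: add.commute)
qed

text \<open>
  Integrate the series for the transform along the vertical line Re s = 1 + e against the
  Fejer weights. For e > 0 the series converges absolutely and may be integrated termwise.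
\<close>
lemma fejer_smoothed_psi_error:
  assumes lam: "lam > 0" and e: "e > 0"
  shows "(\<lambda>n. (psi (Suc n) - real (Suc n)) * fejer_weight lam y e (Suc n)) sums
    integral {0..lam} (\<lambda>\<tau>. (1 - \<tau> / lam) * Re (exp (\<i> * of_real (\<tau> * y)) * (psi_error_mellin (Complex (1 + e) \<tau>) / Complex (1 + e) \<tau>)))"
proof -
  define s where "s = (\<lambda>\<tau>. Complex (1 + e) \<tau>)"
  have s0: "s \<tau> \<noteq> 0" for \<tau> using e by (auto simp: s_def complex_eq_iff)
  define c where "c = (\<lambda>n. psi (Suc n) - real (Suc n))"
  define u where "u = (\<lambda>n \<tau>. (of_nat (Suc n) powr (- s \<tau>) - of_nat (Suc (Suc n)) powr (- s \<tau>)) / s \<tau>)"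
  define f where "f = (\<lambda>n \<tau>. c n * ((1 - \<tau> / lam) * Re (exp (\<i> * of_real (\<tau> * y)) * u n \<tau>)))"
  define g where "g = (\<lambda>\<tau>. (1 - \<tau> / lam) * Re (exp (\<i> * of_real (\<tau> * y)) * (psi_error_mellin (s \<tau>) / s \<tau>)))"
  have fs: "(\<lambda>n. f n \<tau>) sums g \<tau>" for \<tau>
  proof -
    have "(\<lambda>n. exp (\<i> * of_real (\<tau> * y)) * (of_real (c n) * (of_nat (Suc n) powr (- s \<tau>) - of_nat (Suc (Suc n)) powr (- s \<tau>)) / s \<tau>)) sums
       (exp (\<i> * of_real (\<tau> * y)) * (psi_error_mellin (s \<tau>) / s \<tau>))"
      unfolding c_def by (intro sums_mult sums_divide psi_error_mellin_sums) (use e in \<open>simp add: s_def\<close>)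
    hence "(\<lambda>n. (1 - \<tau> / lam) * Re (exp (\<i> * of_real (\<tau> * y)) * (of_real (c n) * (of_nat (Suc n) powr (- s \<tau>) - of_nat (Suc (Suc n)) powr (- s \<tau>)) / s \<tau>))) sums g \<tau>"
      unfolding g_def by (rule sums_mult[OF sums_Re])
    also have "(\<lambda>n. (1 - \<tau> / lam) * Re (exp (\<i> * of_real (\<tau> * y)) * (of_real (c n) * (of_nat (Suc n) powr (- s \<tau>) - of_nat (Suc (Suc n)) powr (- s \<tau>)) / s \<tau>))) = (\<lambda>n. f n \<tau>)"
    proof
      fix n
      have "exp (\<i> * of_real (\<tau> * y)) * (of_real (c n) * (of_nat (Suc n) powr (- s \<tau>) - of_nat (Suc (Suc n)) powr (- s \<tau>)) / s \<tau>) =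
         of_real (c n) * (exp (\<i> * of_real (\<tau> * y)) * u n \<tau>)" by (simp add: u_def)
      thus "(1 - \<tau> / lam) * Re (exp (\<i> * of_real (\<tau> * y)) * (of_real (c n) * (of_nat (Suc n) powr (- s \<tau>) - of_nat (Suc (Suc n)) powr (- s \<tau>)) / s \<tau>)) = f n \<tau>"
        unfolding f_def by (simp only: Re_of_real_mult) simp
    qed
    finally show ?thesis .
  qed
  have ul: "uniform_limit {0..lam} (\<lambda>N \<tau>. \<Sum>n<N. f n \<tau>) g sequentially"
  proof -
    have "uniform_limit {0..lam} (\<lambda>N \<tau>. \<Sum>n<N. f n \<tau>) (\<lambda>\<tau>. \<Sum>n. f n \<tau>) sequentially"
    proof (rule Weierstrass_m_test[where M = "\<lambda>n. 6 * real (Suc n) powr (- 1 - e)"])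
      show "summable (\<lambda>n. 6 * real (Suc n) powr (- 1 - e))"
        using e by (intro summable_mult) (subst summable_Suc_iff, auto simp: summable_real_powr_iff)
      fix n \<tau> assume t: "\<tau> \<in> {0..lam}"
      have "norm (u n \<tau>) \<le> norm (s \<tau>) * real (Suc n) powr (- Re (s \<tau>) - 1) / norm (s \<tau>)"
        unfolding u_def norm_divide using e
        by (intro divide_right_mono norm_powr_diff_le) (auto simp: s_def)
      also have "\<dots> = real (Suc n) powr (- 2 - e)" using s0 by (simp add: s_def)
      finally have 1: "norm (u n \<tau>) \<le> real (Suc n) powr (- 2 - e)" .
      have "\<bar>Re (exp (\<i> * of_real (\<tau> * y)) * u n \<tau>)\<bar> \<le> norm (exp (\<i> * of_real (\<tau> * y)) * u n \<tau>)"
        by (rule abs_Re_le_cmod)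
      also have "\<dots> = norm (u n \<tau>)" by (simp add: norm_mult)
      finally have 2: "\<bar>Re (exp (\<i> * of_real (\<tau> * y)) * u n \<tau>)\<bar> \<le> real (Suc n) powr (- 2 - e)" using 1 by linarith
      have 3: "\<bar>1 - \<tau> / lam\<bar> \<le> 1" using t lam by (auto simp: abs_le_iff)
      have 4: "\<bar>c n\<bar> \<le> 6 * real (Suc n)" using psi_le[of "Suc n"] psi_nonneg[of "Suc n"] by (auto simp: c_def)
      have "norm (f n \<tau>) \<le> 6 * real (Suc n) * (1 * real (Suc n) powr (- 2 - e))"
        unfolding f_def real_norm_def abs_mult using 2 3 4 by (intro mult_mono) auto
      also have "\<dots> = 6 * real (Suc n) powr (- 1 - e)"
        using powr_add[of "real (Suc n)" 1 "- 2 - e"] by simp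
      finally show "norm (f n \<tau>) \<le> 6 * real (Suc n) powr (- 1 - e)" .
    qed
    thus ?thesis using fs by (simp add: sums_iff)
  qed
  have cf: "continuous_on {0..lam} (f n)" for n
  proof -
    have cs: "continuous_on {0..lam} s" unfolding s_def by (intro continuous_on_Complex continuous_intros)
    have cp: "continuous_on {0..lam} (\<lambda>\<tau>. of_nat (Suc k) powr (- s \<tau>) :: complex)" for k
    proof -
      have "of_nat (Suc k) powr (- s \<tau>) = exp (- s \<tau> * Ln (of_nat (Suc k)))" for \<tau>
        by (simp add: powr_def del: of_nat_Suc)
      thus ?thesis by (simp only:) (intro continuous_intros cs)
    qed
    have cl: "continuous_on {0..lam} (\<lambda>\<tau>. 1 - \<tau> / lam)" using lam by (intro continuous_intros) auto
    show ?thesis unfolding f_def u_def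
      by (intro continuous_on_mult continuous_on_Re continuous_on_divide continuous_on_diff cp cs cl continuous_on_exp
           continuous_on_const continuous_on_of_real continuous_on_id) (use s0 in auto)
  qed
  have cF: "continuous_on {0..lam} (\<lambda>\<tau>. \<Sum>n<N. f n \<tau>)" for N by (intro continuous_on_sum cf)
  obtain I J where IJ: "\<And>N. ((\<lambda>\<tau>. \<Sum>n<N. f n \<tau>) has_integral I N) {0..lam}" "(g has_integral J) {0..lam}" "(I \<longlongrightarrow> J) sequentially"
    by (rule uniform_limit_integral[OF ul cF trivial_limit_sequentially]) (rule that, assumption+)
  have Ieq: "I N = (\<Sum>n<N. c n * fejer_weight lam y e (Suc n))" for N
  proof -
    have "(f n has_integral c n * fejer_weight lam y e (Suc n)) {0..lam}" for n
    proof -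
      have "f n integrable_on {0..lam}" by (rule integrable_continuous_real[OF cf])
      moreover have "integral {0..lam} (f n) = c n * fejer_weight lam y e (Suc n)"
        unfolding f_def by (subst integral_mult_right, subst fejer_weight_eq) (use lam e in \<open>auto simp: u_def s_def\<close>)
      ultimately show ?thesis by (simp add: has_integral_iff)
    qed
    hence "((\<lambda>\<tau>. \<Sum>n<N. f n \<tau>) has_integral (\<Sum>n<N. c n * fejer_weight lam y e (Suc n))) {0..lam}"
      by (intro has_integral_sum) auto
    thus ?thesis using IJ(1) has_integral_unique by blast
  qed
  have "I = (\<lambda>N. \<Sum>n<N. c n * fejer_weight lam y e (Suc n))" using Ieq by (rule ext)
  hence "(\<lambda>n. c n * fejer_weight lam y e (Suc n)) sums J" using IJ(3) unfolding sums_def by (simp only:)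
  moreover have "J = integral {0..lam} g" using IJ(2) by (simp add: integral_unique)
  ultimately show ?thesis unfolding c_def g_def s_def by simp
qed

lemma sum_integral_Suc:
  fixes f :: "real \<Rightarrow> real"
  assumes "a \<le> b" "f integrable_on {real a..real b}"
  shows "(\<Sum>m=a..<b. integral {real m..real m + 1} f) = integral {real a..real b} f"
  using assms
proof (induction b)
  case 0
  thus ?case by simp
next
  case (Suc b)
  show ?case
  proof (cases "a = Suc b")
    case False
    hence ab: "a \<le> b" using Suc.prems by simp
    have i: "f integrable_on {real a..real b}"
      by (rule integrable_subinterval_real[OF Suc.prems(2)]) auto
    have "(\<Sum>m=a..<Suc b. integral {real m..real m + 1} f) = integral {real a..real b} f + integral {real b..real (Suc b)} f"
      using Suc.IH[OF ab i] ab by (simp add: add.commute)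
    also have "\<dots> = integral {real a..real (Suc b)} f"
      using ab Suc.prems by (intro Henstock_Kurzweil_Integration.integral_combine) auto
    finally show ?thesis .
  qed simp
qed

text \<open>
  One integration by parts: a quantitative Riemann-Lebesgue lemma.
\<close>
lemma oscillatory_bound:
  fixes p p' :: "real \<Rightarrow> complex"
  assumes lam: "lam > 0" and y: "y > 0"
    and d: "\<And>t. t \<in> {0..lam} \<Longrightarrow> (p has_vector_derivative p' t) (at t within {0..lam})"
    and c: "continuous_on {0..lam} p'"
    and A: "\<And>t. t \<in> {0..lam} \<Longrightarrow> norm (p t) \<le> A" and B: "\<And>t. t \<in> {0..lam} \<Longrightarrow> norm (p' t) \<le> B"
  shows "norm (integral {0..lam} (\<lambda>t. p t * exp (\<i> * of_real (t * y)))) \<le> (2 * A + B * lam) / y"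
proof -
  define E where "E = (\<lambda>t::real. exp (\<i> * of_real (t * y)) / (\<i> * of_real y))"
  have y0: "\<i> * complex_of_real y \<noteq> 0" using y by simp
  have dE: "(E has_vector_derivative exp (\<i> * of_real (t * y))) (at t within {0..lam})" for t
  proof -
    have "((\<lambda>z. exp (\<i> * (z * of_real y)) / (\<i> * of_real y)) has_field_derivative exp (\<i> * (of_real t * of_real y))) (at (of_real t))"
      using y by (auto intro!: derivative_eq_intros simp: mult_ac)
    from has_vector_derivative_real_field[OF this] show ?thesis unfolding E_def by simp
  qed
  have nE: "norm (E t) = 1 / y" for t using y by (simp add: E_def norm_divide norm_mult)
  have "((\<lambda>t. p t * exp (\<i> * of_real (t * y)) + p' t * E t) has_integral (p lam * E lam - p 0 * E 0)) {0..lam}"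
    using lam by (intro fundamental_theorem_of_calculus has_vector_derivative_mult d dE) auto
  moreover have i2: "(\<lambda>t. p' t * E t) integrable_on {0..lam}"
    using y by (intro integrable_continuous_real continuous_intros c) (auto simp: E_def intro!: continuous_intros)
  ultimately have "((\<lambda>t. (p t * exp (\<i> * of_real (t * y)) + p' t * E t) - p' t * E t) has_integral
     ((p lam * E lam - p 0 * E 0) - integral {0..lam} (\<lambda>t. p' t * E t))) {0..lam}"
    by (intro has_integral_diff) (auto simp: has_integral_integral)
  hence "integral {0..lam} (\<lambda>t. p t * exp (\<i> * of_real (t * y))) = (p lam * E lam - p 0 * E 0) - integral {0..lam} (\<lambda>t. p' t * E t)"
    by (simp add: integral_unique)
  also have "norm \<dots> \<le> (norm (p lam * E lam) + norm (p 0 * E 0)) + norm (integral {0..lam} (\<lambda>t. p' t * E t))"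
    by (intro order_trans[OF norm_triangle_ineq4] add_mono order_refl norm_triangle_ineq4)
  also have "norm (p lam * E lam) \<le> A * (1 / y)" unfolding norm_mult nE using A[of lam] lam y by (intro mult_right_mono) auto
  also have "norm (p 0 * E 0) \<le> A * (1 / y)" unfolding norm_mult nE using A[of 0] lam y by (intro mult_right_mono) auto
  also have "norm (integral {0..lam} (\<lambda>t. p' t * E t)) \<le> B * (1 / y) * (lam - 0)"
  proof (rule integral_bound)
    show "continuous_on {0..lam} (\<lambda>t. p' t * E t)"
      using y by (intro continuous_intros c) (auto simp: E_def intro!: continuous_intros)
    show "norm (p' t * E t) \<le> B * (1 / y)" if "t \<in> {0..lam}" for t
      unfolding norm_mult nE using B[OF that] y by (intro mult_right_mono) auto
  qed (use lam in auto)
  finally show ?thesis using y by (simp add: field_simps)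
qed

text \<open>
  The transform is holomorphic in a neighbourhood of the closed half-plane Re s \<ge> 1, by the absence of zeros on
  Re s = 1, so it and its derivative are bounded on the compact rectangle 1 \<le> Re s \<le> 2,
  0 \<le> Im s \<le> \<open>lam\<close>. The constant is therefore uniform in e, which stands in for a passage to
  the limit e \<rightarrow> 0.
\<close>
lemma smoothed_boundary_bound:
  assumes lam: "lam > 0"
  obtains C where "\<And>e y. 0 < e \<Longrightarrow> e \<le> 1 \<Longrightarrow> y > 0 \<Longrightarrow>
     \<bar>integral {0..lam} (\<lambda>\<tau>. (1 - \<tau> / lam) * Re (exp (\<i> * of_real (\<tau> * y)) * (psi_error_mellin (Complex (1 + e) \<tau>) / Complex (1 + e) \<tau>)))\<bar> \<le> C / y"
proof -
  define D where "D = ({s. Re s > -1} - {s. zeta_reg s = 0}) - {0}"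
  define g where "g = (\<lambda>s. psi_error_mellin s / s)"
  have D: "open D" unfolding D_def by (intro open_delete psi_error_mellin_domain)
  have g: "g holomorphic_on D" unfolding g_def D_def
    by (intro holomorphic_intros holomorphic_on_subset[OF psi_error_mellin_holomorphic]) auto
  define K where "K = cbox (Complex 1 0) (Complex 2 lam)"
  have K: "compact K" by (simp add: K_def)
  have KD: "K \<subseteq> D" unfolding K_def D_def using zeta_reg_nonzero by (auto simp: in_cbox_complex_iff)
  have cg: "continuous_on K g" "continuous_on K (deriv g)"
    using holomorphic_on_imp_continuous_on[OF g] holomorphic_on_imp_continuous_on[OF holomorphic_deriv[OF g D]] KD
    by (auto elim: continuous_on_subset)
  obtain A where A: "\<And>s. s \<in> K \<Longrightarrow> norm (g s) \<le> A"
    using compact_imp_bounded[OF compact_continuous_image[OF cg(1) K]] by (auto simp: bounded_iff)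
  obtain B where B: "\<And>s. s \<in> K \<Longrightarrow> norm (deriv g s) \<le> B"
    using compact_imp_bounded[OF compact_continuous_image[OF cg(2) K]] by (auto simp: bounded_iff)
  have "Complex 1 0 \<in> K" using lam by (simp add: K_def in_cbox_complex_iff)
  hence A0: "A \<ge> 0" using A norm_ge_zero order_trans by blast
  show ?thesis
  proof (rule that)
    fix e y :: real assume e: "0 < e" "e \<le> 1" and y: "y > 0"
    define s where "s = (\<lambda>\<tau>. Complex (1 + e) \<tau>)"
    have sK: "s \<tau> \<in> K" if "\<tau> \<in> {0..lam}" for \<tau> using that e by (auto simp: s_def K_def in_cbox_complex_iff)
    define p where "p = (\<lambda>\<tau>. of_real (1 - \<tau> / lam) * g (s \<tau>))"
    define p' where "p' = (\<lambda>\<tau>. of_real (1 - \<tau> / lam) * (\<i> * deriv g (s \<tau>)) + of_real (- 1 / lam) * g (s \<tau>))"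
    have cs: "continuous_on A s" for A unfolding s_def by (intro continuous_on_Complex continuous_intros)
    have cgs: "continuous_on {0..lam} (\<lambda>\<tau>. g (s \<tau>))" "continuous_on {0..lam} (\<lambda>\<tau>. deriv g (s \<tau>))"
      by (rule continuous_on_compose2[OF cg(1) cs] continuous_on_compose2[OF cg(2) cs]; use sK in auto)+
    have "norm (integral {0..lam} (\<lambda>\<tau>. p \<tau> * exp (\<i> * of_real (\<tau> * y)))) \<le> (2 * A + (B + A / lam) * lam) / y"
    proof (rule oscillatory_bound[OF lam y])
      fix t assume t: "t \<in> {0..lam}"
      have dg: "(g has_field_derivative deriv g (s t)) (at (s t))"
        using holomorphic_derivI[OF g D] sK[OF t] KD by blast
      have s_eq: "s = (\<lambda>t. of_real (1 + e) + \<i> * of_real t)" by (auto simp: s_def complex_eq_iff)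
      have ds: "(s has_vector_derivative \<i>) (at t within {0..lam})"
        unfolding s_eq by (auto intro!: derivative_eq_intros)
      have "((g \<circ> s) has_vector_derivative (\<i> * deriv g (s t))) (at t within {0..lam})"
        by (rule field_vector_diff_chain_within[OF ds has_field_derivative_at_within[OF dg]])
      moreover have "((\<lambda>\<tau>. complex_of_real (1 - \<tau> / lam)) has_vector_derivative of_real (- 1 / lam)) (at t within {0..lam})"
        using lam by (auto intro!: derivative_eq_intros has_vector_derivative_of_real simp: has_real_derivative_iff_has_vector_derivative[symmetric] simp del: of_real_diff of_real_divide)
      ultimately show "(p has_vector_derivative p' t) (at t within {0..lam})"
        unfolding p_def p'_def o_def by (intro has_vector_derivative_mult)
      have l1: "norm (complex_of_real (1 - t / lam)) \<le> 1"
        using t lam by (simp only: norm_of_real) (auto simp: abs_le_iff)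
      show "norm (p t) \<le> A" unfolding p_def norm_mult
        using mult_mono[OF l1 A[OF sK[OF t]]] by simp
      have "norm (p' t) \<le> norm (complex_of_real (1 - t / lam)) * norm (deriv g (s t)) + norm (complex_of_real (- 1 / lam)) * norm (g (s t))"
        unfolding p'_def by (rule order_trans[OF norm_triangle_ineq]) (simp add: norm_mult del: of_real_diff of_real_divide)
      also have "\<dots> \<le> 1 * B + 1 / lam * A"
        by (intro add_mono mult_mono l1 A B sK t) (use lam in \<open>auto simp: norm_divide\<close>)
      finally show "norm (p' t) \<le> B + A / lam" by simp
    next
      show "continuous_on {0..lam} p'" unfolding p'_def using lam by (intro continuous_intros cgs) auto
    qed
    moreover have "(\<lambda>\<tau>. p \<tau> * exp (\<i> * of_real (\<tau> * y))) integrable_on {0..lam}"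
      unfolding p_def using lam by (intro integrable_continuous_real continuous_intros cgs) auto
    hence "integral {0..lam} (\<lambda>\<tau>. Re (p \<tau> * exp (\<i> * of_real (\<tau> * y)))) = Re (integral {0..lam} (\<lambda>\<tau>. p \<tau> * exp (\<i> * of_real (\<tau> * y))))"
      using integral_linear[OF _ bounded_linear_Re] unfolding o_def by blast
    moreover have "Re (p \<tau> * exp (\<i> * of_real (\<tau> * y))) = (1 - \<tau> / lam) * Re (exp (\<i> * of_real (\<tau> * y)) * (psi_error_mellin (s \<tau>) / s \<tau>))" for \<tau>
    proof -
      have "p \<tau> * exp (\<i> * of_real (\<tau> * y)) = of_real (1 - \<tau> / lam) * (exp (\<i> * of_real (\<tau> * y)) * (psi_error_mellin (s \<tau>) / s \<tau>))"
        by (simp add: p_def g_def)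
      thus ?thesis by (simp only: Re_of_real_mult)
    qed
    ultimately show "\<bar>integral {0..lam} (\<lambda>\<tau>. (1 - \<tau> / lam) * Re (exp (\<i> * of_real (\<tau> * y)) * (psi_error_mellin (Complex (1 + e) \<tau>) / Complex (1 + e) \<tau>)))\<bar> \<le> (2 * A + (B + A / lam) * lam) / y"
      using abs_Re_le_cmod[of "integral {0..lam} (\<lambda>\<tau>. p \<tau> * exp (\<i> * of_real (\<tau> * y)))"] unfolding s_def by simp
  qed
qed

section \<open>A lower bound for the number of primes\<close>

lemma fejer_weight_integrand_integrable:
  assumes "lam > 0" "a \<ge> 1"
  shows "(\<lambda>x. x powr c * fejer lam (y - ln x)) integrable_on {a..b}"
proof -
  have "continuous_on {a..b} (\<lambda>x. fejer lam (y - ln x))"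
    by (rule continuous_on_compose2[OF fejer_continuous[OF assms(1), of UNIV]])
       (use assms in \<open>auto intro!: continuous_intros\<close>)
  thus ?thesis using assms by (intro integrable_continuous_real continuous_intros) auto
qed

lemma fejer_majorant_antiderivative:
  fixes lam y x :: real
  assumes "x > 0" "y - ln x \<noteq> 0" "lam > 0"
  shows "((\<lambda>x. 2 / lam * (1 / (y - ln x))) has_real_derivative (x powr (-1) * (2 / (lam * (y - ln x)\<^sup>2)))) (at x)"
proof -
  have d1: "((\<lambda>x. y - ln x) has_real_derivative (- (1 / x))) (at x)"
    using assms by (auto intro!: derivative_eq_intros)
  have "((\<lambda>x. 2 / lam * inverse (y - ln x)) has_real_derivative (2 / lam * - (inverse (y - ln x) * (- (1 / x)) * inverse (y - ln x)))) (at x)"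
    by (intro DERIV_cmult DERIV_inverse' d1 assms)
  also have "2 / lam * - (inverse (y - ln x) * (- (1 / x)) * inverse (y - ln x)) = x powr (-1) * (2 / (lam * (y - ln x)\<^sup>2))"
  proof -
    define D where "D = y - ln x"
    show ?thesis using assms unfolding D_def[symmetric] by (simp add: powr_minus power2_eq_square divide_simps)
  qed
  finally show ?thesis by (simp add: inverse_eq_divide)
qed

text \<open>
  Suppose \<psi>(N) < (1 - d) N. As \<psi> increases, \<psi>(m) - m is at most -(\<delta>/2) m for all m between
  (1 - \<delta>/2) N and N. Centre the Fejer weights on this stretch. The stretch then contributes at most
  -\<delta>/32 to the smoothed error; the terms to its left and right contribute little, by the decay of the kernel and
  the Chebyshev bound \<psi>(m) - m \<le> 5 m. So the smoothed error is at most -\<delta>/64,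
  contrary to the bound C / y for large y.
\<close>
lemma psi_lower:
  assumes "d > 0"
  shows "eventually (\<lambda>N. psi N \<ge> (1 - d) * real N) sequentially"
proof -
  (* The assertion for a smaller d implies it for d. *)
  define \<delta> where "\<delta> = min d (1/2)"
  have \<delta>: "0 < \<delta>" "\<delta> < 1" "\<delta> \<le> d" using assms by (auto simp: \<delta>_def)
  (* Chosen so that 20 / (lam * \<eta>) = \<delta> / 64 for \<eta> = \<delta> / 6: the terms outside
     the stretch then contribute at most half of what the stretch contributes. *)
  define lam where "lam = 7680 / \<delta>\<^sup>2"
  have lam: "lam > 0" using \<delta> by (simp add: lam_def)
  define \<eta> where "\<eta> = \<delta> / 6"
  have \<eta>: "\<eta> > 0" using \<delta> by (simp add: \<eta>_def)
  have lam2: "1 / lam \<le> \<eta>"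
  proof -
    have "1 / lam = \<delta> * \<delta> / 7680" by (simp add: lam_def power2_eq_square)
    also have "\<dots> \<le> \<delta> * 1 / 7680" using \<delta> by (intro divide_right_mono mult_left_mono) auto
    also have "\<dots> \<le> \<eta>" using \<delta> by (simp add: \<eta>_def)
    finally show ?thesis .
  qed
  obtain C where C: "\<And>e y. 0 < e \<Longrightarrow> e \<le> 1 \<Longrightarrow> y > 0 \<Longrightarrow>
     \<bar>integral {0..lam} (\<lambda>\<tau>. (1 - \<tau> / lam) * Re (exp (\<i> * of_real (\<tau> * y)) * (psi_error_mellin (Complex (1 + e) \<tau>) / Complex (1 + e) \<tau>)))\<bar> \<le> C / y"
    by (rule smoothed_boundary_bound[OF lam]) (rule that, assumption+)
  have ev1: "eventually (\<lambda>N. real N \<ge> 6 / \<delta>) sequentially" 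
    using filterlim_at_top[THEN iffD1, OF filterlim_real_sequentially] by blast
  have ev2: "eventually (\<lambda>N. ln (real N) - \<eta> > max 1 (64 * C / \<delta>)) sequentially"
  proof -
    have "filterlim (\<lambda>N. ln (real N) - \<eta>) at_top sequentially" by real_asymp
    thus ?thesis unfolding filterlim_at_top_dense by blast
  qed
  from ev1 ev2 show ?thesis
  proof eventually_elim
    case (elim N)
    show ?case
    proof (rule ccontr)
      assume "\<not> psi N \<ge> (1 - d) * real N"
      hence neg: "psi N < (1 - d) * real N" by simp
      have N0: "real N > 0" 
      proof -
        have "6 / \<delta> > 0" using \<delta> by simp
        thus ?thesis using elim(1) by linarith
      qed
      have N: "psi N \<le> (1 - \<delta>) * real N"
      proof -
        have "(1 - d) * real N \<le> (1 - \<delta>) * real N" using \<delta> by (intro mult_right_mono) auto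
        thus ?thesis using neg by linarith
      qed
      define y where "y = ln (real N) - \<eta>"
      have y: "y > 1" "y > 64 * C / \<delta>" using elim(2) by (auto simp: y_def)
      define M where "M = nat \<lceil>(1 - \<delta> / 2) * real N\<rceil>"
      have M1: "real M \<ge> (1 - \<delta> / 2) * real N" unfolding M_def by (rule real_nat_ceiling_ge)
      have pp: "(1 - \<delta> / 2) * real N > 0" using \<delta> N0 by simp
      have M2: "real M \<le> (1 - \<delta> / 2) * real N + 1"
      proof -
        have "real M = of_int \<lceil>(1 - \<delta> / 2) * real N\<rceil>" using pp by (simp add: M_def)
        thus ?thesis by linarith
      qed
      have "real M > 0" using M1 pp by linarith
      hence M0: "M \<ge> 1" by simp
      have M3: "real M \<le> (1 - \<delta> / 3) * real N"
      proof -
        have "1 \<le> \<delta> / 6 * real N" using elim(1) \<delta> by (simp add: field_simps)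
        thus ?thesis using M2 by (simp add: algebra_simps)
      qed
      have MN: "M \<le> N"
      proof -
        have "(1 - \<delta> / 3) * real N \<le> 1 * real N" using \<delta> by (intro mult_right_mono) auto
        thus ?thesis using M3 by linarith
      qed
      have e2: "exp (- 2 * \<eta>) \<ge> 1 - \<delta> / 3" using exp_ge_add_one_self[of "- 2 * \<eta>"] by (simp add: \<eta>_def)
      have Me: "real M \<le> exp (y - \<eta>)"
      proof -
        have "exp (y - \<eta>) = real N * exp (- 2 * \<eta>)"
        proof -
          have "y - \<eta> = ln (real N) + (- 2 * \<eta>)" by (simp add: y_def)
          thus ?thesis using N0 by (simp only: exp_add exp_ln)
        qed
        also have "\<dots> \<ge> real N * (1 - \<delta> / 3)" using e2 by (intro mult_left_mono) auto
        finally show ?thesis using M3 by (simp add: mult.commute)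
      qed
      (* Small enough that the convergence factor m powr (-e) stays at least 1/2 up to N + 1. *)
      define e where "e = min 1 (ln 2 / ln (real N + 1))"
      have lnN: "ln (real N + 1) > 0" using N0 by simp
      have e: "0 < e" "e \<le> 1" using lnN by (auto simp: e_def)
      have eN: "(real N + 1) powr (-e) \<ge> 1/2"
      proof -
        have "e * ln (real N + 1) \<le> ln 2" using lnN by (simp add: e_def min_def field_simps)
        hence "exp (- (e * ln (real N + 1))) \<ge> exp (- ln 2)" by simp
        thus ?thesis using N0 by (simp add: powr_def exp_minus)
      qed
      define w where "w = fejer_weight lam y e"
      define f where "f = (\<lambda>x. x powr (-1) * fejer lam (y - ln x))"
      define fe where "fe = (\<lambda>x. x powr (- 2 - e) * fejer lam (y - ln x))"
      have fi: "f integrable_on {a..b}" "fe integrable_on {a..b}" if "a \<ge> 1" for a b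
        unfolding f_def fe_def by (rule fejer_weight_integrand_integrable[OF lam that])+
      have f0: "f x \<ge> 0" "fe x \<ge> 0" for x 
        unfolding f_def fe_def by (intro mult_nonneg_nonneg fejer_nonneg lam powr_ge_zero)+
      have w_le: "real m * w m \<le> integral {real m..real m + 1} f" if "m \<ge> 1" for m
      proof -
        have "real m * w m = integral {real m..real m + 1} (\<lambda>x. real m * fe x)"
          unfolding w_def fejer_weight_def fe_def by simp
        also have "\<dots> \<le> integral {real m..real m + 1} f"
        proof (rule integral_le)
          show "(\<lambda>x. real m * fe x) integrable_on {real m..real m + 1}"
            using that by (intro integrable_on_mult_right fi) auto
          show "f integrable_on {real m..real m + 1}" using that by (intro fi) auto
          fix x assume x: "x \<in> {real m..real m + 1}"
          hence x1: "x \<ge> 1" using that by auto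
          have "x powr (-2-e) \<le> x powr (-2)" using x1 e by (intro powr_mono) auto
          hence "real m * x powr (-2-e) \<le> x * x powr (-2)" using x by (intro mult_mono) auto
          also have "\<dots> = x powr (-1)" using x1 powr_add[of x 1 "-2"] by simp
          finally have "(real m * x powr (-2-e)) * fejer lam (y - ln x) \<le> x powr (-1) * fejer lam (y - ln x)"
            by (intro mult_right_mono fejer_nonneg lam)
          thus "real m * fe x \<le> f x" by (simp add: fe_def f_def mult.assoc)
        qed
        finally show ?thesis .
      qed
      have w0: "w m \<ge> 0" if "m \<ge> 1" for m unfolding w_def fejer_weight_def
        using that f0(2) fi(2)[of "real m" "real m + 1"] by (intro integral_nonneg) (auto simp: fe_def)
      have low: "integral {1..real M} f \<le> 2 / (lam * \<eta>)"
      proof -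
        define G where "G = (\<lambda>x. 2 / lam * (1 / (y - ln x)))"
        have lt: "ln x \<le> y - \<eta>" if "1 \<le> x" "x \<le> real M" for x
        proof -
          have "x \<le> exp (y - \<eta>)" using that Me by linarith
          hence "ln x \<le> ln (exp (y - \<eta>))" using that by (subst ln_le_cancel_iff) auto
          thus ?thesis by simp
        qed
        have hi: "((\<lambda>x. x powr (-1) * (2 / (lam * (y - ln x)\<^sup>2))) has_integral (G (real M) - G 1)) {1..real M}"
        proof (rule fundamental_theorem_of_calculus)
          fix x assume x: "x \<in> {1..real M}"
          have nz: "y - ln x \<noteq> 0" "x > 0" using lt[of x] x \<eta> by auto
          have "(G has_real_derivative (x powr (-1) * (2 / (lam * (y - ln x)\<^sup>2)))) (at x)"
            unfolding G_def using nz lam by (intro fejer_majorant_antiderivative) auto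
          thus "(G has_vector_derivative (x powr (-1) * (2 / (lam * (y - ln x)\<^sup>2)))) (at x within {1..real M})"
            by (simp add: has_real_derivative_iff_has_vector_derivative has_vector_derivative_at_within)
        qed (use M0 in auto)
        have "integral {1..real M} f \<le> G (real M) - G 1"
        proof (rule has_integral_le[OF integrable_integral hi])
          fix x assume x: "x \<in> {1..real M}"
          have nz: "y - ln x \<noteq> 0" "x > 0" using lt[of x] x \<eta> by auto
          show "f x \<le> x powr (-1) * (2 / (lam * (y - ln x)\<^sup>2))"
            unfolding f_def using fejer_le[OF lam nz(1)] by (intro mult_left_mono) auto
        qed (rule fi, simp)
        also have "\<dots> \<le> G (real M)" using y lam by (simp add: G_def)
        also have "\<dots> \<le> 2 / lam * (1 / \<eta>)" unfolding G_def using lt[of "real M"] M0 \<eta> lam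
          by (intro mult_left_mono divide_left_mono mult_pos_pos) auto
        finally show ?thesis by simp
      qed
      have high: "integral {real N..real J} f \<le> 2 / (lam * \<eta>)" if "J \<ge> N" for J
      proof -
        define G where "G = (\<lambda>x. 2 / lam * (1 / (y - ln x)))"
        have gt: "ln x - y \<ge> \<eta>" if "real N \<le> x" for x
          using that N0 by (simp add: y_def)
        have hi: "((\<lambda>x. x powr (-1) * (2 / (lam * (y - ln x)\<^sup>2))) has_integral (G (real J) - G (real N))) {real N..real J}"
        proof (rule fundamental_theorem_of_calculus)
          fix x assume x: "x \<in> {real N..real J}"
          have nz: "y - ln x \<noteq> 0" "x > 0" using gt[of x] x \<eta> N0 by auto
          have "(G has_real_derivative (x powr (-1) * (2 / (lam * (y - ln x)\<^sup>2)))) (at x)"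
            unfolding G_def using nz lam by (intro fejer_majorant_antiderivative) auto
          thus "(G has_vector_derivative (x powr (-1) * (2 / (lam * (y - ln x)\<^sup>2)))) (at x within {real N..real J})"
            by (simp add: has_real_derivative_iff_has_vector_derivative has_vector_derivative_at_within)
        qed (use that in auto)
        have "integral {real N..real J} f \<le> G (real J) - G (real N)"
        proof (rule has_integral_le[OF integrable_integral hi])
          fix x assume x: "x \<in> {real N..real J}"
          have nz: "y - ln x \<noteq> 0" "x > 0" using gt[of x] x \<eta> N0 by auto
          show "f x \<le> x powr (-1) * (2 / (lam * (y - ln x)\<^sup>2))"
            unfolding f_def using fejer_le[OF lam nz(1)] by (intro mult_left_mono) auto
        qed (rule fi, use M0 MN in simp)
        also have "\<dots> \<le> - G (real N)" using gt[of "real J"] that \<eta> lam by (simp add: G_def divide_nonneg_nonpos mult_nonneg_nonpos)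
        also have "\<dots> \<le> 2 / lam * (1 / \<eta>)" using \<eta> lam N0 by (simp add: G_def y_def)
        finally show ?thesis by simp
      qed
      (* The peak of the kernel, of height lam / 4 and logarithmic width 2 / lam, lies inside [M, N]. *)
      have win: "integral {real M..real N} f \<ge> 1/4"
      proof -
        have sub: "real M \<le> exp (y - 1 / lam)" "exp (y + 1 / lam) \<le> real N"
        proof -
          have "exp (y - \<eta>) \<le> exp (y - 1 / lam)" using lam2 by simp
          thus "real M \<le> exp (y - 1 / lam)" using Me by linarith
          have "exp (y + 1 / lam) \<le> exp (ln (real N))" using lam2 by (simp add: y_def)
          thus "exp (y + 1 / lam) \<le> real N" using N0 by simp
        qed
        define G where "G = (\<lambda>x. lam / 4 * ln x)"
        define a where "a = exp (y - 1 / lam)"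
        define b where "b = exp (y + 1 / lam)"
        have ab: "a \<le> b" "a > 0" using lam by (auto simp: a_def b_def)
        have "1 \<le> real M" using M0 by simp
        hence a1: "a \<ge> 1" using sub(1) unfolding a_def by linarith
        have hi: "((\<lambda>x. x powr (-1) * (lam / 4)) has_integral (G b - G a)) {a..b}"
        proof (rule fundamental_theorem_of_calculus)
          fix x assume x: "x \<in> {a..b}"
          have "(G has_real_derivative (x powr (-1) * (lam / 4))) (at x)"
            unfolding G_def using x ab by (auto intro!: derivative_eq_intros simp: powr_minus field_simps)
          thus "(G has_vector_derivative (x powr (-1) * (lam / 4))) (at x within {a..b})"
            by (simp add: has_real_derivative_iff_has_vector_derivative has_vector_derivative_at_within)
        qed (use ab in auto)
        have "1/4 \<le> G b - G a" using lam by (simp add: G_def a_def b_def field_simps)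
        also have "\<dots> \<le> integral {a..b} f"
        proof (rule has_integral_le[OF hi integrable_integral])
          show "f integrable_on {a..b}" by (rule fi(1)[OF a1])
          fix x assume x: "x \<in> {a..b}"
          have "ln a \<le> ln x" "ln x \<le> ln b" using x ab by auto
          hence "\<bar>y - ln x\<bar> \<le> 1 / lam" by (auto simp: a_def b_def abs_le_iff)
          thus "x powr (-1) * (lam / 4) \<le> f x"
            unfolding f_def using fejer_ge[OF lam] by (intro mult_left_mono) auto
        qed
        also have "\<dots> \<le> integral {real M..real N} f"
        proof (rule integral_subset_le)
          show "{a..b} \<subseteq> {real M..real N}" using sub unfolding a_def b_def by auto
          show "f integrable_on {a..b}" by (rule fi(1)[OF a1])
          show "f integrable_on {real M..real N}" using M0 by (intro fi) auto
        qed (use f0 in blast)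
        finally show ?thesis .
      qed
      have win2: "(\<Sum>m=M..<N. real m * w m) \<ge> 1/16"
      proof -
        have "1/16 \<le> 1/4 * integral {real M..real N} f" using win by simp
        also have "\<dots> = (\<Sum>m=M..<N. 1/4 * integral {real m..real m + 1} f)"
          unfolding sum_distrib_left[symmetric] using sum_integral_Suc[OF MN fi(1)] M0 by simp
        also have "\<dots> \<le> (\<Sum>m=M..<N. real m * w m)"
        proof (rule sum_mono)
          fix m assume m: "m \<in> {M..<N}"
          hence m1: "m \<ge> 1" using M0 by auto
          have "1/4 * integral {real m..real m + 1} f = integral {real m..real m + 1} (\<lambda>x. 1/4 * f x)" by simp
          also have "\<dots> \<le> integral {real m..real m + 1} (\<lambda>x. real m * fe x)"
          proof (rule integral_le)
            show "(\<lambda>x. real m * fe x) integrable_on {real m..real m + 1}"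
              using m1 by (intro integrable_on_mult_right fi) auto
            show "(\<lambda>x. 1/4 * f x) integrable_on {real m..real m + 1}" using m1 by (intro integrable_on_mult_right fi) auto
            fix x assume x: "x \<in> {real m..real m + 1}"
            have x1: "x \<ge> 1" "x \<le> 2 * real m" using x m1 by auto
            have "x \<le> real N + 1" using x m by auto
            hence "x powr (-e) \<ge> (real N + 1) powr (-e)" using e x1 by (intro powr_mono2') auto
            hence xe: "x powr (-e) \<ge> 1/2" using eN by linarith
            have "1/4 * x powr (-1) = (x / 2) * (x powr (-2) * (1/2))"
              using x1 powr_add[of x 1 "-2"] by simp
            also have "\<dots> \<le> real m * (x powr (-2) * x powr (-e))"
              using x1 xe by (intro mult_mono) auto
            also have "x powr (-2) * x powr (-e) = x powr (-2-e)" by (simp add: powr_add[symmetric])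
            finally have "(1/4 * x powr (-1)) * fejer lam (y - ln x) \<le> (real m * x powr (-2-e)) * fejer lam (y - ln x)"
              by (intro mult_right_mono fejer_nonneg lam)
            thus "1/4 * f x \<le> real m * fe x" by (simp add: fe_def f_def mult.assoc)
          qed
          also have "\<dots> = real m * w m" unfolding w_def fejer_weight_def fe_def by simp
          finally show "1/4 * integral {real m..real m + 1} f \<le> real m * w m" .
        qed
        finally show ?thesis .
      qed
      define c where "c = (\<lambda>m. psi m - real m)"
      have c5: "c m \<le> 5 * real m" for m using psi_le[of m] by (simp add: c_def)
      have cneg: "c m \<le> - (\<delta> / 2) * real m" if "m \<in> {M..<N}" for m
      proof -
        have "psi m \<le> psi N" using that by (intro psi_mono) auto
        also note N
        finally have "c m \<le> (1 - \<delta>) * real N - real m" by (simp add: c_def)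
        also have "(1 - \<delta>) * real N - real m \<le> - (\<delta> / 2) * real N"
          using M1 that by (auto simp: algebra_simps)
        also have "\<dots> \<le> - (\<delta> / 2) * real m" using that \<delta> by (intro mult_left_mono_neg) auto
        finally show ?thesis .
      qed
      have bound: "(\<Sum>m=1..<J. c m * w m) \<le> 20 / (lam * \<eta>) - \<delta> / 32" if J: "J \<ge> N" for J
      proof -

        have "(\<Sum>m=1..<J. c m * w m) = (\<Sum>m=1..<M. c m * w m) + ((\<Sum>m=M..<N. c m * w m) + (\<Sum>m=N..<J. c m * w m))"
          using sum.atLeastLessThan_concat[OF MN J, of "\<lambda>m. c m * w m"] sum.atLeastLessThan_concat[of 1 M J "\<lambda>m. c m * w m"] M0 MN J
          by simp
        also have "(\<Sum>m=1..<M. c m * w m) \<le> (\<Sum>m=1..<M. 5 * integral {real m..real m + 1} f)"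
        proof (rule sum_mono)
          fix m assume m: "m \<in> {1..<M}"
          have "c m * w m \<le> 5 * real m * w m" using m by (intro mult_right_mono c5 w0) auto
          thus "c m * w m \<le> 5 * integral {real m..real m + 1} f" using w_le[of m] m by auto
        qed
        also have "\<dots> = 5 * integral {1..real M} f"
          unfolding sum_distrib_left[symmetric] using sum_integral_Suc[of 1 M f] M0 fi(1)[of 1 "real M"] by simp
        also have "\<dots> \<le> 5 * (2 / (lam * \<eta>))" using low by simp
        also have "(\<Sum>m=N..<J. c m * w m) \<le> (\<Sum>m=N..<J. 5 * integral {real m..real m + 1} f)"
        proof (rule sum_mono)
          fix m assume m: "m \<in> {N..<J}"
          have m1: "m \<ge> 1" using m MN M0 by auto
          have "c m * w m \<le> 5 * real m * w m" using m1 by (intro mult_right_mono c5 w0) auto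
          thus "c m * w m \<le> 5 * integral {real m..real m + 1} f" using w_le[of m] m1 by auto
        qed
        also have "\<dots> = 5 * integral {real N..real J} f"
          unfolding sum_distrib_left[symmetric] using sum_integral_Suc[of N J f] J MN M0 fi(1)[of "real N" "real J"] by simp
        also have "\<dots> \<le> 5 * (2 / (lam * \<eta>))" using high[OF J] by simp
        also have "(\<Sum>m=M..<N. c m * w m) \<le> (\<Sum>m=M..<N. - (\<delta> / 2) * (real m * w m))"
        proof (rule sum_mono)
          fix m assume m: "m \<in> {M..<N}"
          have "c m * w m \<le> (- (\<delta> / 2) * real m) * w m" using m M0 by (intro mult_right_mono cneg w0) auto
          thus "c m * w m \<le> - (\<delta> / 2) * (real m * w m)" by (simp add: mult.assoc)
        qed
        also have "\<dots> = - (\<delta> / 2) * (\<Sum>m=M..<N. real m * w m)" by (rule sum_distrib_left[symmetric])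
        also have "\<dots> \<le> - (\<delta> / 2) * (1/16)" using win2 \<delta> by (intro mult_left_mono_neg) auto
        finally show ?thesis by (simp add: mult.commute)
      qed
      have sums: "(\<lambda>n. c (Suc n) * w (Suc n)) sums
        integral {0..lam} (\<lambda>\<tau>. (1 - \<tau> / lam) * Re (exp (\<i> * of_real (\<tau> * y)) * (psi_error_mellin (Complex (1 + e) \<tau>) / Complex (1 + e) \<tau>)))" (is "_ sums ?R")
        unfolding c_def w_def using lam e by (intro fejer_smoothed_psi_error) auto
      have r1: "?R \<le> 20 / (lam * \<eta>) - \<delta> / 32"
      proof (rule LIMSEQ_le_const2[OF sums[unfolded sums_def]])
        have "(\<Sum>i<n. c (Suc i) * w (Suc i)) \<le> 20 / (lam * \<eta>) - \<delta> / 32" if "n \<ge> N" for n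
        proof -
          have "(\<Sum>i<n. c (Suc i) * w (Suc i)) = (\<Sum>m=1..<Suc n. c m * w m)"
            by (induction n) auto
          thus ?thesis using bound[of "Suc n"] that by simp
        qed
        thus "\<exists>N. \<forall>n\<ge>N. (\<Sum>i<n. c (Suc i) * w (Suc i)) \<le> 20 / (lam * \<eta>) - \<delta> / 32" by blast
      qed
      have eqn: "20 / (lam * \<eta>) = \<delta> / 64"
        using \<delta> by (simp add: lam_def \<eta>_def power2_eq_square field_simps)
      define R where "R = ?R"
      define q where "q = C / y"
      have "R \<le> \<delta> / 64 - \<delta> / 32" using r1 unfolding eqn R_def .
      moreover have "R \<ge> - q" using C[OF e, of y] y unfolding R_def q_def by (simp add: abs_le_iff)
      moreover have "q < \<delta> / 64"
        using y \<delta> unfolding q_def by (simp add: field_simps)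
      ultimately show False using \<delta> by linarith
    qed
  qed
qed

text \<open>
  Each prime p \<le> n contributes ln p once for each of its powers up to n, in total at most ln n.
\<close>
lemma psi_le_card_primes: "psi n \<le> real (card {p. prime p \<and> p \<le> n}) * ln (real n)"
proof -
  define A where "A = {k\<in>{1..n}. primepow k}"
  define P where "P = {p. prime p \<and> p \<le> n}"
  have fin: "finite A" "finite P" by (auto simp: A_def P_def)
  have "psi n = (\<Sum>k\<in>A. ln (real (aprimedivisor k)))"
    unfolding psi_def A_def by (subst sum.inter_filter) (auto simp: mangoldt_def intro!: sum.cong)
  also have "\<dots> = (\<Sum>p\<in>P. \<Sum>k\<in>{k\<in>A. aprimedivisor k = p}. ln (real (aprimedivisor k)))"
  proof (rule sum.group[symmetric, OF fin])
    show "aprimedivisor ` A \<subseteq> P"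
    proof safe
      fix k assume k: "k \<in> A"
      hence "primepow k" "k \<ge> 1" "k \<le> n" by (auto simp: A_def)
      moreover from this have "k > 1" using primepow_gt_Suc_0[of k] by simp
      ultimately have "prime (aprimedivisor k)" "aprimedivisor k dvd k"
        by (auto intro!: prime_aprimedivisor' aprimedivisor_dvd')
      thus "aprimedivisor k \<in> P" using \<open>k \<le> n\<close> \<open>k \<ge> 1\<close> by (auto simp: P_def dest!: dvd_imp_le)
    qed
  qed
  also have "\<dots> \<le> (\<Sum>p\<in>P. ln (real n))"
  proof (rule sum_mono)
    fix p assume p: "p \<in> P"
    hence pp: "prime p" "p \<le> n" "p > 1" by (auto simp: P_def dest: prime_gt_Suc_0_nat)
    have lnp: "ln (real p) > 0" using pp by simp
    define m where "m = nat \<lfloor>ln (real n) / ln (real p)\<rfloor>"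
    have "{k\<in>A. aprimedivisor k = p} \<subseteq> (\<lambda>j. p ^ j) ` {1..m}"
    proof
      fix k assume k: "k \<in> {k\<in>A. aprimedivisor k = p}"
      define j where "j = multiplicity p k"
      have kj: "k = p ^ j" using k primepow_decompose[of k] by (auto simp: A_def j_def)
      have "k > 1" using k primepow_gt_Suc_0[of k] by (auto simp: A_def)
      hence j1: "j \<ge> 1" using kj by (cases j) auto
      have "real (p ^ j) \<le> real n" using k kj by (auto simp: A_def simp del: of_nat_power)
      hence "ln (real (p ^ j)) \<le> ln (real n)" using pp by (subst ln_le_cancel_iff) auto
      hence "real j * ln (real p) \<le> ln (real n)" using pp by (simp add: ln_realpow)
      hence "real j \<le> ln (real n) / ln (real p)" using lnp by (simp add: field_simps)
      hence "j \<le> m" unfolding m_def by (simp add: le_nat_iff le_floor_iff)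
      thus "k \<in> (\<lambda>j. p ^ j) ` {1..m}" using kj j1 by auto
    qed
    hence "card {k\<in>A. aprimedivisor k = p} \<le> card ((\<lambda>j. p ^ j) ` {1..m})" by (intro card_mono) auto
    also have "\<dots> \<le> card {1..m}" by (rule card_image_le) auto
    finally have c: "card {k\<in>A. aprimedivisor k = p} \<le> m" by simp
    have "(\<Sum>k\<in>{k\<in>A. aprimedivisor k = p}. ln (real (aprimedivisor k))) = (\<Sum>k\<in>{k\<in>A. aprimedivisor k = p}. ln (real p))"
      by (rule sum.cong) auto
    also have "\<dots> = real (card {k\<in>A. aprimedivisor k = p}) * ln (real p)" by simp
    also have "\<dots> \<le> real m * ln (real p)" using c lnp by (intro mult_right_mono) auto
    also have "real m \<le> ln (real n) / ln (real p)"
      unfolding m_def using lnp pp by (intro of_nat_floor divide_nonneg_pos) auto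
    hence "real m * ln (real p) \<le> ln (real n)" using lnp by (simp add: field_simps)
    finally show "(\<Sum>k\<in>{k\<in>A. aprimedivisor k = p}. ln (real (aprimedivisor k))) \<le> ln (real n)" .
  qed
  also have "\<dots> = real (card P) * ln (real n)" by simp
  finally show ?thesis by (simp add: P_def)
qed

lemma prime_pi_lower:
  assumes "d > 0"
  shows "eventually (\<lambda>t. real (prime_pi t) \<ge> (1 - d) * (t / ln t)) at_top"
proof -
  define \<delta> where "\<delta> = min d 1"
  have \<delta>: "0 < \<delta>" "\<delta> \<le> 1" "\<delta> \<le> d" using assms by (auto simp: \<delta>_def)
  have "eventually (\<lambda>N. psi N \<ge> (1 - \<delta> / 2) * real N) sequentially" using \<delta> by (intro psi_lower) auto
  then obtain N0 where N0: "\<And>N. N \<ge> N0 \<Longrightarrow> psi N \<ge> (1 - \<delta> / 2) * real N" by (auto simp: eventually_sequentially)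
  show ?thesis
    using eventually_ge_at_top[of "real N0 + 1"] eventually_ge_at_top[of "2 / \<delta>"] eventually_ge_at_top[of 3]
  proof eventually_elim
    case (elim t)
    define n where "n = nat \<lfloor>t\<rfloor>"
    have n: "real n \<le> t" "t - 1 \<le> real n" "n \<ge> N0" "n \<ge> 2" using elim by (auto simp: n_def le_nat_iff le_floor_iff)
    have eq: "{p. prime p \<and> p \<le> n} = {p. prime p \<and> real p \<le> t}"
      using elim by (auto simp: n_def le_nat_iff le_floor_iff)
    have lnt: "ln t > 0" "ln (real n) \<le> ln t" using elim n by auto
    have "(1 - d) * t \<le> (1 - \<delta>) * t" using \<delta> elim by (intro mult_right_mono) auto
    also have "(1 - \<delta>) * t \<le> (1 - \<delta> / 2) * (t - 1)"
    proof -
      have "1 \<le> \<delta> / 2 * t" using elim \<delta> by (simp add: field_simps)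
      moreover have "(1 - \<delta> / 2) * (t - 1) - (1 - \<delta>) * t = \<delta> / 2 * t - 1 + \<delta> / 2" by (simp add: field_simps)
      ultimately show ?thesis using \<delta> by linarith
    qed
    also have "\<dots> \<le> (1 - \<delta> / 2) * real n" using \<delta> n by (intro mult_left_mono) auto
    also have "\<dots> \<le> psi n" using N0 n by simp
    also have "\<dots> \<le> real (card {p. prime p \<and> p \<le> n}) * ln (real n)" by (rule psi_le_card_primes)
    also have "\<dots> \<le> real (card {p. prime p \<and> p \<le> n}) * ln t" using lnt by (intro mult_left_mono) auto
    also have "card {p. prime p \<and> p \<le> n} = prime_pi t" by (simp add: eq prime_pi_def)
    finally show ?case using lnt by (simp add: field_simps)
  qed
qed

section \<open>Exponential integrals\<close>

text \<open>
  Integrate by parts after writing exp(i f) as (exp(i f))' / (i f'). As f' is monotone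
  and bounded away from 0, it keeps its sign, so 1/f' is monotone and varies by at most 1/m.
\<close>
lemma first_derivative_test:
  fixes f f' f'' :: "real \<Rightarrow> real"
  assumes ab: "a \<le> b" and m: "m > 0"
    and d1: "\<And>t. t \<in> {a..b} \<Longrightarrow> (f has_real_derivative f' t) (at t within {a..b})"
    and d2: "\<And>t. t \<in> {a..b} \<Longrightarrow> (f' has_real_derivative f'' t) (at t within {a..b})"
    and c2: "continuous_on {a..b} f''" and pos: "\<And>t. t \<in> {a..b} \<Longrightarrow> f'' t \<ge> 0"
    and bd: "\<And>t. t \<in> {a..b} \<Longrightarrow> \<bar>f' t\<bar> \<ge> m"
  shows "norm (integral {a..b} (\<lambda>t. exp (\<i> * of_real (f t)))) \<le> 4 / m"
proof -
  have nz: "f' t \<noteq> 0" if "t \<in> {a..b}" for t using bd[OF that] m by auto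
  have cf1: "continuous_on {a..b} f" by (rule DERIV_continuous_on[OF d1])
  have cf2: "continuous_on {a..b} f'" by (rule DERIV_continuous_on[OF d2])
  note cf = cf1 cf2
  define E where "E = (\<lambda>t. exp (\<i> * of_real (f t)) * (- \<i> * of_real (1 / f' t)))"
  define h where "h = (\<lambda>t. exp (\<i> * of_real (f t)) * (\<i> * of_real (f'' t / (f' t)\<^sup>2)))"
  have dE: "(E has_vector_derivative (exp (\<i> * of_real (f t)) + h t)) (at t within {a..b})" if t: "t \<in> {a..b}" for t
  proof -
    have 1: "((\<lambda>t. exp (\<i> * of_real (f t))) has_vector_derivative (\<i> * of_real (f' t) * exp (\<i> * of_real (f t)))) (at t within {a..b})"
    proof -
      have "((\<lambda>t. \<i> * complex_of_real (f t)) has_vector_derivative (\<i> * of_real (f' t))) (at t within {a..b})"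
        by (intro has_vector_derivative_mult_right has_vector_derivative_of_real) 
           (use d1[OF t] in \<open>simp add: has_real_derivative_iff_has_vector_derivative\<close>)
      from field_vector_diff_chain_within[OF this, of exp "exp (\<i> * of_real (f t))"]
      show ?thesis by (simp add: o_def has_field_derivative_at_within DERIV_exp)
    qed
    have 2: "((\<lambda>t. - \<i> * of_real (1 / f' t)) has_vector_derivative (- \<i> * of_real (- (f'' t) / (f' t)\<^sup>2))) (at t within {a..b})"
    proof -
      have X: "((\<lambda>t. 1 / f' t) has_real_derivative (- (f'' t) / (f' t)\<^sup>2)) (at t within {a..b})"
        using d2[OF t] nz[OF t] by (auto intro!: derivative_eq_intros simp: power2_eq_square)
      show ?thesis
        by (intro has_vector_derivative_mult_right has_vector_derivative_of_real) (use X in \<open>simp add: has_real_derivative_iff_has_vector_derivative\<close>)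
    qed
    have "(E has_vector_derivative (exp (\<i> * of_real (f t)) * (- \<i> * of_real (- (f'' t) / (f' t)\<^sup>2)) +
        (\<i> * of_real (f' t) * exp (\<i> * of_real (f t))) * (- \<i> * of_real (1 / f' t)))) (at t within {a..b})"
      unfolding E_def by (rule has_vector_derivative_mult[OF 1 2])
    also have "exp (\<i> * of_real (f t)) * (- \<i> * of_real (- (f'' t) / (f' t)\<^sup>2)) +
        (\<i> * of_real (f' t) * exp (\<i> * of_real (f t))) * (- \<i> * of_real (1 / f' t)) = exp (\<i> * of_real (f t)) + h t"
      using nz[OF t] by (simp add: h_def mult_ac)
    finally show ?thesis .
  qed
  have ch: "continuous_on {a..b} h" unfolding h_def using nz by (intro continuous_intros cf c2) auto
  have "((\<lambda>t. exp (\<i> * of_real (f t)) + h t) has_integral (E b - E a)) {a..b}"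
    by (rule fundamental_theorem_of_calculus[OF ab dE])
  moreover have "(h has_integral (integral {a..b} h)) {a..b}"
    using integrable_continuous_real[OF ch] by (rule integrable_integral)
  ultimately have "((\<lambda>t. (exp (\<i> * of_real (f t)) + h t) - h t) has_integral (E b - E a - integral {a..b} h)) {a..b}"
    by (rule has_integral_diff)
  hence e: "integral {a..b} (\<lambda>t. exp (\<i> * of_real (f t))) = E b - E a - integral {a..b} h"
    by (simp add: integral_unique)
  have nE: "norm (E t) \<le> 1 / m" if "t \<in> {a..b}" for t
    unfolding E_def using bd[OF that] m by (simp add: norm_mult norm_divide frac_le)
  have "norm (integral {a..b} h) \<le> integral {a..b} (\<lambda>t. f'' t / (f' t)\<^sup>2)"
  proof (rule integral_norm_bound_integral)
    show "(\<lambda>t. f'' t / (f' t)\<^sup>2) integrable_on {a..b}"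
      using nz by (intro integrable_continuous_real continuous_intros cf c2) auto
    show "norm (h t) \<le> f'' t / (f' t)\<^sup>2" if "t \<in> {a..b}" for t
      unfolding h_def using pos[OF that] by (simp add: norm_mult norm_divide norm_power)
  qed (rule integrable_continuous_real[OF ch])
  also have "\<dots> = (- 1 / f' b) - (- 1 / f' a)"
  proof (rule integral_unique, rule fundamental_theorem_of_calculus[OF ab, where f = "\<lambda>t. - 1 / f' t"])
    fix t assume t: "t \<in> {a..b}"
    have "((\<lambda>t. - 1 / f' t) has_real_derivative (f'' t / (f' t)\<^sup>2)) (at t within {a..b})"
      using d2[OF t] nz[OF t] by (auto intro!: derivative_eq_intros simp: power2_eq_square)
    thus "((\<lambda>t. - 1 / f' t) has_vector_derivative (f'' t / (f' t)\<^sup>2)) (at t within {a..b})"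
      by (simp add: has_real_derivative_iff_has_vector_derivative)
  qed
  also have "\<dots> \<le> \<bar>1 / f' b\<bar> + \<bar>1 / f' a\<bar>" by linarith
  also have "\<dots> \<le> 1 / m + 1 / m"
    using bd[of a] bd[of b] ab m by (intro add_mono) (auto simp: abs_divide frac_le)
  finally have "norm (integral {a..b} h) \<le> 1 / m + 1 / m" .
  moreover have "norm (E b - E a - integral {a..b} h) \<le> norm (E b) + norm (E a) + norm (integral {a..b} h)"
    by (metis add_mono_thms_linordered_semiring(3) norm_triangle_ineq4 order_trans)
  moreover have "norm (E b) \<le> 1 / m" "norm (E a) \<le> 1 / m" using nE ab by auto
  ultimately show ?thesis unfolding e by simp
qed

text \<open>
  Since f' increases at rate at least l, it is smaller than sqrt l in absolute value only on an interval
  of length at most 2 / sqrt l around its zero. That interval is estimated trivially,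
  and the first derivative test with m = sqrt l handles the rest.
\<close>
lemma second_derivative_test:
  fixes f f' f'' :: "real \<Rightarrow> real"
  assumes ab: "a \<le> b" and l: "l > 0"
    and d1: "\<And>t. t \<in> {a..b} \<Longrightarrow> (f has_real_derivative f' t) (at t)"
    and d2: "\<And>t. t \<in> {a..b} \<Longrightarrow> (f' has_real_derivative f'' t) (at t)"
    and c2: "continuous_on {a..b} f''" and pos: "\<And>t. t \<in> {a..b} \<Longrightarrow> f'' t \<ge> l"
  shows "norm (integral {a..b} (\<lambda>t. exp (\<i> * of_real (f t)))) \<le> 12 / sqrt l"
proof -
  define m where "m = sqrt l"
  have m: "m > 0" "m * m = l" using l by (auto simp: m_def)
  have lm: "l * (1 / m) = m" using m by (simp add: field_simps)
  have grow: "f' t - f' s \<ge> l * (t - s)" if "s \<in> {a..b}" "t \<in> {a..b}" "s \<le> t" for s t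
  proof (cases "s = t")
    case False
    hence st: "s < t" using that by simp
    have "\<exists>z>s. z < t \<and> f' t - f' s = (t - s) * f'' z"
      by (rule MVT2[OF st]) (use d2 that in auto)
    then obtain z where z: "z > s" "z < t" "f' t - f' s = (t - s) * f'' z" by blast
    have "(t - s) * f'' z \<ge> (t - s) * l" using pos[of z] z that by (intro mult_left_mono) auto
    thus ?thesis using z by (simp add: mult.commute)
  qed auto
  have cf1: "continuous_on {a..b} f" by (rule DERIV_continuous_on[OF has_field_derivative_at_within[OF d1]])
  have cf2: "continuous_on {a..b} f'" by (rule DERIV_continuous_on[OF has_field_derivative_at_within[OF d2]])
  note cf = cf1 cf2
  define e where "e = (\<lambda>t. exp (\<i> * of_real (f t)))"
  have ce: "continuous_on {a..b} e" unfolding e_def by (intro continuous_intros cf)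
  have sub: "norm (integral {c..d} e) \<le> 4 / m" if cd: "c \<le> d" "{c..d} \<subseteq> {a..b}" and big: "\<And>t. t \<in> {c..d} \<Longrightarrow> \<bar>f' t\<bar> \<ge> m" for c d
    unfolding e_def
  proof (rule first_derivative_test[OF cd(1) m(1)])
    show "(f has_real_derivative f' t) (at t within {c..d})" "(f' has_real_derivative f'' t) (at t within {c..d})" 
      "f'' t \<ge> 0" if "t \<in> {c..d}" for t
      using d1[of t] d2[of t] pos[of t] that cd l by (auto intro!: has_field_derivative_at_within)
    show "continuous_on {c..d} f''" by (rule continuous_on_subset[OF c2 cd(2)])
  qed (use big in auto)
  have split: "\<exists>c\<in>{a..b}. (\<forall>t\<in>{a..<c}. f' t \<le> 0) \<and> (\<forall>t\<in>{c<..b}. f' t \<ge> 0)"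
  proof -
    consider "f' a \<ge> 0" | "f' b \<le> 0" | "f' a \<le> 0" "0 \<le> f' b" by linarith
    thus ?thesis
    proof cases
      case 1
      have "f' t \<ge> 0" if "t \<in> {a<..b}" for t
      proof -
        have "l * (t - a) \<ge> 0" using l that by simp
        thus ?thesis using grow[of a t] that 1 by auto
      qed
      thus ?thesis using ab by (intro bexI[of _ a]) auto
    next
      case 2
      have "f' t \<le> 0" if "t \<in> {a..<b}" for t
      proof -
        have "l * (b - t) \<ge> 0" using l that by simp
        thus ?thesis using grow[of t b] that 2 by auto
      qed
      thus ?thesis using ab by (intro bexI[of _ b]) auto
    next
      case 3
      then obtain c where c: "a \<le> c" "c \<le> b" "f' c = 0" using IVT'[of f' a 0 b] ab cf by auto
      have "f' t \<le> 0" if "t \<in> {a..<c}" for t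
      proof -
        have "l * (c - t) \<ge> 0" using l that by simp
        thus ?thesis using grow[of t c] that c by auto
      qed
      moreover have "f' t \<ge> 0" if "t \<in> {c<..b}" for t
      proof -
        have "l * (t - c) \<ge> 0" using l that by simp
        thus ?thesis using grow[of c t] that c by auto
      qed
      ultimately show ?thesis using c by (intro bexI[of _ c]) auto
    qed
  qed
  then obtain c where c: "c \<in> {a..b}" "\<And>t. t \<in> {a..<c} \<Longrightarrow> f' t \<le> 0" "\<And>t. t \<in> {c<..b} \<Longrightarrow> f' t \<ge> 0"
    by blast
  define r where "r = 1 / m"
  have im: "r > 0" "4 / m = 4 * r" "l * r = m" using m lm by (auto simp: r_def)
  define p where "p = max a (c - 2 * r)"
  define q where "q = min b (c + 2 * r)"
  have pq: "a \<le> p" "p \<le> q" "q \<le> b" using c(1) ab im(1) by (auto simp: p_def q_def)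
  have left: "norm (integral {a..p} e) \<le> 4 / m"
  proof (cases "p = a")
    case False
    hence p: "p = c - 2 * r" by (auto simp: p_def max_def split: if_splits)
    show ?thesis
    proof (rule sub)
      fix t assume t: "t \<in> {a..p}"
      define s where "s = c - r"
      have s: "s \<in> {a..b}" "s < c" "t \<le> s" "s - t \<ge> r" using t p im c(1) pq by (auto simp: s_def)
      have "f' s \<le> 0" using c(2)[of s] s by auto
      moreover have "l * (s - t) \<ge> l * r" using s l by (intro mult_left_mono) auto
      moreover have "f' s - f' t \<ge> l * (s - t)" using s t pq by (intro grow) auto
      ultimately have "f' t \<le> - m" using im(3) by linarith
      thus "\<bar>f' t\<bar> \<ge> m" by linarith
    qed (use pq in auto)
  qed (use m in auto)
  have right: "norm (integral {q..b} e) \<le> 4 / m"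
  proof (cases "q = b")
    case False
    hence q: "q = c + 2 * r" by (auto simp: q_def min_def split: if_splits)
    show ?thesis
    proof (rule sub)
      fix t assume t: "t \<in> {q..b}"
      define s where "s = c + r"
      have s: "s \<in> {a..b}" "s > c" "s \<le> t" "t - s \<ge> r" using t q im c(1) pq by (auto simp: s_def)
      have "f' s \<ge> 0" using c(3)[of s] s by auto
      moreover have "l * (t - s) \<ge> l * r" using s l by (intro mult_left_mono) auto
      moreover have "f' t - f' s \<ge> l * (t - s)" using s t pq by (intro grow) auto
      ultimately show "\<bar>f' t\<bar> \<ge> m" using im(3) by linarith
    qed (use pq in auto)
  qed (use m in auto)
  have mid: "norm (integral {p..q} e) \<le> 1 * (q - p)"
  proof (rule integral_bound[OF pq(2)])
    show "continuous_on {p..q} e" by (rule continuous_on_subset[OF ce]) (use pq in auto)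
  qed (simp add: e_def)
  have "q - p \<le> 4 / m" unfolding im(2) by (auto simp: p_def q_def)
  have i: "e integrable_on {a..b}" by (rule integrable_continuous_real[OF ce])
  have "integral {a..b} e = integral {a..p} e + integral {p..b} e"
    using pq i by (intro Henstock_Kurzweil_Integration.integral_combine[symmetric]) auto
  also have "integral {p..b} e = integral {p..q} e + integral {q..b} e"
    using pq integrable_subinterval_real[OF i, of p b] 
    by (intro Henstock_Kurzweil_Integration.integral_combine[symmetric]) auto
  finally have "norm (integral {a..b} e) \<le> norm (integral {a..p} e) + (norm (integral {p..q} e) + norm (integral {q..b} e))"
    by (auto intro: order_trans[OF norm_triangle_ineq] add_left_mono norm_triangle_ineq)
  also have "\<dots> \<le> 4 / m + (4 / m + 4 / m)" 
  proof (intro add_mono left right)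
    show "norm (integral {p..q} e) \<le> 4 / m" using mid \<open>q - p \<le> 4 / m\<close> by simp
  qed
  finally show ?thesis by (simp add: e_def m_def)
qed

section \<open>Derivatives of the Riemann-Siegel theta function\<close>

definition theta1 :: "real \<Rightarrow> real" where
  "theta1 t = Re (Digamma (Complex (1/4) (t/2))) / 2 - ln pi / 2"

definition theta2 :: "real \<Rightarrow> real" where
  "theta2 t = - Im (Polygamma 1 (Complex (1/4) (t/2))) / 4"

lemma quarter_line_not_nonpos: "Complex (1/4) y \<notin> \<int>\<^sub>\<le>\<^sub>0" "Complex (1/4) y \<notin> \<real>\<^sub>\<le>\<^sub>0"
proof -
  have "z \<notin> \<int>\<^sub>\<le>\<^sub>0" if "Re z > 0" for z using that by (auto simp: nonpos_Ints_def)
  thus "Complex (1/4) y \<notin> \<int>\<^sub>\<le>\<^sub>0" by simp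
  show "Complex (1/4) y \<notin> \<real>\<^sub>\<le>\<^sub>0" by (simp add: complex_nonpos_Reals_iff)
qed

lemma quarter_line_deriv:
  "((\<lambda>t. Complex (1/4) (t/2)) has_vector_derivative (\<i> / 2)) (at t)"
proof -
  have e: "(\<lambda>t. Complex (1/4) (t/2)) = (\<lambda>t. of_real (1/4) + of_real t * (\<i> / 2))"
    by (auto simp: complex_eq_iff)
  show ?thesis unfolding e by (auto intro!: derivative_eq_intros)
qed

lemma deriv_rs_theta: "(rs_theta has_real_derivative theta1 t) (at t)"
proof -
  have "((ln_Gamma \<circ> (\<lambda>t. Complex (1/4) (t/2))) has_vector_derivative (\<i> / 2 * Digamma (Complex (1/4) (t/2)))) (at t)"
    by (rule field_vector_diff_chain_at[OF quarter_line_deriv has_field_derivative_ln_Gamma_complex])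
       (rule quarter_line_not_nonpos)
  hence "((\<lambda>t. Im (ln_Gamma (Complex (1/4) (t/2)))) has_vector_derivative Im (\<i> / 2 * Digamma (Complex (1/4) (t/2)))) (at t)"
    unfolding o_def by (rule bounded_linear.has_vector_derivative[OF bounded_linear_Im])
  hence 1: "((\<lambda>t. Im (ln_Gamma (Complex (1/4) (t/2)))) has_real_derivative Re (Digamma (Complex (1/4) (t/2))) / 2) (at t)"
    by (simp add: has_real_derivative_iff_has_vector_derivative)
  have "((\<lambda>t. Im (ln_Gamma (Complex (1/4) (t/2))) - t / 2 * ln pi) has_real_derivative theta1 t) (at t)"
    unfolding theta1_def by (rule DERIV_diff[OF 1]) (auto intro!: derivative_eq_intros)
  thus ?thesis by (simp add: rs_theta_def[abs_def])
qed

lemma deriv_theta1: "(theta1 has_real_derivative theta2 t) (at t)"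
proof -
  have d: "(Digamma has_field_derivative Polygamma (Suc 0) (Complex (1/4) (t/2))) (at (Complex (1/4) (t/2)))"
    by (rule has_field_derivative_Polygamma[OF quarter_line_not_nonpos(1)])
  have "((Digamma \<circ> (\<lambda>t. Complex (1/4) (t/2))) has_vector_derivative (\<i> / 2 * Polygamma (Suc 0) (Complex (1/4) (t/2)))) (at t)"
    by (rule field_vector_diff_chain_at[OF quarter_line_deriv d])
  hence "((\<lambda>t. Re (Digamma (Complex (1/4) (t/2)))) has_vector_derivative Re (\<i> / 2 * Polygamma (Suc 0) (Complex (1/4) (t/2)))) (at t)"
    unfolding o_def by (rule bounded_linear.has_vector_derivative[OF bounded_linear_Re])
  hence 1: "((\<lambda>t. Re (Digamma (Complex (1/4) (t/2)))) has_real_derivative (- Im (Polygamma 1 (Complex (1/4) (t/2))) / 2)) (at t)"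
    by (simp add: has_real_derivative_iff_has_vector_derivative)
  have "((\<lambda>t. Re (Digamma (Complex (1/4) (t/2))) / 2 - ln pi / 2) has_real_derivative (- Im (Polygamma 1 (Complex (1/4) (t/2))) / 2) / 2 - 0) (at t)"
    by (rule DERIV_diff[OF DERIV_cdivide[OF 1] DERIV_const])
  thus ?thesis unfolding theta1_def[abs_def] theta2_def by simp
qed

lemma continuous_theta2: "continuous_on A theta2"
proof -
  have "continuous_on {z. Re z > 0} (Polygamma 1 :: complex \<Rightarrow> complex)"
    by (intro continuous_on_Polygamma) (auto simp: nonpos_Ints_def)
  hence "continuous_on A (\<lambda>t. Polygamma 1 (Complex (1/4) (t/2)))"
    by (rule continuous_on_compose2) (auto intro!: continuous_on_Complex continuous_intros)
  thus ?thesis unfolding theta2_def[abs_def] by (intro continuous_intros) auto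
qed

text \<open>
  All terms of the series of the trigamma function contribute with the same sign, and about y/2 of them, those
  with index between y/2 and y for y = t/2, are of order 1/y^2.
\<close>
lemma theta2_lower:
  assumes t: "t \<ge> 16"
  shows "theta2 t \<ge> 1 / (64 * t)"
proof -
  define y where "y = t / 2"
  have y: "y \<ge> 8" using t by (simp add: y_def)
  define z where "z = Complex (1/4) y"
  have z0: "z \<noteq> 0" by (simp add: z_def complex_eq_iff)
  define g where "g = (\<lambda>k::nat. 2 * (real k + 1/4) * y / ((real k + 1/4)\<^sup>2 + y\<^sup>2)\<^sup>2)"
  have im: "- Im (inverse ((z + of_nat k)\<^sup>2)) = g k" for k
  proof -
    have zk: "z + of_nat k = Complex (real k + 1/4) y" by (simp add: z_def complex_eq_iff)
    have "(z + of_nat k)\<^sup>2 = Complex ((real k + 1/4)\<^sup>2 - y\<^sup>2) (2 * (real k + 1/4) * y)"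
      unfolding zk by (simp add: power2_eq_square complex_eq_iff)
    moreover have "((real k + 1/4)\<^sup>2 - y\<^sup>2)\<^sup>2 + (2 * (real k + 1/4) * y)\<^sup>2 = ((real k + 1/4)\<^sup>2 + y\<^sup>2)\<^sup>2"
      by (simp add: power2_eq_square algebra_simps)
    ultimately show ?thesis by (simp add: g_def)
  qed
  have "summable (\<lambda>k. inverse ((z + of_nat k)^Suc 1))" using z0 by (intro Polygamma_converges') auto
  hence "(\<lambda>k. inverse ((z + of_nat k)\<^sup>2)) sums Polygamma 1 z"
    by (simp add: Polygamma_def summable_sums power2_eq_square)
  hence "(\<lambda>k. - Im (inverse ((z + of_nat k)\<^sup>2))) sums (- Im (Polygamma 1 z))" by (intro sums_minus sums_Im)
  hence gs: "g sums (4 * theta2 t)" unfolding im by (simp add: theta2_def z_def y_def)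
  have g0: "g k \<ge> 0" for k using y by (simp add: g_def)
  define K where "K = {nat \<lceil>y/2\<rceil>..<nat \<lfloor>y\<rfloor>}"
  have Kr: "y / 2 \<le> real k + 1/4 \<and> real k + 1/4 \<le> y" if "k \<in> K" for k
  proof -
    have "real k \<ge> y / 2" using that by (auto simp: K_def)
    moreover have "k + 1 \<le> nat \<lfloor>y\<rfloor>" using that by (auto simp: K_def)
    hence "real k + 1 \<le> y" using y by (simp add: le_nat_iff le_floor_iff)
    ultimately show ?thesis by simp
  qed
  have gK: "g k \<ge> 1 / (4 * y\<^sup>2)" if "k \<in> K" for k
  proof -
    define a where "a = real k + 1/4"
    have a: "y / 2 \<le> a" "a \<le> y" using Kr[OF that] by (auto simp: a_def)
    have a2: "a\<^sup>2 \<le> y\<^sup>2" using a y by (intro power_mono) auto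
    have "(a\<^sup>2 + y\<^sup>2)\<^sup>2 \<le> (2 * y\<^sup>2)\<^sup>2" using a2 by (intro power_mono) auto
    moreover have pos: "(a\<^sup>2 + y\<^sup>2)\<^sup>2 > 0" using y by (auto intro!: zero_less_power add_nonneg_pos)
    moreover have "2 * a * y \<ge> y * y" using a y by (intro mult_right_mono) auto
    ultimately have "y * y / (2 * y\<^sup>2)\<^sup>2 \<le> 2 * a * y / (a\<^sup>2 + y\<^sup>2)\<^sup>2"
      using y by (intro frac_le) auto
    also have "y * y / (2 * y\<^sup>2)\<^sup>2 = 1 / (4 * y\<^sup>2)" using y by (simp add: power2_eq_square)
    finally show ?thesis by (simp add: g_def a_def)
  qed
  have cK: "real (card K) \<ge> y / 2 - 2"
  proof -
    have "real (nat \<lfloor>y\<rfloor>) \<ge> y - 1" "real (nat \<lceil>y/2\<rceil>) \<le> y / 2 + 1" using y by linarith+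
    thus ?thesis by (simp add: K_def)
  qed
  have "real (card K) * (1 / (4 * y\<^sup>2)) = (\<Sum>k\<in>K. 1 / (4 * y\<^sup>2))" by simp
  also have "\<dots> \<le> (\<Sum>k\<in>K. g k)" by (intro sum_mono gK)
  also have "\<dots> \<le> 4 * theta2 t"
    using sum_le_suminf[OF sums_summable[OF gs], of K] g0 gs by (auto simp: sums_iff K_def)
  finally have main: "real (card K) * (1 / (4 * y\<^sup>2)) \<le> 4 * theta2 t" .
  have "real (card K) \<ge> y / 8"
    using cK y by linarith
  hence "y / 8 * (1 / (4 * y\<^sup>2)) \<le> 4 * theta2 t"
    using main y by (smt (verit) mult_right_mono zero_le_divide_1_iff zero_le_power2 zero_le_mult_iff)
  moreover have "y / 8 * (1 / (4 * y\<^sup>2)) = 1 / (16 * t)" using t by (simp add: power2_eq_square y_def)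
  ultimately have "1 / (16 * t) \<le> 4 * theta2 t" by linarith
  moreover have "1 / (64 * t) = 1 / (16 * t) / 4" by simp
  ultimately show ?thesis by linarith
qed

text \<open>
  Terms with index below y = t/2 are bounded by those of the harmonic series, and the later ones decay like y/k^2.
  The additive constant is far from optimal; only the growth ln t / 2 matters.
\<close>
lemma theta1_upper:
  assumes t: "t \<ge> 8"
  shows "theta1 t \<le> ln t / 2 + 3 / 2"
proof -
  define y where "y = t / 2"
  have y: "y \<ge> 4" using t by (simp add: y_def)
  define z where "z = Complex (1/4) y"
  have z0: "z \<noteq> 0" by (simp add: z_def complex_eq_iff)
  define a where "a = (\<lambda>k::nat. real k + 1/4)"
  define f where "f = (\<lambda>k::nat. 1 / real (Suc k) - a k / ((a k)\<^sup>2 + y\<^sup>2))"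
  have "(\<lambda>k. inverse (of_nat (Suc k)) - inverse (z + of_nat k)) sums (Digamma z + euler_mascheroni)"
    unfolding Digamma_def using summable_Digamma[OF z0] by (simp add: summable_sums)
  hence "(\<lambda>k. Re (inverse (of_nat (Suc k)) - inverse (z + of_nat k))) sums Re (Digamma z + euler_mascheroni)"
    by (rule sums_Re)
  also have "(\<lambda>k. Re (inverse (of_nat (Suc k)) - inverse (z + of_nat k))) = f"
  proof
    fix k
    have "z + of_nat k = Complex (a k) y" by (simp add: z_def a_def complex_eq_iff)
    moreover have "inverse (complex_of_nat (Suc k)) = of_real (1 / real (Suc k))" by (simp add: inverse_eq_divide)
    ultimately show "Re (inverse (of_nat (Suc k)) - inverse (z + of_nat k)) = f k"
      by (simp add: f_def del: of_nat_Suc)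
  qed
  finally have "f sums (Re (Digamma z) + Re euler_mascheroni)" by simp
  moreover have "Re (euler_mascheroni :: complex) = euler_mascheroni"
    by (metis Re_complex_of_real of_real_euler_mascheroni)
  ultimately have fs: "f sums (Re (Digamma z) + euler_mascheroni)" by simp
  define K where "K = nat \<lceil>y\<rceil>"
  have K: "real K \<ge> y" "real K \<le> y + 1" "K \<ge> 1" using y by (auto simp: K_def) linarith+
  have f1: "f k \<le> 1 / real (Suc k)" for k
    unfolding f_def a_def by (simp add: divide_nonneg_nonneg)
  have f2: "f k \<le> y\<^sup>2 / real K * real k powr (-2)" if "k \<ge> K" for k
  proof -
    have k: "real k \<ge> real K" "real k > 0" using that K by auto
    have ak: "a k > 0" "a k \<ge> real k" "a k \<le> real (Suc k)" by (auto simp: a_def)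
    have pos: "(a k)\<^sup>2 + y\<^sup>2 > 0" using ak by (intro add_pos_nonneg) auto
    have "f k \<le> 1 / a k - a k / ((a k)\<^sup>2 + y\<^sup>2)"
      unfolding f_def using ak by (intro diff_right_mono divide_left_mono) auto
    also have "\<dots> = y\<^sup>2 / (a k * ((a k)\<^sup>2 + y\<^sup>2))"
      using ak pos by (simp add: field_simps power2_eq_square)
    also have "\<dots> \<le> y\<^sup>2 / (real K * (real k)\<^sup>2)"
    proof (intro frac_le mult_mono)
      show "(real k)\<^sup>2 \<le> (a k)\<^sup>2 + y\<^sup>2" using ak k power_mono[of "real k" "a k" 2] by (smt (verit) zero_le_power2)
      show "real K \<le> a k" using ak k by linarith
      show "0 < real K * (real k)\<^sup>2" using k K by (intro mult_pos_pos) auto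
    qed (use ak k in auto)
    also have "\<dots> = y\<^sup>2 / real K * real k powr (-2)" using k by (simp add: powr_minus powr_numeral field_simps)
    finally show ?thesis .
  qed
  have tail: "(\<Sum>k. f (k + K)) \<le> y\<^sup>2 / real K * (2 / real K)"
  proof -
    have s: "summable (\<lambda>k. y\<^sup>2 / real K * real (k + K) powr (-2))"
      by (intro summable_mult suminf_inverse_squares_tail K)
    have "(\<Sum>k. f (k + K)) \<le> (\<Sum>k. y\<^sup>2 / real K * real (k + K) powr (-2))"
      by (rule suminf_le[OF f2 summable_ignore_initial_segment[OF sums_summable[OF fs]] s]) simp
    also have "\<dots> = y\<^sup>2 / real K * (\<Sum>k. real (k + K) powr (-2))"
      by (intro suminf_mult suminf_inverse_squares_tail K)
    also have "\<dots> \<le> y\<^sup>2 / real K * (2 / real K)"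
      by (intro mult_left_mono suminf_inverse_squares_tail K) auto
    finally show ?thesis .
  qed
  also have "y\<^sup>2 / real K * (2 / real K) \<le> 2"
  proof -
    have "y\<^sup>2 \<le> (real K)\<^sup>2" using K y by (intro power_mono) auto
    thus ?thesis using K by (simp add: field_simps power2_eq_square)
  qed
  finally have tail2: "(\<Sum>k. f (k + K)) \<le> 2" .
  have "(\<Sum>k<K. f k) \<le> (\<Sum>k<K. 1 / real (Suc k))" by (intro sum_mono f1)
  also have "\<dots> = harm K" by (simp add: harm_def inverse_eq_divide sum.atLeast1_atMost_eq)
  also have "\<dots> \<le> ln (real K) + 1"
    using euler_mascheroni_sequence_decreasing[of 1 K] K by (simp add: harm_def)
  finally have head: "(\<Sum>k<K. f k) \<le> ln (real K) + 1" .
  have "Re (Digamma z) + euler_mascheroni = (\<Sum>k. f (k + K)) + (\<Sum>k<K. f k)"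
    using suminf_split_initial_segment[OF sums_summable[OF fs], of K] fs by (simp add: sums_iff)
  also have "\<dots> \<le> 2 + (ln (real K) + 1)" using head tail2 by linarith
  finally have "Re (Digamma z) \<le> ln (real K) + 3" using euler_mascheroni_pos by linarith
  moreover have "ln (real K) \<le> ln t" using K t by (subst ln_le_cancel_iff) (auto simp: y_def)
  moreover have "ln pi \<ge> 0" using pi_gt3 by (intro ln_ge_zero) auto
  ultimately show ?thesis unfolding theta1_def z_def y_def by linarith
qed

section \<open>Zeros of the Hardy function in short intervals\<close>

definition zeta_partial_sum :: "nat \<Rightarrow> real \<Rightarrow> complex" where
  "zeta_partial_sum N t = (\<Sum>n=1..N. of_real (real n powr (-1/2)) * exp (\<i> * of_real (t * (- ln (real n)))))"

text \<open>
  The exponent 3/2 is a compromise: sums of length T^(3/2) approximate \<zeta> on the critical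
  line up to o(1), because the error of order T^2 N^(-3/2) is small, while the sum of
  n powr (-1/2) over n \<le> N is still only of order T^(3/4).
\<close>
definition cutoff :: "real \<Rightarrow> nat" where "cutoff T = nat \<lceil>T powr (3/2)\<rceil>"

lemma cutoff_bounds:
  assumes "T \<ge> 1"
  shows "real (cutoff T) \<ge> T powr (3/2)" "cutoff T \<ge> 1" "sqrt (real (cutoff T)) \<le> 2 * T powr (3/4)"
proof -
  show 1: "real (cutoff T) \<ge> T powr (3/2)" unfolding cutoff_def by (rule real_nat_ceiling_ge)
  have p1: "T powr (3/2) \<ge> 1" using assms by (simp add: ge_one_powr_ge_zero)
  hence "real (cutoff T) \<ge> 1" using 1 by linarith
  thus "cutoff T \<ge> 1" by simp
  have "real (cutoff T) = of_int \<lceil>T powr (3/2)\<rceil>" using p1 by (simp add: cutoff_def)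
  hence "real (cutoff T) \<le> T powr (3/2) + 1" by linarith
  also have "\<dots> \<le> 4 * T powr (3/2)" using p1 by linarith
  also have "\<dots> = (2 * T powr (3/4))\<^sup>2"
    using assms by (simp add: power2_eq_square powr_add[symmetric])
  finally show "sqrt (real (cutoff T)) \<le> 2 * T powr (3/4)" by (intro real_le_lsqrt) auto
qed

lemma zeta_partial_sum_term:
  assumes "n \<ge> 1"
  shows "of_nat n powr (- Complex (1/2) t) = of_real (real n powr (-1/2)) * exp (\<i> * of_real (t * (- ln (real n))))"
proof -
  have "- Complex (1/2) t * of_real (ln (real n)) = of_real (-1/2 * ln (real n)) + \<i> * of_real (t * (- ln (real n)))"
    by (simp add: complex_eq_iff)
  note h = this
  have "of_nat n powr (- Complex (1/2) t) = exp (- Complex (1/2) t * of_real (ln (real n)))"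
    unfolding powr_def using assms by (simp add: Ln_of_nat)
  also have "\<dots> = exp (of_real (-1/2 * ln (real n))) * exp (\<i> * of_real (t * (- ln (real n))))"
    by (simp only: h exp_add)
  also have "exp (complex_of_real (-1/2 * ln (real n))) = of_real (real n powr (-1/2))"
    using assms by (simp only: exp_of_real powr_def) simp
  finally show ?thesis .
qed

lemma sum_inverse_sqrt: "(\<Sum>n=1..N. real n powr (-1/2)) \<le> 2 * sqrt (real N)"
proof (induction N)
  case (Suc N)
  have s: "sqrt (real (Suc N)) > 0" by simp
  have e: "real (Suc N) powr (-1/2) = 1 / sqrt (real (Suc N))"
    by (simp add: powr_minus_divide powr_half_sqrt del: of_nat_Suc)
  have "1 / sqrt (real (Suc N)) \<le> 2 * sqrt (real (Suc N)) - 2 * sqrt (real N)"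
  proof -
    have "2 * (sqrt (real N) * sqrt (real (Suc N))) \<le> real N + real (Suc N)"
      using sum_squares_bound[of "sqrt (real N)" "sqrt (real (Suc N))"] by simp
    hence "1 \<le> (2 * sqrt (real (Suc N)) - 2 * sqrt (real N)) * sqrt (real (Suc N))"
      by (simp add: algebra_simps)
    thus ?thesis using s by (simp add: pos_divide_le_eq del: of_nat_Suc)
  qed
  thus ?case using Suc.IH e by simp
qed simp

lemma zeta_line_approx:
  "eventually (\<lambda>T. \<forall>t\<in>{T/4..4*T}. norm (zeta (Complex (1/2) t) - zeta_partial_sum (cutoff T) t) \<le> 1/10) at_top"
proof -
  define E where "E = (\<lambda>T::real. 2 * (4 * T + 1) * (4 * T + 2) * T powr (-9/4) + T powr (-3/4) + 8 * T powr (-1/4))"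
  have "(E \<longlongrightarrow> 0) at_top" unfolding E_def by real_asymp
  hence "eventually (\<lambda>T. E T < 1/10) at_top" by (rule order_tendstoD) simp
  thus ?thesis using eventually_ge_at_top[of 1]
  proof eventually_elim
    case (elim T)
    show ?case
    proof
      fix t assume t: "t \<in> {T/4..4*T}"
      define N where "N = cutoff T"
      note N = cutoff_bounds[OF elim(2), folded N_def]
      define s where "s = Complex (1/2) t"
      have T0: "T > 0" using elim by simp
      have s1: "s \<noteq> 1" by (auto simp: s_def complex_eq_iff)
      have nm: "norm (s - 1) > 0" using s1 by simp
      define S where "S = (\<Sum>k=1..N. of_nat k powr (- s))"
      have Sd: "S = zeta_partial_sum N t" unfolding S_def zeta_partial_sum_def s_def by (intro sum.cong refl zeta_partial_sum_term) auto
      define R where "R = S - of_nat N powr (-s) / 2 + of_nat N powr (1 - s) / (s - 1)"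
      have z: "zeta s = zeta_reg s / (s - 1)" by (intro zeta_eq_zeta_reg) (simp add: s_def)
      have "norm (zeta_reg s - ((s - 1) * (S - of_nat N powr (-s) / 2) + of_nat N powr (1 - s)))
         \<le> norm (s - 1) * norm s * norm (s + 1) * (2 * real N powr (- Re s - 1))"
        unfolding S_def by (rule zeta_reg_approx) (use N in \<open>auto simp: s_def\<close>)
      also have "zeta_reg s - ((s - 1) * (S - of_nat N powr (-s) / 2) + of_nat N powr (1 - s)) = (s - 1) * (zeta s - R)"
      proof -
        have zr: "zeta_reg s = (s - 1) * zeta s" using z s1 by simp
        have "(s - 1) * R = (s - 1) * (S - of_nat N powr (-s) / 2) + of_nat N powr (1 - s)"
          using s1 by (simp add: R_def distrib_left)
        thus ?thesis by (simp only: zr right_diff_distrib[of _ "zeta s"])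
      qed
      finally have "norm (s - 1) * norm (zeta s - R) \<le> norm (s - 1) * (norm s * norm (s + 1) * (2 * real N powr (- Re s - 1)))"
        by (simp add: norm_mult mult.assoc)
      hence A: "norm (zeta s - R) \<le> norm s * norm (s + 1) * (2 * real N powr (- Re s - 1))"
        using nm by (simp only: mult_le_cancel_left_pos)
      have ns: "norm s \<le> 4 * T + 1" "norm (s + 1) \<le> 4 * T + 2"
        using cmod_le[of s] cmod_le[of "s + 1"] t elim by (auto simp: s_def)
      have Np: "real N powr (-3/2) \<le> T powr (-9/4)"
      proof -
        have "real N powr (-3/2) \<le> (T powr (3/2)) powr (-3/2)" using N T0 by (intro powr_mono2') auto
        thus ?thesis by (simp add: powr_powr)
      qed
      have "norm s * norm (s + 1) * (2 * real N powr (- Re s - 1)) \<le> (4 * T + 1) * (4 * T + 2) * (2 * T powr (-9/4))"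
        using ns Np T0 by (intro mult_mono) (auto simp: s_def)
      from order_trans[OF A this]
      have A': "norm (zeta s - R) \<le> 2 * (4 * T + 1) * (4 * T + 2) * T powr (-9/4)" by (simp only: mult_ac)
      have B: "norm (of_nat N powr (-s) / 2) \<le> T powr (-3/4)"
      proof -
        have "norm (of_nat N powr (-s) / 2) = real N powr (-1/2) / 2"
          by (simp add: norm_divide norm_powr_real_powr s_def)
        also have "\<dots> \<le> real N powr (-1/2)" by simp
        also have "\<dots> \<le> (T powr (3/2)) powr (-1/2)" using N T0 by (intro powr_mono2') auto
        also have "\<dots> = T powr (-3/4)" by (simp add: powr_powr)
        finally show ?thesis .
      qed
      have C: "norm (of_nat N powr (1 - s) / (s - 1)) \<le> 8 * T powr (-1/4)"
      proof -
        have "norm (of_nat N powr (1 - s)) = sqrt (real N)"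
          by (simp add: norm_powr_real_powr s_def powr_half_sqrt)
        moreover have "norm (s - 1) \<ge> T / 4" using abs_Im_le_cmod[of "s - 1"] t by (auto simp: s_def)
        ultimately have "norm (of_nat N powr (1 - s) / (s - 1)) \<le> (2 * T powr (3/4)) / (T / 4)"
          unfolding norm_divide using N T0 by (intro frac_le) auto
        also have "\<dots> = 8 * T powr (-1/4)" using T0 powr_add[of T "-1/4" 1] by (simp add: field_simps)
        finally show ?thesis .
      qed
      have "zeta s - S = (zeta s - R) - of_nat N powr (-s) / 2 + of_nat N powr (1 - s) / (s - 1)" by (simp add: R_def)
      hence "norm (zeta s - S) \<le> norm (zeta s - R) + norm (of_nat N powr (-s) / 2) + norm (of_nat N powr (1 - s) / (s - 1))"
        by (simp only:) (rule norm_triangle_le, rule add_mono[OF norm_triangle_ineq4 order_refl])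
      also have "\<dots> \<le> E T" unfolding E_def using A' B C by linarith
      finally show "norm (zeta (Complex (1/2) t) - zeta_partial_sum (cutoff T) t) \<le> 1/10"
        using elim(1) unfolding Sd N_def s_def by linarith
    qed
  qed
qed

lemma linear_phase_integral:
  assumes "\<xi> \<noteq> 0" "a \<le> b"
  shows "norm (integral {a..b} (\<lambda>t. exp (\<i> * of_real (t * \<xi>)))) \<le> 2 / \<bar>\<xi>\<bar>"
proof -
  define E where "E = (\<lambda>t::real. exp (\<i> * of_real (t * \<xi>)) / (\<i> * of_real \<xi>))"
  have dE: "(E has_vector_derivative exp (\<i> * of_real (t * \<xi>))) (at t within {a..b})" for t
  proof -
    have "((\<lambda>z. exp (\<i> * (z * of_real \<xi>)) / (\<i> * of_real \<xi>)) has_field_derivative exp (\<i> * (of_real t * of_real \<xi>))) (at (of_real t))"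
      using assms by (auto intro!: derivative_eq_intros simp: mult_ac)
    from has_vector_derivative_real_field[OF this] show ?thesis unfolding E_def by simp
  qed
  have nE: "norm (E t) = 1 / \<bar>\<xi>\<bar>" for t by (simp add: E_def norm_divide norm_mult)
  have "integral {a..b} (\<lambda>t. exp (\<i> * of_real (t * \<xi>))) = E b - E a"
    by (rule integral_unique, rule fundamental_theorem_of_calculus[OF assms(2) dE])
  also have "norm \<dots> \<le> norm (E b) + norm (E a)" by (rule norm_triangle_ineq4)
  finally show ?thesis unfolding nE by simp
qed

lemma continuous_zeta_partial_sum: "continuous_on A (zeta_partial_sum N)"
  unfolding zeta_partial_sum_def[abs_def] by (intro continuous_intros)

text \<open>
  Only the term n = 1 does not oscillate.
\<close>
lemma integral_zeta_partial_sum_lower: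
  assumes "a \<le> b" "N \<ge> 1"
  shows "norm (integral {a..b} (zeta_partial_sum N) - of_real (b - a)) \<le> 8 * sqrt (real N)"
proof -
  define f where "f = (\<lambda>n t. of_real (real n powr (-1/2)) * exp (\<i> * of_real (t * (- ln (real n)))))"
  have fi: "f n integrable_on {a..b}" for n
    unfolding f_def by (intro integrable_continuous_real continuous_intros)
  have "zeta_partial_sum N = (\<lambda>t. \<Sum>n=1..N. f n t)" by (simp add: zeta_partial_sum_def f_def fun_eq_iff)
  hence "integral {a..b} (zeta_partial_sum N) = (\<Sum>n=1..N. integral {a..b} (f n))"
    by (simp only:) (intro integral_sum fi, auto)
  also have "\<dots> = integral {a..b} (f 1) + (\<Sum>n=2..N. integral {a..b} (f n))"
    using assms(2) by (subst sum.atLeast_Suc_atMost) (auto simp: numeral_2_eq_2)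
  also have "integral {a..b} (f 1) = of_real (b - a)" using assms by (simp add: f_def scaleR_conv_of_real)
  finally have "norm (integral {a..b} (zeta_partial_sum N) - of_real (b - a)) = norm (\<Sum>n=2..N. integral {a..b} (f n))" by simp
  also have "\<dots> \<le> (\<Sum>n=2..N. norm (integral {a..b} (f n)))" by (rule norm_sum)
  also have "\<dots> \<le> (\<Sum>n=2..N. real n powr (-1/2) * 4)"
  proof (rule sum_mono)
    fix n assume n: "n \<in> {2..N}"
    have "ln (real n) \<ge> ln 2" using n by simp
    hence l: "ln (real n) \<ge> 1/2" using ln2_ge_two_thirds by linarith
    have "norm (integral {a..b} (f n)) = real n powr (-1/2) * norm (integral {a..b} (\<lambda>t. exp (\<i> * of_real (t * (- ln (real n))))))"
      unfolding f_def by (simp add: norm_mult)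
    also have "\<dots> \<le> real n powr (-1/2) * (2 / \<bar>- ln (real n)\<bar>)"
      using l assms by (intro mult_left_mono linear_phase_integral) auto
    also have "2 / \<bar>- ln (real n)\<bar> \<le> 4" using l by (simp add: field_simps)
    hence "real n powr (-1/2) * (2 / \<bar>- ln (real n)\<bar>) \<le> real n powr (-1/2) * 4" by (intro mult_left_mono) auto
    finally show "norm (integral {a..b} (f n)) \<le> real n powr (-1/2) * 4" .
  qed
  also have "\<dots> \<le> (\<Sum>n=1..N. real n powr (-1/2) * 4)" by (intro sum_mono2) auto
  also have "\<dots> = 4 * (\<Sum>n=1..N. real n powr (-1/2))" by (simp add: sum_distrib_left mult.commute)
  also have "\<dots> \<le> 4 * (2 * sqrt (real N))" by (intro mult_left_mono sum_inverse_sqrt) auto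
  finally show ?thesis by simp
qed

text \<open>
  The phase of the n-th term is \<theta>(t) - t ln n, whose stationary point lies near t = 2 \<pi> n^2. For
  n \<le> 18 sqrt T the second derivative test gives O(sqrt T) per term; for larger n the phase
  has derivative at most -1, and the first derivative test gives O(1).
\<close>
lemma twisted_zeta_partial_sum_upper:
  assumes T: "T \<ge> 16" and ab: "T \<le> a" "a \<le> b" "b \<le> 2 * T"
  shows "norm (integral {a..b} (\<lambda>t. exp (\<i> * of_real (rs_theta t)) * zeta_partial_sum N t)) \<le> 1300 * T powr (3/4) + 8 * sqrt (real N)"
proof -
  define g where "g = (\<lambda>n t. exp (\<i> * of_real (rs_theta t - t * ln (real n))))"
  have cg: "continuous_on A (g n)" for A n unfolding g_def by (intro continuous_intros)
  have e: "exp (\<i> * of_real (rs_theta t)) * zeta_partial_sum N t = (\<Sum>n=1..N. of_real (real n powr (-1/2)) * g n t)" for t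
    unfolding zeta_partial_sum_def g_def sum_distrib_left
  proof (intro sum.cong refl)
    fix n
    have "exp (\<i> * of_real (rs_theta t)) * exp (\<i> * of_real (t * (- ln (real n)))) = exp (\<i> * of_real (rs_theta t - t * ln (real n)))"
      by (simp add: exp_add[symmetric] algebra_simps)
    thus "exp (\<i> * of_real (rs_theta t)) * (of_real (real n powr (-1/2)) * exp (\<i> * of_real (t * (- ln (real n))))) =
       of_real (real n powr (-1/2)) * exp (\<i> * of_real (rs_theta t - t * ln (real n)))" by (subst mult.left_commute) (simp only:)
  qed
  have T0: "T > 0" using T by simp
  have d1: "((\<lambda>t. rs_theta t - t * ln (real n)) has_real_derivative (theta1 t - ln (real n))) (at t)" for n t
    by (auto intro!: derivative_eq_intros deriv_rs_theta)
  have d2: "((\<lambda>t. theta1 t - ln (real n)) has_real_derivative theta2 t) (at t)" for n t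
    by (auto intro!: derivative_eq_intros deriv_theta1)
  have t2: "theta2 t \<ge> 1 / (128 * T)" if "t \<in> {a..b}" for t
  proof -
    have "1 / (128 * T) \<le> 1 / (64 * t)" using that ab T by (intro divide_left_mono) auto
    also have "\<dots> \<le> theta2 t" using that ab T by (intro theta2_lower) auto
    finally show ?thesis .
  qed
  have t20: "theta2 t \<ge> 0" if "t \<in> {a..b}" for t
  proof -
    have "1 / (128 * T) \<ge> 0" using T by simp
    thus ?thesis using t2[OF that] by linarith
  qed
  have small: "norm (integral {a..b} (g n)) \<le> 144 * sqrt T" for n
  proof -
    have "norm (integral {a..b} (g n)) \<le> 12 / sqrt (1 / (128 * T))"
      unfolding g_def by (rule second_derivative_test[OF ab(2) _ d1 d2 continuous_theta2 t2]) (use T in auto)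
    also have "12 / sqrt (1 / (128 * T)) = 12 * sqrt (128 * T)" by (simp add: real_sqrt_divide)
    also have "\<dots> \<le> 12 * sqrt (144 * T)" using T0 by (intro mult_left_mono real_sqrt_le_mono) auto
    also have "\<dots> = 144 * sqrt T" by (simp add: real_sqrt_mult)
    finally show ?thesis .
  qed
  have large: "norm (integral {a..b} (g n)) \<le> 4" if n: "real n > 18 * sqrt T" for n
  proof -
    (* The factor 18 compensates the additive constant in the bound for the derivative of theta. *)
    have ln18: "ln (18::real) \<ge> ln 2 / 2 + 5 / 2"
    proof -
      have "exp (5::real) = exp 1 ^ 5" by (simp add: exp_of_nat_mult[symmetric])
      also have "\<dots> \<le> (272/100) ^ 5" using e_less_272 by (intro power_mono) auto
      also have "\<dots> \<le> 162" by (simp add: power_divide)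
      finally have "5 \<le> ln (162::real)" by (subst ln_ge_iff) auto
      moreover have "ln (162::real) + ln 2 = ln (162 * 2)" by (subst ln_mult) auto
      moreover have "ln (18::real) + ln 18 = ln (18 * 18)" by (subst ln_mult) auto
      ultimately show ?thesis by simp
    qed
    have p: "18 * sqrt T > 0" using T0 by simp
    hence "real n > 0" using n by linarith
    from ln_le_cancel_iff[OF p this] n have "ln (18 * sqrt T) \<le> ln (real n)" by simp
    also have "ln (18 * sqrt T) = ln 18 + ln T / 2" using T0 by (simp add: ln_mult ln_sqrt)
    finally have lnn: "ln (real n) \<ge> ln 18 + ln T / 2" .
    have th: "theta1 t - ln (real n) \<le> -1" if "t \<in> {a..b}" for t
    proof -
      have "theta1 t \<le> ln t / 2 + 3/2" using that ab T by (intro theta1_upper) auto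
      moreover have "ln t \<le> ln (2 * T)" using that ab T by (subst ln_le_cancel_iff) auto
      moreover have "ln (2 * T) = ln 2 + ln T" using T0 by (simp add: ln_mult)
      ultimately show ?thesis using lnn ln18 by linarith
    qed
    have bd: "\<bar>theta1 t - ln (real n)\<bar> \<ge> 1" if "t \<in> {a..b}" for t using th[OF that] by linarith
    from first_derivative_test[OF ab(2) zero_less_one has_field_derivative_at_within[OF d1[of n]]
        has_field_derivative_at_within[OF d2[of n]] continuous_theta2 t20 bd]
    show ?thesis by (simp add: g_def)
  qed
  define M where "M = nat \<lfloor>18 * sqrt T\<rfloor>"
  have gi: "(\<lambda>t. of_real (real n powr (-1/2)) * g n t) integrable_on {a..b}" for n
    by (intro integrable_continuous_real continuous_intros cg)
  have "integral {a..b} (\<lambda>t. exp (\<i> * of_real (rs_theta t)) * zeta_partial_sum N t) = (\<Sum>n=1..N. integral {a..b} (\<lambda>t. of_real (real n powr (-1/2)) * g n t))"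
    unfolding e by (intro integral_sum gi) auto
  also have "norm \<dots> \<le> (\<Sum>n=1..N. norm (integral {a..b} (\<lambda>t. of_real (real n powr (-1/2)) * g n t)))" by (rule norm_sum)
  also have "\<dots> = (\<Sum>n=1..N. real n powr (-1/2) * norm (integral {a..b} (g n)))"
    by (simp add: norm_mult)
  also have "\<dots> \<le> (\<Sum>n=1..N. (if n \<le> M then real n powr (-1/2) * (144 * sqrt T) else 0) + real n powr (-1/2) * 4)"
  proof (rule sum_mono)
    fix n assume n: "n \<in> {1..N}"
    show "real n powr (-1/2) * norm (integral {a..b} (g n)) \<le> (if n \<le> M then real n powr (-1/2) * (144 * sqrt T) else 0) + real n powr (-1/2) * 4"
    proof (cases "n \<le> M")
      case True
      have "real n powr (-1/2) * norm (integral {a..b} (g n)) \<le> real n powr (-1/2) * (144 * sqrt T)"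
        by (intro mult_left_mono small) auto
      thus ?thesis using True by (simp add: add_increasing2)
    next
      case False
      hence "real n > 18 * sqrt T" by (simp add: M_def nat_le_iff not_le) linarith
      hence "real n powr (-1/2) * norm (integral {a..b} (g n)) \<le> real n powr (-1/2) * 4"
        by (intro mult_left_mono large) auto
      thus ?thesis using False by simp
    qed
  qed
  also have "\<dots> = (\<Sum>n=1..N. if n \<le> M then real n powr (-1/2) * (144 * sqrt T) else 0) + (\<Sum>n=1..N. real n powr (-1/2)) * 4"
    by (simp add: sum.distrib sum_distrib_right)
  also have "(\<Sum>n=1..N. if n \<le> M then real n powr (-1/2) * (144 * sqrt T) else 0) \<le> (\<Sum>n=1..M. real n powr (-1/2) * (144 * sqrt T))"
  proof -
    have "(\<Sum>n=1..N. if n \<le> M then real n powr (-1/2) * (144 * sqrt T) else 0) = (\<Sum>n\<in>{n\<in>{1..N}. n \<le> M}. real n powr (-1/2) * (144 * sqrt T))"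
      by (subst sum.inter_filter) auto
    also have "\<dots> \<le> (\<Sum>n=1..M. real n powr (-1/2) * (144 * sqrt T))"
      using T0 by (intro sum_mono2) auto
    finally show ?thesis .
  qed
  also have "(\<Sum>n=1..M. real n powr (-1/2) * (144 * sqrt T)) = (\<Sum>n=1..M. real n powr (-1/2)) * (144 * sqrt T)"
    by (simp add: sum_distrib_right)
  also have "\<dots> \<le> (2 * sqrt (real M)) * (144 * sqrt T)" using T0 by (intro mult_right_mono sum_inverse_sqrt) auto
  also have "\<dots> \<le> (2 * (4.5 * T powr (1/4))) * (144 * sqrt T)"
  proof -
    have "real M \<le> 18 * sqrt T" using T0 by (simp add: M_def)
    also have "\<dots> \<le> (4.5 * T powr (1/4))\<^sup>2"
      using T0 by (simp add: power2_eq_square powr_add[symmetric] powr_half_sqrt)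
    finally have "sqrt (real M) \<le> 4.5 * T powr (1/4)" by (intro real_le_lsqrt) auto
    thus ?thesis using T0 by (intro mult_right_mono mult_left_mono) auto
  qed
  also have "(2 * (4.5 * T powr (1/4))) * (144 * sqrt T) = 1296 * T powr (3/4)"
    using T0 powr_add[of T "1/4" "1/2"] by (simp add: powr_half_sqrt)
  also have "(\<Sum>n=1..N. real n powr (-1/2)) * 4 \<le> (2 * sqrt (real N)) * 4" by (intro mult_right_mono sum_inverse_sqrt) auto
  finally have "norm (integral {a..b} (\<lambda>t. exp (\<i> * of_real (rs_theta t)) * zeta_partial_sum N t)) \<le> 1296 * T powr (3/4) + 2 * sqrt (real N) * 4" by simp
  also have "\<dots> \<le> 1300 * T powr (3/4) + 8 * sqrt (real N)" by simp
  finally show ?thesis .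
qed

text \<open>
  If Z kept its sign on the interval, the absolute value of its integral would equal the integral of |Z|. The
  latter is at least the absolute value of the integral of \<zeta>, about the length of the
  interval; the former is O(T^(3/4)) plus a tenth of the length.
\<close>
lemma hardy_Z_has_zero:
  "eventually (\<lambda>T. \<forall>a b. T \<le> a \<and> b \<le> 2 * T \<and> b - a \<ge> 2000 * T powr (3/4) \<longrightarrow> (\<exists>t\<in>{a<..<b}. hardy_Z t = 0)) at_top"
  using zeta_line_approx eventually_ge_at_top[of 16]
proof eventually_elim
  case (elim T)
  show ?case
  proof (intro allI impI)
    fix a b assume ab: "T \<le> a \<and> b \<le> 2 * T \<and> b - a \<ge> 2000 * T powr (3/4)"
    define X where "X = T powr (3/4)"
    have X: "X > 0" using elim by (simp add: X_def)
    have "b - a \<ge> 2000 * X" using ab by (simp add: X_def)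
    hence lt: "a < b" using X by linarith
    define N where "N = cutoff T"
    note N = cutoff_bounds[of T, folded N_def X_def]
    have sN: "sqrt (real N) \<le> 2 * X" "N \<ge> 1" using N elim by auto
    define z where "z = (\<lambda>t. zeta (Complex (1/2) t))"
    have cz: "continuous_on A z" for A unfolding z_def by (intro continuous_intros)
    have ap: "norm (z t - zeta_partial_sum N t) \<le> 1/10" if "t \<in> {a..b}" for t
      using elim(1) that ab elim(2) unfolding z_def N_def by auto
    have err: "norm (integral {a..b} (\<lambda>t. z t - zeta_partial_sum N t)) \<le> 1/10 * (b - a)"
      by (rule integral_bound) (use lt ap in \<open>auto intro!: continuous_intros cz continuous_zeta_partial_sum\<close>)
    have iz: "z integrable_on {a..b}" and iS: "zeta_partial_sum N integrable_on {a..b}"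
      by (intro integrable_continuous_real cz continuous_zeta_partial_sum)+
    have "integral {a..b} (\<lambda>t. z t - zeta_partial_sum N t) = integral {a..b} z - integral {a..b} (zeta_partial_sum N)"
      by (rule integral_diff[OF iz iS])
    hence e1: "norm (integral {a..b} z - integral {a..b} (zeta_partial_sum N)) \<le> 1/10 * (b - a)" using err by simp
    have "norm (integral {a..b} (zeta_partial_sum N) - of_real (b - a)) \<le> 8 * sqrt (real N)"
      using lt sN by (intro integral_zeta_partial_sum_lower) auto
    hence e2: "norm (integral {a..b} (zeta_partial_sum N) - of_real (b - a)) \<le> 16 * X" using sN by linarith
    have "norm (complex_of_real (b - a)) \<le> norm (integral {a..b} z) + norm (integral {a..b} z - integral {a..b} (zeta_partial_sum N)) + norm (integral {a..b} (zeta_partial_sum N) - of_real (b - a))"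
      by norm
    note tri = this
    have low: "norm (integral {a..b} z) \<ge> 9/10 * (b - a) - 16 * X"
    proof -
      have "norm (complex_of_real (b - a)) = b - a" using lt by (simp del: of_real_diff)
      note tri' = tri[unfolded this]
      have "p \<ge> 9/10 * x - 16 * X" if "x \<le> p + q + r" "q \<le> 1/10 * x" "r \<le> 16 * X" for p q r x :: real
        using that by linarith
      from this[OF tri' e1 e2] show ?thesis .
    qed
    have "norm (integral {a..b} z) \<le> integral {a..b} (\<lambda>t. norm (z t))"
      by (rule continuous_on_imp_absolutely_integrable_on[OF cz])
    also have "(\<lambda>t. norm (z t)) = (\<lambda>t. \<bar>hardy_Z t\<bar>)" by (simp add: abs_hardy_Z z_def)
    finally have low2: "integral {a..b} (\<lambda>t. \<bar>hardy_Z t\<bar>) \<ge> 9/10 * (b - a) - 16 * X" using low by linarith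
    define w where "w = (\<lambda>t. exp (\<i> * of_real (rs_theta t)))"
    have cw: "continuous_on A w" for A unfolding w_def by (intro continuous_intros)
    have iZ: "hardy_Z integrable_on {a..b}" by (intro integrable_continuous_real continuous_on_hardy_Z)
    have "(\<lambda>t. complex_of_real (hardy_Z t)) = (\<lambda>t. w t * (z t - zeta_partial_sum N t) + w t * zeta_partial_sum N t)"
      by (auto simp: hardy_Z_complex w_def z_def algebra_simps)
    hence "integral {a..b} (\<lambda>t. complex_of_real (hardy_Z t)) = integral {a..b} (\<lambda>t. w t * (z t - zeta_partial_sum N t)) + integral {a..b} (\<lambda>t. w t * zeta_partial_sum N t)"
      by (simp only:) (intro integral_add integrable_continuous_real continuous_intros cz cw continuous_zeta_partial_sum)
    moreover have "integral {a..b} (\<lambda>t. complex_of_real (hardy_Z t)) = of_real (integral {a..b} hardy_Z)"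
      using integral_linear[OF iZ bounded_linear_of_real] by (simp add: o_def)
    ultimately have "complex_of_real (integral {a..b} hardy_Z) = integral {a..b} (\<lambda>t. w t * (z t - zeta_partial_sum N t)) + integral {a..b} (\<lambda>t. w t * zeta_partial_sum N t)"
      by (simp only:)
    from arg_cong[OF this, of norm]
    have "\<bar>integral {a..b} hardy_Z\<bar> = norm (integral {a..b} (\<lambda>t. w t * (z t - zeta_partial_sum N t)) + integral {a..b} (\<lambda>t. w t * zeta_partial_sum N t))"
      by (simp only: norm_of_real)
    also have "\<dots> \<le> norm (integral {a..b} (\<lambda>t. w t * (z t - zeta_partial_sum N t))) + norm (integral {a..b} (\<lambda>t. w t * zeta_partial_sum N t))"
      by (rule norm_triangle_ineq)
    also have "norm (integral {a..b} (\<lambda>t. w t * (z t - zeta_partial_sum N t))) \<le> 1/10 * (b - a)"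
    proof (rule integral_bound)
      show "continuous_on {a..b} (\<lambda>t. w t * (z t - zeta_partial_sum N t))" by (intro continuous_intros cz cw continuous_zeta_partial_sum)
      show "norm (w t * (z t - zeta_partial_sum N t)) \<le> 1/10" if "t \<in> {a..b}" for t using ap[OF that] by (simp add: norm_mult w_def)
    qed (use lt in auto)
    also have "norm (integral {a..b} (\<lambda>t. w t * zeta_partial_sum N t)) \<le> 1300 * X + 8 * sqrt (real N)"
      unfolding w_def X_def using ab lt elim by (intro twisted_zeta_partial_sum_upper) auto
    finally have up: "\<bar>integral {a..b} hardy_Z\<bar> \<le> 1/10 * (b - a) + 1316 * X" using sN by linarith
    show "\<exists>t\<in>{a<..<b}. hardy_Z t = 0"
    proof (rule ccontr)
      assume "\<not> (\<exists>t\<in>{a<..<b}. hardy_Z t = 0)"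
      hence nz: "hardy_Z t \<noteq> 0" if "a < t" "t < b" for t using that by auto
      have "(\<forall>t\<in>{a..b}. hardy_Z t \<ge> 0) \<or> (\<forall>t\<in>{a..b}. hardy_Z t \<le> 0)"
      proof (rule ccontr)
        assume "\<not> ?thesis"
        then obtain t s where ts: "t \<in> {a..b}" "hardy_Z t < 0" "s \<in> {a..b}" "hardy_Z s > 0" by (auto simp: not_le)
        have "\<exists>r. min s t \<le> r \<and> r \<le> max s t \<and> hardy_Z r = 0"
        proof (cases "t \<le> s")
          case True
          thus ?thesis using IVT'[of hardy_Z t 0 s] ts continuous_on_hardy_Z by (auto simp: less_imp_le)
        next
          case False
          thus ?thesis using IVT2'[of hardy_Z t 0 s] ts continuous_on_hardy_Z by (auto simp: less_imp_le)
        qed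
        then obtain r where r: "min s t \<le> r" "r \<le> max s t" "hardy_Z r = 0" by blast
        have "r \<noteq> s" "r \<noteq> t" using r ts by auto
        hence "a < r" "r < b" using r(1,2) ts by (auto simp: min_def max_def split: if_splits)
        thus False using nz r by blast
      qed
      hence "integral {a..b} (\<lambda>t. \<bar>hardy_Z t\<bar>) = \<bar>integral {a..b} hardy_Z\<bar>"
      proof
        assume p: "\<forall>t\<in>{a..b}. hardy_Z t \<ge> 0"
        have "integral {a..b} (\<lambda>t. \<bar>hardy_Z t\<bar>) = integral {a..b} hardy_Z" using p by (intro integral_cong) auto
        moreover have "integral {a..b} hardy_Z \<ge> 0" using p by (intro integral_nonneg iZ) auto
        ultimately show ?thesis by simp
      next
        assume p: "\<forall>t\<in>{a..b}. hardy_Z t \<le> 0"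
        have "integral {a..b} (\<lambda>t. \<bar>hardy_Z t\<bar>) = integral {a..b} (\<lambda>t. - hardy_Z t)" using p by (intro integral_cong) auto
        also have "\<dots> = - integral {a..b} hardy_Z" by simp
        finally have "integral {a..b} (\<lambda>t. \<bar>hardy_Z t\<bar>) = - integral {a..b} hardy_Z" .
        moreover have "integral {a..b} (\<lambda>t. \<bar>hardy_Z t\<bar>) \<ge> 0"
          by (intro integral_nonneg integrable_continuous_real continuous_intros continuous_on_hardy_Z) auto
        ultimately show ?thesis by simp
      qed
      hence "9/10 * (b - a) - 16 * X \<le> 1/10 * (b - a) + 1316 * X" using low2 up by linarith
      moreover have "b - a \<ge> 2000 * X" using ab by (simp add: X_def)
      moreover have False if "9/10 * x - 16 * X \<le> 1/10 * x + 1316 * X" "x \<ge> 2000 * X" for x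
        using that X by linarith
      ultimately show False by blast
    qed
  qed
qed

section \<open>Mean squares over short windows\<close>

definition window_mean :: "real \<Rightarrow> (real \<Rightarrow> complex) \<Rightarrow> real \<Rightarrow> complex" where
  "window_mean h f t = integral {0..h} (\<lambda>x. f (t + x)) / of_real h"

lemma window_mean_alt:
  assumes "continuous_on UNIV f"
  shows "window_mean h f t = integral {t..t+h} f / of_real h"
proof -
  have "continuous_on {0 + t..h + t} f" using assms by (rule continuous_on_subset) auto
  from integral_shift[OF this] show ?thesis by (simp add: window_mean_def o_def add.commute)
qed

lemma continuous_window_mean:
  assumes "continuous_on UNIV f"
  shows "continuous_on UNIV (window_mean h f)"
proof -
  have "continuous_on (UNIV \<times> cbox 0 h) (\<lambda>(t, x). f (t + x))"
    unfolding case_prod_beta by (rule continuous_on_compose2[OF assms]) (auto intro!: continuous_intros)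
  from integral_continuous_on_param[OF this]
  have "continuous_on UNIV (\<lambda>t. integral {0..h} (\<lambda>x. f (t + x)))" by simp
  thus ?thesis unfolding window_mean_def[abs_def] divide_inverse by (intro continuous_intros)
qed

lemma continuous_window_mean_iter:
  "continuous_on UNIV f \<Longrightarrow> continuous_on UNIV ((window_mean h ^^ j) f)"
  by (induction j) (auto intro: continuous_window_mean)

lemma window_mean_iter_bound:
  assumes "continuous_on UNIV f" and h: "h > 0" and "\<And>s. s \<in> {t..t + real j * h} \<Longrightarrow> norm (f s) \<le> B"
  shows "norm ((window_mean h ^^ j) f t) \<le> B"
  using assms(3)
proof (induction j arbitrary: t)
  case (Suc j)
  define g where "g = (window_mean h ^^ j) f"
  have cg: "continuous_on A g" for A
    using continuous_window_mean_iter[OF assms(1), of j] unfolding g_def by (rule continuous_on_subset) auto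
  have "norm (integral {t..t+h} g) \<le> B * (t + h - t)"
  proof (rule integral_bound)
    fix s assume s: "s \<in> {t..t+h}"
    show "norm (g s) \<le> B" unfolding g_def
      by (rule Suc.IH, rule Suc.prems) (use s h in \<open>auto simp: algebra_simps\<close>)
  qed (use h in \<open>auto intro: cg\<close>)
  hence "norm (window_mean h g t) \<le> B" unfolding window_mean_alt[OF cg[of UNIV]] norm_divide using h by (simp add: field_simps)
  thus ?case by (simp add: g_def)
qed simp

lemma window_mean_diff:
  assumes "continuous_on UNIV f" "continuous_on UNIV g"
  shows "window_mean h (\<lambda>t. f t - g t) = (\<lambda>t. window_mean h f t - window_mean h g t)"
proof
  fix t
  have "continuous_on {0..h} (\<lambda>x. f (t + x))" "continuous_on {0..h} (\<lambda>x. g (t + x))"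
    by (auto intro!: continuous_on_compose2[OF assms(1)] continuous_on_compose2[OF assms(2)] continuous_intros)
  hence "integral {0..h} (\<lambda>x. f (t + x) - g (t + x)) = integral {0..h} (\<lambda>x. f (t + x)) - integral {0..h} (\<lambda>x. g (t + x))"
    by (intro integral_diff integrable_continuous_real)
  thus "window_mean h (\<lambda>t. f t - g t) t = window_mean h f t - window_mean h g t" by (simp add: window_mean_def diff_divide_distrib)
qed

lemma window_mean_iter_diff:
  assumes "continuous_on UNIV f" "continuous_on UNIV g"
  shows "(window_mean h ^^ j) (\<lambda>t. f t - g t) = (\<lambda>t. (window_mean h ^^ j) f t - (window_mean h ^^ j) g t)"
proof (induction j)
  case (Suc j)
  thus ?case using window_mean_diff[OF continuous_window_mean_iter[OF assms(1)] continuous_window_mean_iter[OF assms(2)]] by simp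
qed simp

text \<open>
  Exponentials are eigenfunctions of the averaging operator. Iterating it raises the eigenvalues to a power
  and thereby suppresses all frequencies away from 0.
\<close>
lemma window_mean_exp_sum:
  assumes "finite A"
  shows "window_mean h (\<lambda>t. \<Sum>n\<in>A. c n * exp (\<i> * of_real (t * \<xi> n))) =
    (\<lambda>t. \<Sum>n\<in>A. c n * (integral {0..h} (\<lambda>t. exp (\<i> * of_real (t * \<xi> n))) / of_real h) * exp (\<i> * of_real (t * \<xi> n)))"
proof
  fix t
  have i: "(\<lambda>x. c n * exp (\<i> * of_real (t * \<xi> n)) * exp (\<i> * of_real (x * \<xi> n))) integrable_on {0..h}" for n
    by (intro integrable_continuous_real continuous_intros)
  have "c n * exp (\<i> * of_real ((t + x) * \<xi> n)) = c n * exp (\<i> * of_real (t * \<xi> n)) * exp (\<i> * of_real (x * \<xi> n))" for n x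
    by (simp add: ring_distribs exp_add)
  hence "window_mean h (\<lambda>t. \<Sum>n\<in>A. c n * exp (\<i> * of_real (t * \<xi> n))) t
    = integral {0..h} (\<lambda>x. \<Sum>n\<in>A. c n * exp (\<i> * of_real (t * \<xi> n)) * exp (\<i> * of_real (x * \<xi> n))) / of_real h"
    by (simp only: window_mean_def)
  also have "integral {0..h} (\<lambda>x. \<Sum>n\<in>A. c n * exp (\<i> * of_real (t * \<xi> n)) * exp (\<i> * of_real (x * \<xi> n)))
    = (\<Sum>n\<in>A. integral {0..h} (\<lambda>x. c n * exp (\<i> * of_real (t * \<xi> n)) * exp (\<i> * of_real (x * \<xi> n))))"
    by (intro integral_sum assms i)
  also have "\<dots> / of_real h = (\<Sum>n\<in>A. c n * (integral {0..h} (\<lambda>t. exp (\<i> * of_real (t * \<xi> n))) / of_real h) * exp (\<i> * of_real (t * \<xi> n)))"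
    unfolding integral_mult_right sum_divide_distrib by (intro sum.cong refl) (simp add: mult_ac)
  finally show "window_mean h (\<lambda>t. \<Sum>n\<in>A. c n * exp (\<i> * of_real (t * \<xi> n))) t = \<dots>" .
qed

lemma window_mean_iter_exp_sum:
  assumes "finite A"
  shows "(window_mean h ^^ j) (\<lambda>t. \<Sum>n\<in>A. c n * exp (\<i> * of_real (t * \<xi> n))) =
    (\<lambda>t. \<Sum>n\<in>A. c n * (integral {0..h} (\<lambda>t. exp (\<i> * of_real (t * \<xi> n))) / of_real h) ^ j * exp (\<i> * of_real (t * \<xi> n)))"
proof (induction j)
  case (Suc j)
  show ?case by (simp only: funpow.simps o_apply Suc.IH window_mean_exp_sum[OF assms]) (simp only: power_Suc2 mult.assoc)
qed simp

text \<open>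
  For n \<ge> 2 the frequency ln n is at least ln 2, and width 10 is large enough to make its eigenvalue at most
  exp(-1). After j averages only the constant term 1 survives up to exp(-j) times the sum
  of the coefficients.
\<close>
lemma window_mean_iter_zeta_partial_sum_lower:
  assumes N: "N \<ge> 1"
  shows "norm ((window_mean 10 ^^ j) (zeta_partial_sum N) t) \<ge> 1 - 2 * sqrt (real N) * exp (- real j)"
proof -
  define m where "m = (\<lambda>n::nat. integral {0..10} (\<lambda>t. exp (\<i> * of_real (t * (- ln (real n))))) / 10)"
  define e where "e = (\<lambda>n::nat. exp (\<i> * of_real (t * (- ln (real n)))))"
  have m1: "m 1 = 1" by (simp add: m_def scaleR_conv_of_real)
  have mn: "norm (m n) \<le> exp (- 1)" if n: "n \<ge> 2" for n
  proof -
    have "ln (real n) \<ge> ln 2" using n by simp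
    hence l: "ln (real n) \<ge> 2/3" using ln2_ge_two_thirds by linarith
    have q: "norm (integral {0..10} (\<lambda>t. exp (\<i> * of_real (t * (- ln (real n)))))) \<le> 2 / \<bar>- ln (real n)\<bar>"
      using l by (intro linear_phase_integral) auto
    have "norm (m n) = norm (integral {0..10} (\<lambda>t. exp (\<i> * of_real (t * (- ln (real n)))))) / 10"
      by (simp only: m_def norm_divide norm_numeral)
    also have "\<dots> \<le> 2 / \<bar>- ln (real n)\<bar> / 10" using q by (rule divide_right_mono) simp
    also have "\<dots> \<le> 3 / 10" using l by (simp add: field_simps)
    also have "\<dots> \<le> exp (- 1)" using e_less_272 by (simp add: exp_minus field_simps)
    finally show ?thesis .
  qed
  have "(window_mean 10 ^^ j) (zeta_partial_sum N) t = (\<Sum>n=1..N. of_real (real n powr (-1/2)) * m n ^ j * e n)"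
    unfolding zeta_partial_sum_def[abs_def] m_def e_def by (subst window_mean_iter_exp_sum) auto
  also have "\<dots> = 1 + (\<Sum>n=2..N. of_real (real n powr (-1/2)) * m n ^ j * e n)"
    using N by (subst sum.atLeast_Suc_atMost) (auto simp: numeral_2_eq_2 m1[unfolded One_nat_def] e_def)
  finally have eq: "(window_mean 10 ^^ j) (zeta_partial_sum N) t = 1 + (\<Sum>n=2..N. of_real (real n powr (-1/2)) * m n ^ j * e n)" .
  have "norm (\<Sum>n=2..N. of_real (real n powr (-1/2)) * m n ^ j * e n) \<le> (\<Sum>n=2..N. real n powr (-1/2) * exp (- real j))"
  proof (rule order_trans[OF norm_sum], rule sum_mono)
    fix n assume n: "n \<in> {2..N}"
    have "norm (m n) ^ j \<le> exp (-1) ^ j" using mn n by (intro power_mono) auto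
    also have "exp (-1) ^ j = exp (- real j)" by (simp add: exp_of_nat_mult[symmetric])
    finally have "real n powr (-1/2) * norm (m n) ^ j \<le> real n powr (-1/2) * exp (- real j)"
      by (intro mult_left_mono) auto
    thus "norm (of_real (real n powr (-1/2)) * m n ^ j * e n) \<le> real n powr (-1/2) * exp (- real j)"
      by (simp add: norm_mult norm_power e_def)
  qed
  also have "\<dots> \<le> (\<Sum>n=1..N. real n powr (-1/2) * exp (- real j))" by (intro sum_mono2) auto
  also have "\<dots> = (\<Sum>n=1..N. real n powr (-1/2)) * exp (- real j)" by (simp add: sum_distrib_right)
  also have "\<dots> \<le> 2 * sqrt (real N) * exp (- real j)" by (intro mult_right_mono sum_inverse_sqrt) auto
  finally have "norm (\<Sum>n=2..N. of_real (real n powr (-1/2)) * m n ^ j * e n) \<le> 2 * sqrt (real N) * exp (- real j)" .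
  moreover have "norm (1::complex) - norm (\<Sum>n=2..N. of_real (real n powr (-1/2)) * m n ^ j * e n) \<le> norm ((window_mean 10 ^^ j) (zeta_partial_sum N) t)"
    unfolding eq using norm_diff_ineq by blast
  ultimately show ?thesis by simp
qed

definition window_length :: "real \<Rightarrow> real" where "window_length T = 10 * of_int \<lceil>ln T\<rceil>"

text \<open>
  With j of size ln T averages of width 10, the suppression exp(-j) beats the sum of coefficients T^(3/4), so
  the iterated mean of \<zeta> has absolute value at least 1/2. That mean only involves the window
  [t, t + 10 j], and is at most 1/10 of the integral of |\<zeta>| there. The passage to
  the square is the Cauchy-Schwarz inequality.
\<close>
lemma local_second_moment_lower:
  "eventually (\<lambda>T. \<forall>t. T / 4 \<le> t \<and> t + window_length T \<le> 4 * T \<longrightarrow>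
     integral {t..t + window_length T} (\<lambda>x. (hardy_Z x)\<^sup>2) \<ge> 25 / window_length T) at_top"
proof -
  have "((\<lambda>T::real. 4 * T powr (3/4) * exp (- ln T)) \<longlongrightarrow> 0) at_top" by real_asymp
  hence "eventually (\<lambda>T::real. 4 * T powr (3/4) * exp (- ln T) < 1/10) at_top" by (rule order_tendstoD) simp
  thus ?thesis using zeta_line_approx eventually_gt_at_top[of 1]
  proof eventually_elim
    case (elim T)
    define J where "J = nat \<lceil>ln T\<rceil>"
    have l0: "ln T > 0" using elim by simp
    hence J: "real J = of_int \<lceil>ln T\<rceil>" "real J \<ge> ln T" "J \<ge> 1" unfolding J_def by (auto, linarith)
    define L where "L = window_length T"
    have L: "L = 10 * real J" by (simp add: L_def window_length_def J(1))
    note L = L order.strict_trans2[OF _ eq_refl[OF L[symmetric]], of 0]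
    have "0 < 10 * real J" using J(3) by simp
    note L = L(1) L(2)[OF this]
    define N where "N = cutoff T"
    note N = cutoff_bounds[of T, folded N_def]
    show ?case
    proof (intro allI impI)
      fix t assume t: "T / 4 \<le> t \<and> t + window_length T \<le> 4 * T"
      define z where "z = (\<lambda>x. zeta (Complex (1/2) x))"
      have cz: "continuous_on A z" for A unfolding z_def by (intro continuous_intros)
      have "sqrt (real N) * exp (- real J) \<le> 2 * T powr (3/4) * exp (- ln T)"
        using N(3) elim J by (intro mult_mono) auto
      hence "norm ((window_mean 10 ^^ J) (zeta_partial_sum N) t) \<ge> 9 / 10"
        using window_mean_iter_zeta_partial_sum_lower[OF N(2), of J t] elim by linarith
      moreover have "norm ((window_mean 10 ^^ J) (\<lambda>x. z x - zeta_partial_sum N x) t) \<le> 1 / 10"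
      proof (rule window_mean_iter_bound[OF _ zero_less_numeral])
        fix s assume "s \<in> {t..t + real J * 10}"
        thus "norm (z s - zeta_partial_sum N s) \<le> 1 / 10" using elim(2) t L unfolding z_def N_def L_def by auto
      qed (intro continuous_intros cz continuous_zeta_partial_sum)
      moreover have "(window_mean 10 ^^ J) (\<lambda>x. z x - zeta_partial_sum N x) t = (window_mean 10 ^^ J) z t - (window_mean 10 ^^ J) (zeta_partial_sum N) t"
        by (simp add: window_mean_iter_diff[OF cz continuous_zeta_partial_sum])
      ultimately have low: "norm ((window_mean 10 ^^ J) z t) \<ge> 1 / 2"
        using norm_triangle_ineq2[of "(window_mean 10 ^^ J) (zeta_partial_sum N) t" "(window_mean 10 ^^ J) z t"] by (simp add: norm_minus_commute)
      obtain j where j: "J = Suc j" using J(3) by (cases J) auto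
      define M where "M = integral {t..t + L} (\<lambda>x. norm (z x))"
      have "norm ((window_mean 10 ^^ j) (window_mean 10 z) t) \<le> M / 10"
      proof (rule window_mean_iter_bound[OF continuous_window_mean[OF cz] zero_less_numeral])
        fix s assume s: "s \<in> {t..t + real j * 10}"
        have "norm (integral {s..s+10} z) \<le> integral {s..s+10} (\<lambda>x. norm (z x))"
          by (rule continuous_on_imp_absolutely_integrable_on[OF cz])
        also have "\<dots> \<le> M" unfolding M_def
          by (rule integral_subset_le)
             (use s L j in \<open>auto intro!: integrable_continuous_real continuous_intros cz simp: algebra_simps\<close>)
        finally show "norm (window_mean 10 z s) \<le> M / 10" by (simp add: window_mean_alt[OF cz] norm_divide)
      qed
      hence M5: "M \<ge> 5" using low by (simp add: j funpow_Suc_right del: funpow.simps)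
      (* The maximiser of 10 k - k^2 L. *)
      define k where "k = 5 / L"
      have k: "k > 0" using L by (simp add: k_def)
      have "integral {t..t + L} (\<lambda>x. 2 * k * norm (z x) - k\<^sup>2) \<le> integral {t..t + L} (\<lambda>x. (norm (z x))\<^sup>2)"
      proof (rule integral_le)
        fix x
        show "2 * k * norm (z x) - k\<^sup>2 \<le> (norm (z x))\<^sup>2"
          using sum_squares_bound[of k "norm (z x)"] by simp
      qed (intro integrable_continuous_real continuous_intros cz)+
      also have "integral {t..t + L} (\<lambda>x. 2 * k * norm (z x) - k\<^sup>2) = 2 * k * M - k\<^sup>2 * L"
        unfolding M_def using L by (subst integral_diff) (auto intro!: integrable_continuous_real continuous_intros cz)
      finally have low2: "2 * k * M - k\<^sup>2 * L \<le> integral {t..t + L} (\<lambda>x. (norm (z x))\<^sup>2)" .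
      have "25 / L = 2 * k * 5 - k\<^sup>2 * L" using L(2) by (simp add: k_def power2_eq_square)
      also have "2 * k * 5 \<le> 2 * k * M" using M5 k by (intro mult_left_mono) auto
      hence "2 * k * 5 - k\<^sup>2 * L \<le> 2 * k * M - k\<^sup>2 * L" by (rule diff_right_mono)
      also note low2
      also have "(\<lambda>x. (norm (z x))\<^sup>2) = (\<lambda>x. (hardy_Z x)\<^sup>2)"
        by (simp add: z_def abs_hardy_Z[symmetric])
      finally show "integral {t..t + window_length T} (\<lambda>x. (hardy_Z x)\<^sup>2) \<ge> 25 / window_length T"
        by (simp only: L_def)
    qed
  qed
qed

section \<open>Resonance\<close>

definition prodset :: "nat set \<Rightarrow> nat" where "prodset X = \<Prod>X"

lemma prodset_bounds:
  assumes "finite S" "\<And>p. p \<in> S \<Longrightarrow> prime p" "X \<subseteq> S"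
  shows "prodset X \<ge> 1" "prodset X \<le> prodset S" "prodset X dvd prodset S"
proof -
  have f: "finite X" using assms finite_subset by blast
  have "prodset S > 0" "prodset X > 0" unfolding prodset_def using assms prime_gt_0_nat
    by (auto intro!: prod_pos)
  moreover show "prodset X dvd prodset S" unfolding prodset_def using assms by (intro prod_dvd_prod_subset) auto
  ultimately show "prodset X \<ge> 1" "prodset X \<le> prodset S" by (auto intro: dvd_imp_le)
qed

lemma prodset_inj:
  assumes "finite S" "\<And>p. p \<in> S \<Longrightarrow> prime p"
  shows "inj_on prodset (Pow S)"
proof -
  have "inj_on Prod (Pow S)"
    by (rule inj_on_Prod_primes) (use assms finite_subset in auto)
  thus ?thesis by (simp add: inj_on_def prodset_def)
qed

text \<open>
  Distinct integers differ by at least 1; the bound only involves the smaller-sized number b, so that the other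
  one may be large.
\<close>
lemma ln_ratio_lower:
  fixes a b P :: nat
  assumes "a \<ge> 1" "b \<ge> 1" "b \<le> P" "a \<noteq> b"
  shows "\<bar>ln (real b) - ln (real a)\<bar> \<ge> 1 / (2 * real P)"
proof (cases "a < b")
  case True
  have "ln (real a / real b) \<le> real a / real b - 1" using assms by (intro ln_le_minus_one) auto
  also have "\<dots> \<le> - (1 / real b)"
  proof -
    have "(real a + 1) / real b \<le> 1" using True by (simp add: divide_le_eq)
    thus ?thesis by (simp add: add_divide_distrib)
  qed
  finally have "1 / real b \<le> ln (real b) - ln (real a)" using assms by (simp add: ln_div)
  moreover have "1 / (2 * real P) \<le> 1 / real b" using assms by (intro divide_left_mono) auto
  ultimately show ?thesis by linarith
next
  case False
  hence ab: "b + 1 \<le> a" using assms by simp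
  have "ln (real b / real a) \<le> real b / real a - 1" using assms by (intro ln_le_minus_one) auto
  also have "real b / real a \<le> real b / real (b + 1)" using ab by (intro divide_left_mono) auto
  hence "real b / real a - 1 \<le> real b / real (b + 1) - 1" by simp
  also have "\<dots> = - (1 / real (b + 1))" by (simp add: field_simps)
  finally have "1 / real (b + 1) \<le> ln (real a) - ln (real b)" using assms by (simp add: ln_div)
  moreover have "1 / (2 * real P) \<le> 1 / real (b + 1)" using assms by (intro divide_left_mono) auto
  ultimately show ?thesis by linarith
qed

text \<open>
  The eigenvalue is the mean of exp(i t \<xi>) over [0, h], whose real part is a mean of cosines of numbers
  in [-1, 1] when h |\<xi>| \<le> 1.
\<close>
lemma window_mean_multiplier:
  assumes h: "h > 0"
  shows "norm (integral {0..h} (\<lambda>t. exp (\<i> * of_real (t * \<xi>))) / of_real h) \<le> 1"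
    and "h * \<bar>\<xi>\<bar> \<le> 1 \<Longrightarrow> Re (integral {0..h} (\<lambda>t. exp (\<i> * of_real (t * \<xi>))) / of_real h) \<ge> 1 / 2"
proof -
  let ?g = "\<lambda>t. exp (\<i> * complex_of_real (t * \<xi>))"
  have cg: "continuous_on {0..h} ?g" by (intro continuous_intros)
  have "norm (integral {0..h} ?g) \<le> 1 * (h - 0)"
    by (rule integral_bound) (use h cg in auto)
  thus "norm (integral {0..h} ?g / of_real h) \<le> 1" using h by (simp add: norm_divide)
  assume x: "h * \<bar>\<xi>\<bar> \<le> 1"
  have "integral {0..h} (\<lambda>t. 1 / 2 :: real) \<le> integral {0..h} (\<lambda>t. Re (?g t))"
  proof (rule integral_le)
    show "(\<lambda>t. Re (?g t)) integrable_on {0..h}" by (intro integrable_continuous_real continuous_intros)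
    fix t assume t: "t \<in> {0..h}"
    have "\<bar>t * \<xi>\<bar> \<le> h * \<bar>\<xi>\<bar>" using t by (simp add: abs_mult mult_right_mono)
    hence "\<bar>t * \<xi>\<bar> \<le> 1" using x by linarith
    hence "(t * \<xi>)\<^sup>2 \<le> 1" by (simp add: abs_square_le_1)
    moreover have "cos (t * \<xi>) \<ge> 1 - (t * \<xi>)\<^sup>2 / 2"
    proof -
      have "(sin (t * \<xi> / 2))\<^sup>2 \<le> (t * \<xi> / 2)\<^sup>2"
        using abs_sin_x_le_abs_x[of "t * \<xi> / 2"] by (simp only: abs_le_square_iff)
      thus ?thesis using cos_double_sin[of "t * \<xi> / 2"] by (simp add: power_divide)
    qed
    ultimately show "1 / 2 \<le> Re (?g t)" by (simp add: Re_exp)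
  qed auto
  also have "integral {0..h} (\<lambda>t. Re (?g t)) = Re (integral {0..h} ?g)"
    using integral_linear[OF integrable_continuous_real[OF cg] bounded_linear_Re] by (simp add: o_def)
  finally have "h / 2 \<le> Re (integral {0..h} ?g)" using h by simp
  thus "Re (integral {0..h} ?g / of_real h) \<ge> 1 / 2" using h by (simp add: field_simps)
qed

text \<open>
  Both sums are expanded products over primes, by multiplicativity.
\<close>
lemma sum_prodset_powr:
  assumes S: "finite S" "\<And>p. p \<in> S \<Longrightarrow> prime p"
  shows "(\<Sum>Y\<in>Pow S. \<Sum>X\<in>Pow Y. real (prodset (Y - X)) powr (-1/2)) = (\<Prod>p\<in>S. 2 + real p powr (-1/2))"
proof -
  define w where "w = (\<lambda>p::nat. real p powr (-1/2))"
  have pw: "real (prodset Z) powr (-1/2) = (\<Prod>p\<in>Z. w p)" for Z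
    by (simp add: prodset_def w_def prod_powr_distrib)
  have "(\<Sum>X\<in>Pow Y. real (prodset (Y - X)) powr (-1/2)) = (\<Prod>p\<in>Y. 1 + w p)" if "Y \<in> Pow S" for Y
  proof -
    have "finite Y" using that S finite_subset by blast
    thus ?thesis unfolding pw by (simp add: prod_add)
  qed
  hence "(\<Sum>Y\<in>Pow S. \<Sum>X\<in>Pow Y. real (prodset (Y - X)) powr (-1/2)) = (\<Sum>Y\<in>Pow S. \<Prod>p\<in>Y. 1 + w p)"
    by (intro sum.cong refl) auto
  also have "\<dots> = (\<Prod>p\<in>S. (1 + w p) + 1)" using S by (subst prod_add) auto
  finally show ?thesis by (simp add: w_def add.commute add.left_commute) 
qed

text \<open>
  Compare the mean of the averaged \<zeta> weighted by |R|^2, where R(t) is the sum of (\<Prod>X) powr (-it) over all subsets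
  X of S, with the mean of |R|^2. In the weighted integral a triple (n, X, Y) with
  \<Prod>Y = n \<Prod>X does not oscillate, and its contribution has nonnegative real part, since the averaging is too short to affect
  frequencies up to ln (\<Prod>S). The triples with X \<subseteq> Y alone give the product on the left. All other
  triples oscillate with frequency at least 1 / (2 \<Prod>S) and are error terms. The quotient of the two means, roughly the
  product of the factors 1 + p powr (-1/2) / 2, bounds B from below.
\<close>
lemma resonance:
  assumes S: "finite S" "\<And>p. p \<in> S \<Longrightarrow> prime p"
    and h: "h > 0" "h * ln (real (prodset S)) \<le> 1"
    and N: "prodset S \<le> N" and H: "H > 0"
    and B: "\<And>v. v \<in> {A..A+H} \<Longrightarrow> norm (window_mean h (zeta_partial_sum N) v) \<le> B"
  shows "H / 2 * (\<Prod>p\<in>S. 2 + real p powr (-1/2)) \<le>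
    B * (H * 2 ^ card S + 4 * real (prodset S) * 4 ^ card S) + 8 * sqrt (real N) * real (prodset S) * 4 ^ card S"
proof -
  define D where "D = Pow S"
  have fD: "finite D" using S by (simp add: D_def)
  have cD: "real (card D) = 2 ^ card S" using S by (simp add: D_def card_Pow)
  have cD2: "real (card D) * real (card D) = 4 ^ card S" unfolding cD by (simp add: power_mult_distrib[symmetric])
  define l where "l = (\<lambda>X. ln (real (prodset X)))"
  define P where "P = real (prodset S)"
  note ps = prodset_bounds[OF S]
  have pD: "prodset X \<ge> 1" "prodset X \<le> prodset S" if "X \<in> D" for X using ps that by (auto simp: D_def)
  have P1: "P \<ge> 1" using ps(1)[of S] by (simp add: P_def)
  have N1: "N \<ge> 1" using ps(1)[of S] N by simp
  define c where "c = (\<lambda>n::nat. real n powr (-1/2))"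
  define \<mu> where "\<mu> = (\<lambda>n::nat. integral {0..h} (\<lambda>t. exp (\<i> * of_real (t * (- ln (real n))))) / of_real h)"
  define K where "K = (\<lambda>\<xi>. integral {A..A+H} (\<lambda>t. exp (\<i> * of_real (t * \<xi>))))"
  define W where "W = (\<lambda>t. \<Sum>(X,Y)\<in>D\<times>D. exp (\<i> * of_real (t * (l Y - l X))))"
  have K0: "K 0 = of_real H" using H by (simp add: K_def scaleR_conv_of_real)
  have K1: "norm (K \<xi>) \<le> 2 / \<bar>\<xi>\<bar>" if "\<xi> \<noteq> 0" for \<xi>
    unfolding K_def using that H by (intro linear_phase_integral) auto
  have gap: "norm (K (ln (real b) - ln (real a))) \<le> 4 * P" if "a \<ge> 1" "b \<ge> 1" "b \<le> prodset S" "a \<noteq> b" for a b :: nat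
  proof -
    have g: "\<bar>ln (real b) - ln (real a)\<bar> \<ge> 1 / (2 * P)" unfolding P_def by (rule ln_ratio_lower) fact+
    have p: "1 / (2 * P) > 0" using P1 by simp
    have "norm (K (ln (real b) - ln (real a))) \<le> 2 / \<bar>ln (real b) - ln (real a)\<bar>" using g p by (intro K1) auto
    also have "\<dots> \<le> 2 / (1 / (2 * P))" using g p by (intro divide_left_mono mult_pos_pos) auto
    finally show ?thesis by simp
  qed
  have Weq: "W t = of_real ((norm (\<Sum>X\<in>D. exp (\<i> * of_real (t * (- l X)))))\<^sup>2)" for t
  proof -
    let ?R = "\<Sum>X\<in>D. exp (\<i> * complex_of_real (t * (- l X)))"
    have cn: "cnj ?R = (\<Sum>Y\<in>D. exp (\<i> * complex_of_real (t * l Y)))"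
      by (simp add: exp_cnj)
    have "complex_of_real ((norm ?R)\<^sup>2) = ?R * cnj ?R" by (rule complex_norm_square)
    also have "\<dots> = (\<Sum>X\<in>D. \<Sum>Y\<in>D. exp (\<i> * complex_of_real (t * (- l X))) * exp (\<i> * complex_of_real (t * l Y)))"
      unfolding cn by (rule sum_product)
    also have "\<dots> = (\<Sum>X\<in>D. \<Sum>Y\<in>D. exp (\<i> * of_real (t * (l Y - l X))))"
      unfolding exp_add[symmetric] by (intro sum.cong refl arg_cong[of _ _ exp]) (simp add: algebra_simps)
    finally show ?thesis unfolding W_def by (simp only: sum.cartesian_product)
  qed
  have cW: "continuous_on C W" for C unfolding W_def case_prod_beta' by (intro continuous_intros)
  have ReW: "norm (W t) = Re (W t)" "Re (W t) \<ge> 0" for t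
    unfolding Weq Re_complex_of_real norm_of_real by (simp_all only: abs_power2 zero_le_power2)
  define G where "G = (\<lambda>t. window_mean h (zeta_partial_sum N) t * W t)"
  have cG: "continuous_on C G" for C unfolding G_def
    using continuous_window_mean[OF continuous_zeta_partial_sum[of UNIV N], of h] by (intro continuous_intros cW) (rule continuous_on_subset, auto)
  have iW: "W integrable_on {A..A+H}" and iG: "G integrable_on {A..A+H}"
    by (intro integrable_continuous_real cW cG)+
  have RiW: "integral {A..A+H} (\<lambda>t. Re (W t)) = Re (integral {A..A+H} W)"
    using integral_linear[OF iW bounded_linear_Re] by (simp add: o_def)
  have B0: "B \<ge> 0" by (rule order_trans[OF norm_ge_zero B[of A]]) (use H in auto)

  have "Re (integral {A..A+H} W) = (\<Sum>(X,Y)\<in>D\<times>D. Re (K (l Y - l X)))"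
  proof -
    have "integral {A..A+H} W = (\<Sum>z\<in>D\<times>D. integral {A..A+H} (\<lambda>t. exp (\<i> * of_real (t * (l (snd z) - l (fst z))))))"
      unfolding W_def case_prod_beta'
      by (intro integral_sum finite_cartesian_product fD integrable_continuous_real continuous_intros)
    thus ?thesis by (simp only: Re_sum K_def case_prod_beta')
  qed
  also have "\<dots> \<le> (\<Sum>(X,Y)\<in>D\<times>D. (if Y = X then H else 0) + 4 * P)"
  proof (rule sum_mono, clarify)
    fix X Y assume XY: "X \<in> D" "Y \<in> D"
    show "Re (K (l Y - l X)) \<le> (if Y = X then H else 0) + 4 * P"
    proof (cases "Y = X")
      case True
      thus ?thesis using K0 P1 by simp
    next
      case False
      hence ne: "prodset X \<noteq> prodset Y" using prodset_inj[OF S] XY by (auto simp: inj_on_def D_def)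
      have "Re (K (l Y - l X)) \<le> norm (K (l Y - l X))" by (rule complex_Re_le_cmod)
      also have "\<dots> \<le> 4 * P" unfolding l_def by (rule gap) (use pD XY ne in auto)
      finally show ?thesis using False by simp
    qed
  qed
  also have "\<dots> = H * 2 ^ card S + 4 * P * 4 ^ card S"
    by (simp add: sum.cartesian_product[symmetric] sum.distrib sum.delta fD cD cD2[symmetric] algebra_simps)
  finally have upW: "Re (integral {A..A+H} W) \<le> H * 2 ^ card S + 4 * P * 4 ^ card S" .

  have "Re (integral {A..A+H} G) \<le> norm (integral {A..A+H} G)" by (rule complex_Re_le_cmod)
  also have "\<dots> \<le> integral {A..A+H} (\<lambda>t. B * Re (W t))"
  proof (rule integral_norm_bound_integral[OF iG])
    show "(\<lambda>t. B * Re (W t)) integrable_on {A..A+H}" by (intro integrable_continuous_real continuous_intros cW)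
    show "norm (G t) \<le> B * Re (W t)" if "t \<in> {A..A+H}" for t
      unfolding G_def norm_mult ReW(1) using B[OF that] ReW(2) by (intro mult_right_mono) auto
  qed
  also have "\<dots> = B * Re (integral {A..A+H} W)" by (simp add: RiW)
  also have "\<dots> \<le> B * (H * 2 ^ card S + 4 * P * 4 ^ card S)" using upW B0 by (rule mult_left_mono)
  finally have upper: "Re (integral {A..A+H} G) \<le> B * (H * 2 ^ card S + 4 * P * 4 ^ card S)" .

  have boxd: "window_mean h (zeta_partial_sum N) = (\<lambda>t. \<Sum>n=1..N. of_real (c n) * \<mu> n * exp (\<i> * of_real (t * (- ln (real n)))))"
    unfolding zeta_partial_sum_def[abs_def] c_def \<mu>_def by (rule window_mean_exp_sum) simp
  have Geq: "G = (\<lambda>t. \<Sum>(n,X,Y)\<in>{1..N}\<times>D\<times>D. of_real (c n) * \<mu> n * exp (\<i> * of_real (t * (l Y - (ln (real n) + l X)))))"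
  proof
    fix t
    have "G t = (\<Sum>n=1..N. \<Sum>z\<in>D\<times>D. of_real (c n) * \<mu> n * exp (\<i> * of_real (t * (- ln (real n)))) * exp (\<i> * of_real (t * (l (snd z) - l (fst z)))))"
      unfolding G_def boxd W_def case_prod_beta' by (rule sum_product)
    also have "\<dots> = (\<Sum>n=1..N. \<Sum>z\<in>D\<times>D. of_real (c n) * \<mu> n * exp (\<i> * of_real (t * (l (snd z) - (ln (real n) + l (fst z))))))"
      unfolding mult.assoc exp_add[symmetric]
      by (intro sum.cong refl arg_cong2[of _ _ _ _ "(*)"] arg_cong[of _ _ exp]) (simp add: algebra_simps)
    finally show "G t = (\<Sum>(n,X,Y)\<in>{1..N}\<times>D\<times>D. of_real (c n) * \<mu> n * exp (\<i> * of_real (t * (l Y - (ln (real n) + l X)))))"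
      by (simp only: sum.cartesian_product case_prod_beta')
  qed
  have "(\<Sum>(n,X,Y)\<in>{1..N}\<times>D\<times>D. (if prodset Y = n * prodset X then c n * H / 2 else 0) - c n * (4 * P))
     \<le> (\<Sum>(n,X,Y)\<in>{1..N}\<times>D\<times>D. Re (of_real (c n) * \<mu> n * K (l Y - (ln (real n) + l X))))"
  proof (rule sum_mono, clarify)
    fix n X Y assume n: "n \<in> {1..N}" and XY: "X \<in> D" "Y \<in> D"
    have c0: "c n \<ge> 0" by (simp add: c_def)
    have X0: "prodset X \<ge> 1" "prodset Y \<ge> 1" "prodset Y \<le> prodset S" using pD XY by auto
    have ln: "ln (real n) + l X = ln (real (n * prodset X))"
      using n X0 by (simp add: l_def ln_mult)
    show "(if prodset Y = n * prodset X then c n * H / 2 else 0) - c n * (4 * P) \<le>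
        Re (of_real (c n) * \<mu> n * K (l Y - (ln (real n) + l X)))"
    proof (cases "prodset Y = n * prodset X")
      case True
      have "n \<le> prodset Y" using True X0 by simp
      hence "real n \<le> real (prodset S)" using X0 by simp
      hence "ln (real n) \<le> ln (real (prodset S))" using n by (subst ln_le_cancel_iff) auto
      hence "h * ln (real n) \<le> h * ln (real (prodset S))" using h(1) by (intro mult_left_mono) auto
      hence "h * ln (real n) \<le> 1" using h(2) by linarith
      hence "h * \<bar>- ln (real n)\<bar> \<le> 1" using n by simp
      hence "Re (\<mu> n) \<ge> 1 / 2" unfolding \<mu>_def by (intro window_mean_multiplier h)
      hence "c n * H * (1 / 2) \<le> c n * H * Re (\<mu> n)" using c0 H by (intro mult_left_mono) auto
      moreover have "l Y - (ln (real n) + l X) = 0" unfolding ln by (simp add: l_def True)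
      moreover have "c n * (4 * P) \<ge> 0" using c0 P1 by simp
      ultimately show ?thesis using True by (simp add: K0 mult_ac)
    next
      case False
      have "norm (of_real (c n) * \<mu> n * K (l Y - (ln (real n) + l X))) = c n * (norm (\<mu> n) * norm (K (l Y - (ln (real n) + l X))))"
        using c0 by (simp add: norm_mult)
      also have "\<dots> \<le> c n * (1 * (4 * P))"
      proof (intro mult_left_mono mult_mono c0)
        show "norm (\<mu> n) \<le> 1" unfolding \<mu>_def by (rule window_mean_multiplier) (rule h)
        show "norm (K (l Y - (ln (real n) + l X))) \<le> 4 * P"
          unfolding ln unfolding l_def by (rule gap) (use X0 n False in auto)
      qed auto
      finally have "norm (of_real (c n) * \<mu> n * K (l Y - (ln (real n) + l X))) \<le> c n * (4 * P)" by simp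
      thus ?thesis using False abs_Re_le_cmod[of "of_real (c n) * \<mu> n * K (l Y - (ln (real n) + l X))"] by simp
    qed
  qed
  also have "\<dots> = Re (integral {A..A+H} G)"
  proof -
    have "integral {A..A+H} G = (\<Sum>z\<in>{1..N}\<times>D\<times>D. integral {A..A+H}
      (\<lambda>t. of_real (c (fst z)) * \<mu> (fst z) * exp (\<i> * of_real (t * (l (snd (snd z)) - (ln (real (fst z)) + l (fst (snd z))))))))"
      unfolding Geq case_prod_beta'
      by (intro integral_sum finite_cartesian_product fD finite_atLeastAtMost integrable_continuous_real continuous_intros)
    thus ?thesis by (simp only: Re_sum K_def case_prod_beta' integral_mult_right)
  qed
  finally have lower: "(\<Sum>(n,X,Y)\<in>{1..N}\<times>D\<times>D. (if prodset Y = n * prodset X then c n * H / 2 else 0) - c n * (4 * P))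
     \<le> Re (integral {A..A+H} G)" .

  have "(\<Sum>(n,X,Y)\<in>{1..N}\<times>D\<times>D. c n * (4 * P)) = (\<Sum>n=1..N. \<Sum>z\<in>D\<times>D. c n * (4 * P))"
    by (simp only: sum.cartesian_product case_prod_beta')
  also have "\<dots> = (\<Sum>n=1..N. c n * (4 * P * 4 ^ card S))"
    by (intro sum.cong refl) (simp add: card_cartesian_product cD2[symmetric] mult_ac)
  also have "\<dots> = (\<Sum>n=1..N. c n) * (4 * P * 4 ^ card S)" by (simp only: sum_distrib_right)
  also have "\<dots> \<le> 2 * sqrt (real N) * (4 * P * 4 ^ card S)"
    using P1 unfolding c_def by (intro mult_right_mono sum_inverse_sqrt) auto
  finally have off: "(\<Sum>(n,X,Y)\<in>{1..N}\<times>D\<times>D. c n * (4 * P)) \<le> 8 * sqrt (real N) * P * 4 ^ card S" by simp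

  have "H / 2 * (\<Prod>p\<in>S. 2 + real p powr (-1/2)) = H / 2 * (\<Sum>Y\<in>D. \<Sum>X\<in>Pow Y. c (prodset (Y - X)))"
    by (simp only: sum_prodset_powr[OF S] D_def c_def)
  also have "\<dots> = (\<Sum>Y\<in>D. \<Sum>X\<in>Pow Y. c (prodset (Y - X)) * H / 2)"
    unfolding sum_distrib_left by (intro sum.cong refl) simp
  also have "\<dots> \<le> (\<Sum>Y\<in>D. \<Sum>X\<in>D. \<Sum>n=1..N. if prodset Y = n * prodset X then c n * H / 2 else 0)"
  proof (rule sum_mono)
    fix Y assume Y: "Y \<in> D"
    have nn: "(\<Sum>n=1..N. if prodset Y = n * prodset X then c n * H / 2 else 0) \<ge> 0" for X
      using H by (intro sum_nonneg) (auto simp: c_def)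
    have fY: "finite Y" using Y S finite_subset by (auto simp: D_def)
    have "(\<Sum>X\<in>Pow Y. c (prodset (Y - X)) * H / 2) \<le> (\<Sum>X\<in>Pow Y. \<Sum>n=1..N. if prodset Y = n * prodset X then c n * H / 2 else 0)"
    proof (rule sum_mono)
      fix X assume X: "X \<in> Pow Y"
      define m where "m = prodset (Y - X)"
      have "Y - X \<in> D" using Y by (auto simp: D_def)
      hence m: "m \<in> {1..N}" using pD N unfolding m_def by fastforce
      have eq: "prodset Y = m * prodset X"
        unfolding prodset_def m_def using X fY by (intro prod.subset_diff) auto
      have "(if prodset Y = m * prodset X then c m * H / 2 else 0) \<le> (\<Sum>n=1..N. if prodset Y = n * prodset X then c n * H / 2 else 0)"
        by (rule member_le_sum[OF m]) (use H in \<open>auto simp: c_def\<close>)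
      thus "c (prodset (Y - X)) * H / 2 \<le> (\<Sum>n=1..N. if prodset Y = n * prodset X then c n * H / 2 else 0)"
        using eq by (simp add: m_def)
    qed
    also have "\<dots> \<le> (\<Sum>X\<in>D. \<Sum>n=1..N. if prodset Y = n * prodset X then c n * H / 2 else 0)"
      using Y fD by (intro sum_mono2 nn) (auto simp: D_def)
    finally show "(\<Sum>X\<in>Pow Y. c (prodset (Y - X)) * H / 2) \<le> (\<Sum>X\<in>D. \<Sum>n=1..N. if prodset Y = n * prodset X then c n * H / 2 else 0)" .
  qed
  also have "\<dots> = (\<Sum>X\<in>D. \<Sum>Y\<in>D. \<Sum>n=1..N. if prodset Y = n * prodset X then c n * H / 2 else 0)"
    by (rule sum.swap)
  also have "\<dots> = (\<Sum>X\<in>D. \<Sum>n=1..N. \<Sum>Y\<in>D. if prodset Y = n * prodset X then c n * H / 2 else 0)"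
    by (intro sum.cong refl, rule sum.swap)
  also have "\<dots> = (\<Sum>n=1..N. \<Sum>X\<in>D. \<Sum>Y\<in>D. if prodset Y = n * prodset X then c n * H / 2 else 0)"
    by (rule sum.swap)
  also have "\<dots> = (\<Sum>(n,X,Y)\<in>{1..N}\<times>D\<times>D. if prodset Y = n * prodset X then c n * H / 2 else 0)"
    by (simp only: sum.cartesian_product)
  finally have diag: "H / 2 * (\<Prod>p\<in>S. 2 + real p powr (-1/2)) \<le> (\<Sum>(n,X,Y)\<in>{1..N}\<times>D\<times>D. if prodset Y = n * prodset X then c n * H / 2 else 0)" .
  show ?thesis
    using lower off diag upper unfolding case_prod_beta' sum_subtractf P_def by linarith
qed

section \<open>Large short means of the zeta-function\<close>

lemma primes_below_subset: "{p::nat. prime p \<and> real p \<le> t} \<subseteq> {1..nat \<lfloor>t\<rfloor>}"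
  by (auto simp: le_nat_floor prime_ge_Suc_0_nat dest: prime_gt_0_nat)

lemma finite_primes_below: "finite {p::nat. prime p \<and> real p \<le> t}"
  using finite_subset[OF primes_below_subset] by blast

lemma prime_pi_le: "t \<ge> 0 \<Longrightarrow> real (prime_pi t) \<le> t"
proof -
  assume t: "t \<ge> 0"
  have "prime_pi t \<le> card {1..nat \<lfloor>t\<rfloor>}" unfolding prime_pi_def by (intro card_mono primes_below_subset) auto
  hence "real (prime_pi t) \<le> real (nat \<lfloor>t\<rfloor>)" by simp
  also have "\<dots> \<le> t" using t by simp
  finally show ?thesis .
qed

lemma prime_pi_mono: "s \<le> t \<Longrightarrow> prime_pi s \<le> prime_pi t"
  unfolding prime_pi_def by (intro card_mono finite_primes_below) auto

text \<open>
  Resonance with S the primes up to sqrt L, where L = ln T. Then \<Prod>S is T^o(1), so that the oscillating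
  terms are negligible for intervals of length T^(4/5), while the gain
  (1 + q/2)^(card S) with q = L powr (-1/4) exceeds every power of L, because
  card S is at least of order sqrt L / ln L.
\<close>
lemma zeta_short_integral_large:
  "eventually (\<lambda>T. \<forall>A H. T / 4 \<le> A \<and> A + H + 1 \<le> 4 * T \<and> H \<ge> T powr (4/5) \<longrightarrow>
     (\<exists>v\<in>{A..A+H}. norm (integral {v..v + 1 / ln T} (\<lambda>t. zeta (Complex (1/2) t))) > ln T ^ 12 / ln T)) at_top"
proof -
  have pl: "filterlim (\<lambda>T::real. sqrt (ln T)) at_top at_top" by real_asymp
  have ev1: "eventually (\<lambda>T. real (prime_pi (sqrt (ln T))) \<ge> (1 - 1/2) * (sqrt (ln T) / ln (sqrt (ln T)))) at_top"
    by (rule eventually_compose_filterlim[OF prime_pi_lower pl]) simp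
  have ev2: "eventually (\<lambda>T::real. exp ((1 - 1/2) * (sqrt (ln T) / ln (sqrt (ln T))) * (sqrt (ln T) powr (-1/2) / 4)) > 4 * ln T ^ 12 + 3) at_top"
    by real_asymp
  have ev3: "eventually (\<lambda>T::real. 4 * exp (2 * (sqrt (ln T) * ln (sqrt (ln T)))) \<le> T powr (4/5)) at_top" by real_asymp
  have ev4: "eventually (\<lambda>T::real. 16 * T powr (3/4) * exp (2 * (sqrt (ln T) * ln (sqrt (ln T)))) \<le> T powr (4/5)) at_top" by real_asymp
  have ev5: "eventually (\<lambda>T::real. exp (sqrt (ln T) * ln (sqrt (ln T))) \<le> T powr (3/2)) at_top" by real_asymp
  have ev6: "eventually (\<lambda>T::real. sqrt (ln T) * ln (sqrt (ln T)) \<le> ln T) at_top" by real_asymp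
  have ev7: "eventually (\<lambda>T::real. sqrt (ln T) \<ge> 2) at_top" by real_asymp
  show ?thesis using ev1 ev2 ev3 ev4 ev5 ev6 ev7 zeta_line_approx eventually_gt_at_top[of 1]
  proof eventually_elim
    case (elim T)
    define L where "L = ln T"
    (* With this y, the number M = y powr y bounds the product of the primes up to y and the number
       of sets of such primes, and it is T^o(1). *)
    define y where "y = sqrt L"
    define M where "M = exp (y * ln y)"
    note el = elim[folded L_def, folded y_def, folded M_def]
    have y2: "y \<ge> 2" using el(7) .
    have L1: "L \<ge> 1"
    proof -
      have "L = y\<^sup>2" using y2 unfolding y_def by (metis less_le_trans order_le_less real_sqrt_gt_0_iff real_sqrt_pow2 zero_less_numeral)
      also have "\<dots> \<ge> 1" using y2 by (simp add: one_le_power)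
      finally show ?thesis .
    qed
    define h where "h = 1 / L"
    have h: "h > 0" "h \<le> 1" using L1 by (auto simp: h_def)
    define S where "S = {p::nat. prime p \<and> real p \<le> y}"
    have S: "finite S" "\<And>p. p \<in> S \<Longrightarrow> prime p" by (auto simp: S_def finite_primes_below)
    define r where "r = card S"
    have rpi: "r = prime_pi y" by (simp add: r_def S_def prime_pi_def)
    have ry: "real r \<le> y" unfolding rpi using y2 by (intro prime_pi_le) simp
    have My: "M = y powr y" using y2 by (simp add: M_def powr_def)
    have M2: "exp (2 * (y * ln y)) = M * M" by (simp add: M_def exp_add[symmetric])
    have M0: "M > 0" by (simp add: M_def)
    define P where "P = real (prodset S)"
    have P1: "P \<ge> 1" unfolding P_def using prodset_bounds(1)[OF S, of S] by simp
    have PM: "P \<le> M"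
    proof -
      have "P = (\<Prod>p\<in>S. real p)" by (simp add: P_def prodset_def)
      also have "\<dots> \<le> (\<Prod>p\<in>S. y)" by (intro prod_mono) (auto simp: S_def)
      also have "\<dots> = y powr real r" using y2 by (simp add: r_def powr_realpow)
      also have "\<dots> \<le> y powr y" using y2 ry by (intro powr_mono) auto
      finally show ?thesis using My by simp
    qed
    have r2M: "2 ^ r \<le> M"
    proof -
      have "(2::real) ^ r = 2 powr real r" by (simp add: powr_realpow)
      also have "\<dots> \<le> 2 powr y" using ry by (intro powr_mono) auto
      also have "\<dots> \<le> y powr y" using y2 by (intro powr_mono2) auto
      finally show ?thesis using My by simp
    qed
    have r4: "P * 4 ^ r \<le> M * M * 2 ^ r"
    proof -
      have "(4::real) ^ r = 2 ^ r * 2 ^ r" by (simp add: power_mult_distrib[symmetric])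
      hence "P * 4 ^ r = P * 2 ^ r * 2 ^ r" by simp
      also have "\<dots> \<le> M * M * 2 ^ r" using PM r2M P1 M0 by (intro mult_right_mono mult_mono) auto
      finally show ?thesis .
    qed
    define N where "N = cutoff T"
    note N = cutoff_bounds[of T, folded N_def]
    have PN: "prodset S \<le> N"
    proof -
      have "real (prodset S) \<le> T powr (3/2)" using PM el(5) unfolding P_def by linarith
      also have "\<dots> \<le> real N" using N el(9) by simp
      finally show ?thesis by simp
    qed
    have hP: "h * ln (real (prodset S)) \<le> 1"
    proof -
      have "ln P \<le> ln M" using P1 PM by (subst ln_le_cancel_iff) auto
      also have "\<dots> \<le> L" using el(6) by (simp add: M_def)
      finally show ?thesis using L1 by (simp add: h_def P_def)
    qed
    show ?case
    proof (intro allI impI, rule ccontr)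
      fix A H assume AH: "T / 4 \<le> A \<and> A + H + 1 \<le> 4 * T \<and> H \<ge> T powr (4/5)"
        and neg: "\<not> (\<exists>v\<in>{A..A+H}. norm (integral {v..v + 1 / ln T} (\<lambda>t. zeta (Complex (1/2) t))) > ln T ^ 12 / ln T)"
      have "T powr (4/5) > 0" using el(9) by simp
      hence H: "H > 0" using AH by linarith
      define z where "z = (\<lambda>t. zeta (Complex (1/2) t))"
      have cz: "continuous_on C z" for C unfolding z_def by (intro continuous_intros)
      define B where "B = L ^ 12 + 1 / 10"
      have B: "norm (window_mean h (zeta_partial_sum N) v) \<le> B" if v: "v \<in> {A..A+H}" for v
      proof -
        have iz: "z integrable_on {v..v+h}" and iS: "zeta_partial_sum N integrable_on {v..v+h}"
          by (intro integrable_continuous_real cz continuous_zeta_partial_sum)+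
        have b1: "norm (integral {v..v+h} z) \<le> h * L ^ 12"
          using neg v unfolding z_def h_def L_def by (auto simp: not_less)
        have "norm (integral {v..v+h} (\<lambda>t. zeta_partial_sum N t - z t)) \<le> 1/10 * (v + h - v)"
        proof (rule integral_bound)
          fix t assume t: "t \<in> {v..v+h}"
          have "t \<in> {T/4..4*T}" using t v AH h by auto
          thus "norm (zeta_partial_sum N t - z t) \<le> 1/10" using el(8) unfolding z_def N_def norm_minus_commute[of "zeta_partial_sum _ _"] by blast
        qed (use h in \<open>auto intro!: continuous_intros cz continuous_zeta_partial_sum\<close>)
        also have "integral {v..v+h} (\<lambda>t. zeta_partial_sum N t - z t) = integral {v..v+h} (zeta_partial_sum N) - integral {v..v+h} z"
          by (rule integral_diff[OF iS iz])
        finally have b2: "norm (integral {v..v+h} (zeta_partial_sum N) - integral {v..v+h} z) \<le> h * (1 / 10)" by simp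
        have "norm (integral {v..v+h} (zeta_partial_sum N)) \<le> norm (integral {v..v+h} (zeta_partial_sum N) - integral {v..v+h} z) + norm (integral {v..v+h} z)"
          by (rule norm_triangle_sub[of _ "integral {v..v+h} z", THEN order_trans]) simp
        also have "\<dots> \<le> h * (1 / 10) + h * L ^ 12" by (rule add_mono[OF b2 b1])
        finally have "norm (integral {v..v+h} (zeta_partial_sum N)) \<le> B * h" by (simp add: B_def algebra_simps)
        thus ?thesis unfolding window_mean_alt[OF continuous_zeta_partial_sum] norm_divide using h by (simp add: pos_divide_le_eq)
      qed
      have R: "H / 2 * (\<Prod>p\<in>S. 2 + real p powr (-1/2)) \<le> B * (H * 2 ^ r + 4 * P * 4 ^ r) + 8 * sqrt (real N) * P * 4 ^ r"
        unfolding P_def r_def by (rule resonance[OF S h(1) hP PN H B])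
      have t1: "4 * P * 4 ^ r \<le> H * 2 ^ r"
      proof -
        have "4 * (M * M) \<le> H" using el(3) AH unfolding M2 by linarith
        hence "4 * (M * M) * 2 ^ r \<le> H * 2 ^ r" by (intro mult_right_mono) auto
        thus ?thesis using r4 by linarith
      qed
      have t2: "8 * sqrt (real N) * P * 4 ^ r \<le> H * 2 ^ r"
      proof -
        have "8 * sqrt (real N) \<le> 16 * T powr (3/4)" using N(3) el(9) by simp
        hence "8 * sqrt (real N) * (P * 4 ^ r) \<le> 16 * T powr (3/4) * (M * M * 2 ^ r)"
          by (rule mult_mono[OF _ r4]) (use P1 in auto)
        also have "\<dots> = 16 * T powr (3/4) * (M * M) * 2 ^ r" by simp
        also have "\<dots> \<le> H * 2 ^ r" using el(4) AH unfolding M2 by (intro mult_right_mono) auto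
        finally show ?thesis by (simp only: mult.assoc)
      qed
      have B0: "B \<ge> 0" using L1 by (simp add: B_def)
      have "B * (H * 2 ^ r + 4 * P * 4 ^ r) \<le> B * (H * 2 ^ r + H * 2 ^ r)" using t1 B0 by (intro mult_left_mono) auto
      hence "H / 2 * (\<Prod>p\<in>S. 2 + real p powr (-1/2)) \<le> B * (H * 2 ^ r + H * 2 ^ r) + H * 2 ^ r" using R t2 by linarith
      also have "\<dots> = H / 2 * (2 ^ r * (4 * B + 2))" by (simp add: algebra_simps)
      finally have up: "(\<Prod>p\<in>S. 2 + real p powr (-1/2)) \<le> 2 ^ r * (4 * B + 2)"
        using H by (simp only: mult_le_cancel_left_pos half_gt_zero)
      define q where "q = y powr (-1/2)"
      have q: "0 < q" "q \<le> 1"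
      proof -
        show "0 < q" using y2 by (simp add: q_def)
        have "y powr (-1/2) \<le> y powr 0" using y2 by (intro powr_mono) auto
        thus "q \<le> 1" using y2 by (simp add: q_def)
      qed
      have "2 ^ r * exp (real r * (q / 4)) = (\<Prod>p\<in>S. 2 * exp (q / 4))"
        by (simp only: exp_of_nat_mult power_mult_distrib[symmetric] prod_constant r_def)
      also have "\<dots> \<le> (\<Prod>p\<in>S. 2 + real p powr (-1/2))"
      proof (intro prod_mono conjI)
        fix p assume p: "p \<in> S"
        have "exp (q / 4) \<le> 1 + q / 4 + (q / 4)\<^sup>2" using q by (intro exp_bound) auto
        also have "(q / 4)\<^sup>2 \<le> q / 4 * 1" unfolding power2_eq_square using q by (intro mult_left_mono) auto
        finally have "2 * exp (q / 4) \<le> 2 + q" by simp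
        also have "q \<le> real p powr (-1/2)"
          unfolding q_def using p prime_gt_0_nat by (intro powr_mono2') (auto simp: S_def)
        finally show "2 * exp (q / 4) \<le> 2 + real p powr (-1/2)" by simp
      qed auto
      also note up
      finally have "exp (real r * (q / 4)) \<le> 4 * B + 2" by (simp only: mult_le_cancel_left_pos zero_less_power zero_less_numeral)
      note exp_le = this
      have "4 * L ^ 12 + 3 < exp ((1 - 1/2) * (y / ln y) * (q / 4))" using el(2) by (simp only: q_def)
      also have "\<dots> \<le> exp (real r * (q / 4))"
        using el(1) q unfolding rpi exp_le_cancel_iff by (intro mult_right_mono) auto
      also note exp_le
      finally show False by (simp add: B_def)
    qed
  qed
qed

section \<open>The values of the product along the ladder\<close>

lemma has_real_derivative_integral:
  fixes f :: "real \<Rightarrow> real"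
  assumes "continuous_on UNIV f" "c < t"
  shows "((\<lambda>x. integral {c..x} f) has_real_derivative f t) (at t)"
proof -
  have "((\<lambda>x. integral {c..x} f) has_real_derivative f t) (at t within {c..t+1})"
    by (rule integral_has_real_derivative) (use assms continuous_on_subset in auto)
  thus ?thesis using assms(2) by (simp add: at_within_Icc_at)
qed

text \<open>
  The argument by change of variables described at the beginning, for an arbitrary increasing u with u' comparable to
  Z^2 / ln t. Changes of variables are carried out with the mean value theorem, applied to
  compositions of antiderivatives with u.
\<close>
lemma product_large_somewhere:
  "eventually (\<lambda>T. \<forall>u u' b. T + T powr (7/8) \<le> b \<longrightarrow> b \<le> 2 * T \<longrightarrow>
     (\<forall>t\<in>{T..b}. (u has_real_derivative u' t) (at t)) \<longrightarrow> strict_mono_on {T..b} u \<longrightarrow>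
     T / 4 \<le> u T \<longrightarrow> u b \<le> 2 * T \<longrightarrow>
     (\<forall>t\<in>{T..b}. (hardy_Z t)\<^sup>2 / (2 * ln t) \<le> u' t \<and> u' t \<le> 2 * (hardy_Z t)\<^sup>2 / ln t) \<longrightarrow>
     (\<exists>t\<in>{T<..<b}. ln T ^ 5 \<le> hardy_Z (u t) ^ 4 * (hardy_Z t)\<^sup>2)) at_top"
proof -
  have ev1: "eventually (\<lambda>T::real. (T powr (7/8) / (20 * ln T) - 1) * (25 / (80 * (ln T)\<^sup>2)) \<ge> T powr (4/5) + 1) at_top"
    by real_asymp
  have ev2: "eventually (\<lambda>T::real. ln T ^ 12 / ln T - 1 / ln T > 800 * ln T ^ 6) at_top" by real_asymp
  have ev3: "eventually (\<lambda>T::real. ln T \<ge> 1) at_top" by real_asymp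
  show ?thesis using ev1 ev2 ev3 local_second_moment_lower zeta_short_integral_large eventually_gt_at_top[of 3]
  proof eventually_elim
    case (elim T)
    show ?case
    proof (intro allI impI, rule ccontr)
      fix u u' :: "real \<Rightarrow> real" and b
      assume b: "T + T powr (7/8) \<le> b" "b \<le> 2 * T"
        and du: "\<forall>t\<in>{T..b}. (u has_real_derivative u' t) (at t)" and mu: "strict_mono_on {T..b} u"
        and uT: "T / 4 \<le> u T" and ub: "u b \<le> 2 * T"
        and u': "\<forall>t\<in>{T..b}. (hardy_Z t)\<^sup>2 / (2 * ln t) \<le> u' t \<and> u' t \<le> 2 * (hardy_Z t)\<^sup>2 / ln t"
        and neg: "\<not> (\<exists>t\<in>{T<..<b}. ln T ^ 5 \<le> hardy_Z (u t) ^ 4 * (hardy_Z t)\<^sup>2)"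
      define L where "L = ln T"
      define w where "w = window_length T"
      define h where "h = 1 / L"
      have L1: "L \<ge> 1" using elim(3) by (simp add: L_def)
      have T3: "T > 3" using elim(6) .
      have h: "h > 0" "h \<le> 1" using L1 by (auto simp: h_def)
      define n where "n = nat (10 * \<lceil>L\<rceil>)"
      have wn: "w = real n" using L1 by (simp add: w_def n_def window_length_def L_def)
      have w: "w \<ge> 10" "w \<le> 20 * L" using L1 unfolding w_def window_length_def L_def[symmetric] by linarith+
      have Tb: "T < b" using b T3 by (smt (verit) powr_gt_zero)
      have u_mono: "u s \<le> u t" if "T \<le> s" "s \<le> t" "t \<le> b" for s t
        using mu that by (cases "s = t") (auto simp: strict_mono_on_def intro!: less_imp_le)
      have lnt: "L \<le> ln t" "ln t \<le> 2 * L" if "t \<in> {T..b}" for t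
      proof -
        show "L \<le> ln t" unfolding L_def using that T3 by simp
        have "2 * T \<le> T * T" using T3 by (intro mult_right_mono) auto
        hence "t \<le> T * T" using that b by auto
        hence "ln t \<le> ln (T * T)" using that T3 by (subst ln_le_cancel_iff) auto
        also have "\<dots> = 2 * L" using T3 by (simp add: L_def ln_mult)
        finally show "ln t \<le> 2 * L" .
      qed
      (* k is a lower bound for the growth of u over one window of length w. *)
      define k where "k = 25 / w / (4 * L)"
      have k0: "k > 0" using w L1 by (simp add: k_def)

      have step: "u (t + w) - u t \<ge> k" if t: "T \<le> t" "t + w \<le> b" for t
      proof -
        define I where "I = (\<lambda>x. integral {T-1..x} (\<lambda>x. (hardy_Z x)\<^sup>2))"
        have cZ: "continuous_on C (\<lambda>x. (hardy_Z x)\<^sup>2)" for C by (intro continuous_intros continuous_on_hardy_Z)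
        have dI: "(I has_real_derivative (hardy_Z x)\<^sup>2) (at x)" if "x \<ge> T" for x
          unfolding I_def using that by (intro has_real_derivative_integral cZ) auto
        have "\<exists>z>t. z < t + w \<and> (u (t + w) - I (t + w) / (4 * L)) - (u t - I t / (4 * L)) = (t + w - t) * (u' z - (hardy_Z z)\<^sup>2 / (4 * L))"
        proof (rule MVT2)
          fix x assume x: "t \<le> x" "x \<le> t + w"
          have "(u has_real_derivative u' x) (at x)" using du x t by auto
          moreover have "(I has_real_derivative (hardy_Z x)\<^sup>2) (at x)" using x t by (intro dI) auto
          ultimately show "((\<lambda>x. u x - I x / (4 * L)) has_real_derivative (u' x - (hardy_Z x)\<^sup>2 / (4 * L))) (at x)"
            by (auto intro!: DERIV_diff DERIV_cdivide)
        qed (use w in simp)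
        then obtain z where z: "t < z" "z < t + w"
          "(u (t + w) - I (t + w) / (4 * L)) - (u t - I t / (4 * L)) = w * (u' z - (hardy_Z z)\<^sup>2 / (4 * L))" by auto
        have zT: "z \<in> {T..b}" using z t by auto
        have "(hardy_Z z)\<^sup>2 / (4 * L) \<le> (hardy_Z z)\<^sup>2 / (2 * ln z)"
          using lnt[OF zT] L1 by (intro divide_left_mono) auto
        also have "\<dots> \<le> u' z" using u' zT by blast
        finally have "w * (u' z - (hardy_Z z)\<^sup>2 / (4 * L)) \<ge> 0" using w by simp
        hence 1: "u (t + w) - u t \<ge> (I (t + w) - I t) / (4 * L)" using z(3) by (simp add: diff_divide_distrib)
        have "I (t + w) = I t + integral {t..t+w} (\<lambda>x. (hardy_Z x)\<^sup>2)"
          unfolding I_def using t w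
          by (intro Henstock_Kurzweil_Integration.integral_combine[symmetric] integrable_continuous_real cZ) auto
        moreover have "integral {t..t+w} (\<lambda>x. (hardy_Z x)\<^sup>2) \<ge> 25 / w"
          unfolding w_def by (rule elim(4)[rule_format]) (use t b T3 w_def in auto)
        ultimately have "(I (t + w) - I t) / (4 * L) \<ge> 25 / w / (4 * L)" using L1 by (intro divide_right_mono) auto
        thus ?thesis using 1 unfolding k_def by linarith
      qed
      have steps: "u (t + real m * w) - u t \<ge> real m * k" if "T \<le> t" "t + real m * w \<le> b" for t m
        using that(2)
      proof (induction m)
        case (Suc m)
        have e: "t + real (Suc m) * w = (t + real m * w) + w" by (simp add: algebra_simps)
        have mw: "real m * w \<ge> 0" using w by simp
        have "u ((t + real m * w) + w) - u (t + real m * w) \<ge> k"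
          using Suc.prems that(1) mw unfolding e by (intro step) auto
        moreover have "u (t + real m * w) - u t \<ge> real m * k"
          by (rule Suc.IH) (use Suc.prems w in \<open>unfold e, linarith\<close>)
        ultimately show ?case unfolding e by (simp add: algebra_simps)
      qed simp

      have big: "u b - u T \<ge> T powr (4/5) + 1"
      proof -
        define m where "m = nat \<lfloor>(b - T) / w\<rfloor>"
        have q0: "(b - T) / w \<ge> 0" using Tb w by simp
        have m: "real m \<le> (b - T) / w" "real m \<ge> (b - T) / w - 1" using q0 unfolding m_def by linarith+
        have "T powr (7/8) / (20 * L) \<le> (b - T) / w" using b w L1 Tb by (intro frac_le) auto
        hence "T powr (7/8) / (20 * L) - 1 \<le> real m" using m by linarith
        moreover have "25 / (80 * L\<^sup>2) \<le> k"
        proof -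
          have "w * (4 * L) \<le> 20 * L * (4 * L)" using w L1 by (intro mult_right_mono) auto
          also have "\<dots> = 80 * L\<^sup>2" by (simp add: power2_eq_square)
          finally have "25 / (80 * L\<^sup>2) \<le> 25 / (w * (4 * L))" using w L1 by (intro divide_left_mono) auto
          thus ?thesis by (simp add: k_def)
        qed
        ultimately have "(T powr (7/8) / (20 * L) - 1) * (25 / (80 * L\<^sup>2)) \<le> real m * k" using L1 by (intro mult_mono) auto
        hence "T powr (4/5) + 1 \<le> real m * k" using elim(1) unfolding L_def by linarith
        also have mb: "T + real m * w \<le> b" using m(1) w by (simp add: pos_le_divide_eq)
        have "real m * k \<le> u (T + real m * w) - u T" using mb by (intro steps) auto
        also have "\<dots> \<le> u b - u T" using mb w by (intro diff_right_mono u_mono) auto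
        finally show ?thesis .
      qed

      define z where "z = (\<lambda>t. zeta (Complex (1/2) t))"
      have cz: "continuous_on C z" for C unfolding z_def by (intro continuous_intros)
      have "\<exists>v\<in>{u T..u T + (u b - u T - h)}. norm (integral {v..v + 1 / ln T} (\<lambda>t. zeta (Complex (1/2) t))) > ln T ^ 12 / ln T"
        by (rule elim(5)[rule_format]) (use uT ub h big T3 in auto)
      then obtain v where v: "u T \<le> v" "v + h \<le> u b" "norm (integral {v..v+h} z) > L ^ 12 / L"
        by (auto simp: z_def h_def L_def)
      have cu: "continuous_on {T..b} u"
        by (rule DERIV_continuous_on[of _ _ u']) (use du in \<open>auto intro: has_field_derivative_at_within\<close>)
      obtain s1 where s1: "s1 \<in> {T..b}" "u s1 = v" using IVT'[of u T v b] v h cu Tb by auto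
      obtain s2 where s2: "s2 \<in> {T..b}" "u s2 = v + h" using IVT'[of u T "v + h" b] v h cu Tb by auto
      have s12: "s1 < s2"
      proof (rule ccontr)
        assume "\<not> s1 < s2"
        hence "u s2 \<le> u s1" using s1 s2 by (intro u_mono) auto
        thus False using s1 s2 h by simp
      qed
      (* Otherwise w windows (w is an integer) would fit between s1 and s2, and u would grow there by more than h. *)
      have len: "s2 - s1 \<le> 400 * L\<^sup>2"
      proof -
        have "s2 \<le> s1 + real n * w"
        proof (rule ccontr)
          assume "\<not> s2 \<le> s1 + real n * w"
          hence lt: "s1 + real n * w < s2" by simp
          have p: "real n * w \<ge> 0" using w by simp
          have "u (s1 + real n * w) < u s2"
            by (rule strict_mono_onD[OF mu _ _ lt]) (use s1 s2 lt p in auto)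
          moreover have "real n * k \<le> u (s1 + real n * w) - u s1" using s1 s2 lt by (intro steps) auto
          moreover have "real n * k \<ge> h"
          proof -
            have "real n * k = 25 / (4 * L)" using w unfolding wn[symmetric] by (simp add: k_def)
            also have "\<dots> \<ge> h" using L1 by (simp add: h_def field_simps)
            finally show ?thesis .
          qed
          ultimately show False using s1 s2 by simp
        qed
        hence "s2 - s1 \<le> w * w" unfolding wn by simp
        also have "\<dots> \<le> (20 * L) * (20 * L)" using w by (intro mult_mono) auto
        finally show ?thesis by (simp add: power2_eq_square)
      qed

      define Q where "Q = (\<lambda>x. integral {v-1..x} (\<lambda>x. hardy_Z x ^ 4))"
      have cZ4: "continuous_on C (\<lambda>x. hardy_Z x ^ 4)" for C by (intro continuous_intros continuous_on_hardy_Z)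
      have "\<exists>z>s1. z < s2 \<and> Q (u s2) - Q (u s1) = (s2 - s1) * (hardy_Z (u z) ^ 4 * u' z)"
      proof (rule MVT2[OF s12])
        fix x assume x: "s1 \<le> x" "x \<le> s2"
        have "u x \<ge> u s1" using x s1 s2 by (intro u_mono) auto
        hence "(Q has_real_derivative hardy_Z (u x) ^ 4) (at (u x))"
          unfolding Q_def using s1 by (intro has_real_derivative_integral cZ4) auto
        moreover have "(u has_real_derivative u' x) (at x)" using du x s1 s2 by auto
        ultimately show "((\<lambda>x. Q (u x)) has_real_derivative hardy_Z (u x) ^ 4 * u' x) (at x)" by (rule DERIV_chain2)
      qed
      then obtain x where x: "s1 < x" "x < s2" "Q (u s2) - Q (u s1) = (s2 - s1) * (hardy_Z (u x) ^ 4 * u' x)" by auto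
      have xT: "x \<in> {T<..<b}" using x s1 s2 by auto
      hence xT': "x \<in> {T..b}" by auto
      have "hardy_Z (u x) ^ 4 * u' x \<le> hardy_Z (u x) ^ 4 * (2 * (hardy_Z x)\<^sup>2 / ln x)"
        using u' xT' by (intro mult_left_mono) auto
      also have "\<dots> = 2 * (hardy_Z (u x) ^ 4 * (hardy_Z x)\<^sup>2) / ln x" by simp
      also have "\<dots> \<le> 2 * L ^ 5 / L"
      proof (rule frac_le)
        have "\<not> L ^ 5 \<le> hardy_Z (u x) ^ 4 * (hardy_Z x)\<^sup>2" using neg xT unfolding L_def by blast
        thus "2 * (hardy_Z (u x) ^ 4 * (hardy_Z x)\<^sup>2) \<le> 2 * L ^ 5" by simp
      qed (use lnt[OF xT'] L1 in auto)
      also have "\<dots> = 2 * L ^ 4" using L1 by (simp add: power_Suc[symmetric] eval_nat_numeral)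
      finally have ux: "hardy_Z (u x) ^ 4 * u' x \<le> 2 * L ^ 4" .
      have "Q (u s2) - Q (u s1) \<le> (s2 - s1) * (2 * L ^ 4)" unfolding x(3) using ux s12 by (intro mult_left_mono) auto
      also have "\<dots> \<le> 400 * L\<^sup>2 * (2 * L ^ 4)" using len L1 by (intro mult_right_mono) auto
      also have "\<dots> = 800 * L ^ 6" by (simp add: power_add[symmetric])
      finally have upQ: "Q (u s2) - Q (u s1) \<le> 800 * L ^ 6" .
      have "Q (v + h) = Q v + integral {v..v+h} (\<lambda>x. hardy_Z x ^ 4)"
        unfolding Q_def using h
        by (intro Henstock_Kurzweil_Integration.integral_combine[symmetric] integrable_continuous_real cZ4) auto
      hence Q4: "integral {v..v+h} (\<lambda>x. hardy_Z x ^ 4) \<le> 800 * L ^ 6" using upQ s1 s2 by simp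
      have "norm (integral {v..v+h} z) \<le> integral {v..v+h} (\<lambda>x. 1 + hardy_Z x ^ 4)"
      proof (rule integral_norm_bound_integral)
        show "norm (z x) \<le> 1 + hardy_Z x ^ 4" for x
        proof -
          have "norm (z x) = \<bar>hardy_Z x\<bar>" by (simp add: abs_hardy_Z z_def)
          also have "\<dots> \<le> 1 + \<bar>hardy_Z x\<bar> ^ 4"
          proof (cases "\<bar>hardy_Z x\<bar> \<le> 1")
            case False
            hence "\<bar>hardy_Z x\<bar> ^ 1 \<le> \<bar>hardy_Z x\<bar> ^ 4" by (intro power_increasing) auto
            thus ?thesis by simp
          qed (simp add: add_increasing2)
          also have "\<bar>hardy_Z x\<bar> ^ 4 = hardy_Z x ^ 4" by simp
          finally show ?thesis .
        qed
      qed (intro integrable_continuous_real continuous_intros cz cZ4)+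
      also have "\<dots> = h + integral {v..v+h} (\<lambda>x. hardy_Z x ^ 4)"
        using h by (subst integral_add) (auto intro!: integrable_continuous_real cZ4)
      finally have "L ^ 12 / L < h + 800 * L ^ 6" using v(3) Q4 by linarith
      thus False using elim(2) unfolding L_def[symmetric] h_def by linarith
    qed
  qed
qed

section \<open>Jacob's ladders\<close>

lemma jacobs_ladder_estimates:
  assumes ladder: "jacobs_ladder \<phi>" and c: "\<delta> > 0"
  shows "\<exists>T1 d. strict_mono_on {T1..} \<phi> \<and>
    (\<forall>t\<ge>T1. (\<phi> has_real_derivative d t) (at t) \<and>
       (hardy_Z t)\<^sup>2 / (2 * ln t) \<le> d t / 2 \<and> d t / 2 \<le> 2 * (hardy_Z t)\<^sup>2 / ln t \<and>
       \<bar>(t - \<phi> t / 2) - (1 - euler_mascheroni) * real (prime_pi t)\<bar> \<le> \<delta> * ((1 - euler_mascheroni) * real (prime_pi t)))"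
proof -
  have em: "euler_mascheroni < (1::real)" using euler_mascheroni_less_13_over_22 by simp
  have "(\<lambda>t. (t - \<phi> t / 2) - (1 - euler_mascheroni) * real (prime_pi t)) \<in> o[at_top](\<lambda>t. (1 - euler_mascheroni) * real (prime_pi t))"
    using ladder unfolding jacobs_ladder_def asymp_equiv_altdef by blast
  from landau_o.smallD[OF this c]
  have e1: "eventually (\<lambda>t. \<bar>(t - \<phi> t / 2) - (1 - euler_mascheroni) * real (prime_pi t)\<bar> \<le> \<delta> * ((1 - euler_mascheroni) * real (prime_pi t))) at_top"
    by eventually_elim (use em in \<open>simp add: abs_mult\<close>)
  obtain T0 d G r where J: "strict_mono_on {T0..} \<phi>" "\<forall>t\<ge>T0. (\<phi> has_real_derivative d t) (at t within {T0..})"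
    "\<forall>t\<ge>T0. (hardy_Z t)\<^sup>2 = G t * d t" "\<forall>t\<ge>T0. G t = 1/2 * (1 + r t) * ln t" "r \<in> O[at_top](\<lambda>t. ln (ln t) / ln t)"
    using ladder unfolding jacobs_ladder_def by blast
  have "(\<lambda>t::real. ln (ln t) / ln t) \<in> o[at_top](\<lambda>_. 1)" by real_asymp
  with J(5) have "r \<in> o[at_top](\<lambda>_. 1)" by (rule landau_o.big_small_trans)
  from landau_o.smallD[OF this, of "1/2"] have e2: "eventually (\<lambda>t. \<bar>r t\<bar> \<le> 1/2) at_top" by simp
  have "eventually (\<lambda>t. t \<ge> T0 + 3 \<and> \<bar>r t\<bar> \<le> 1/2 \<and>
     \<bar>(t - \<phi> t / 2) - (1 - euler_mascheroni) * real (prime_pi t)\<bar> \<le> \<delta> * ((1 - euler_mascheroni) * real (prime_pi t)) \<and> t \<ge> 3) at_top"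
    using e1 e2 eventually_ge_at_top[of "T0 + 3"] eventually_ge_at_top[of 3] by eventually_elim simp
  then obtain T1 where T1: "\<And>t. t \<ge> T1 \<Longrightarrow> t \<ge> T0 + 3 \<and> \<bar>r t\<bar> \<le> 1/2 \<and>
     \<bar>(t - \<phi> t / 2) - (1 - euler_mascheroni) * real (prime_pi t)\<bar> \<le> \<delta> * ((1 - euler_mascheroni) * real (prime_pi t)) \<and> t \<ge> 3"
    unfolding eventually_at_top_linorder by blast
  have "strict_mono_on {T1..} \<phi>" using J(1) T1[of T1] by (rule_tac monotone_on_subset) auto
  moreover have "(\<phi> has_real_derivative d t) (at t) \<and>
       (hardy_Z t)\<^sup>2 / (2 * ln t) \<le> d t / 2 \<and> d t / 2 \<le> 2 * (hardy_Z t)\<^sup>2 / ln t \<and>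
       \<bar>(t - \<phi> t / 2) - (1 - euler_mascheroni) * real (prime_pi t)\<bar> \<le> \<delta> * ((1 - euler_mascheroni) * real (prime_pi t))"
    if t: "t \<ge> T1" for t
  proof -
    note b = T1[OF t]
    have t0: "t \<ge> T0" "t \<in> interior {T0..}" using b by auto
    have "(\<phi> has_real_derivative d t) (at t)" using J(2) t0 at_within_interior[OF t0(2)] by metis
    moreover have l0: "ln t > 0" using b by simp
    have G: "G t = 1/2 * (1 + r t) * ln t" using J(4) t0 by blast
    have "1/2 * (1/2) * ln t \<le> G t" "G t \<le> 1/2 * 2 * ln t"
      unfolding G using b l0 by (intro mult_right_mono mult_left_mono; linarith)+
    hence G2: "ln t / 4 \<le> G t" "G t \<le> ln t" by simp_all
    have G0: "G t > 0" using G2 l0 by linarith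
    have d: "d t / 2 = (hardy_Z t)\<^sup>2 / (2 * G t)" using J(3) t0 G0 by simp
    have "(hardy_Z t)\<^sup>2 / (2 * ln t) \<le> d t / 2" unfolding d using G2 G0 by (intro divide_left_mono) auto
    moreover have "d t / 2 \<le> 2 * (hardy_Z t)\<^sup>2 / ln t"
    proof -
      have "d t / 2 \<le> (hardy_Z t)\<^sup>2 / (2 * (ln t / 4))" unfolding d using G2 l0 G0 by (intro divide_left_mono) auto
      thus ?thesis by (simp add: mult.commute)
    qed
    ultimately show ?thesis using b by blast
  qed
  ultimately show ?thesis by blast
qed

lemma ladder_value_attained:
  fixes a :: real
  assumes ladder: "jacobs_ladder \<phi>" and a: "7/8 < a" "a < 1"
  shows "eventually (\<lambda>T. \<exists>\<alpha>. \<alpha> \<in> {T<..<T + T powr a} \<and> \<phi> \<alpha> / 2 \<in> {\<phi> T / 2<..<\<phi> (T + T powr a) / 2} \<and>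
    hardy_Z (\<phi> \<alpha> / 2) ^ 4 * (hardy_Z \<alpha>)\<^sup>2 = 1 / (2 * pi\<^sup>2) * ln T ^ 5) at_top"
proof -
  have half: "(1/2 :: real) > 0" by simp
  obtain T1 d where mono: "strict_mono_on {T1..} \<phi>" and
    est: "\<forall>t\<ge>T1. (\<phi> has_real_derivative d t) (at t) \<and>
       (hardy_Z t)\<^sup>2 / (2 * ln t) \<le> d t / 2 \<and> d t / 2 \<le> 2 * (hardy_Z t)\<^sup>2 / ln t \<and>
       \<bar>(t - \<phi> t / 2) - (1 - euler_mascheroni) * real (prime_pi t)\<bar> \<le> 1/2 * ((1 - euler_mascheroni) * real (prime_pi t))"
    using jacobs_ladder_estimates[OF ladder half] by blast
  have em: "euler_mascheroni < (1::real)" "euler_mascheroni > (19/33::real)"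
    using euler_mascheroni_less_13_over_22 euler_mascheroni_gt_19_over_33 by simp_all
  have bounds: "t / 4 \<le> \<phi> t / 2" "\<phi> t / 2 \<le> t" if "t \<ge> T1" "t \<ge> 0" for t
  proof -
    define x where "x = (1 - euler_mascheroni) * real (prime_pi t)"
    (* Since 1 - c < 14/33, even the trivial bound for the number of primes keeps u(t) above t/4. *)
    have "x \<le> (14/33) * t" unfolding x_def using em prime_pi_le[OF that(2)] by (intro mult_mono) auto
    moreover have "x \<ge> 0" unfolding x_def using em by simp
    moreover have "\<bar>(t - \<phi> t / 2) - x\<bar> \<le> 1/2 * x" using est that unfolding x_def by blast
    ultimately show "t / 4 \<le> \<phi> t / 2" "\<phi> t / 2 \<le> t" using that(2) by linarith+
  qed
  have ev1: "eventually (\<lambda>T::real. T powr a \<le> T) at_top" using a by real_asymp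
  have ev2: "eventually (\<lambda>T::real. 2000 * T powr (3/4) \<le> T powr (7/8)) at_top" by real_asymp
  have ev3: "eventually (\<lambda>T::real. T powr (7/8) \<le> T powr a) at_top" using a by real_asymp
  show ?thesis
    using ev1 ev2 ev3 product_large_somewhere hardy_Z_has_zero eventually_ge_at_top[of T1] eventually_gt_at_top[of 3]
  proof eventually_elim
    case (elim T)
    define b where "b = T + T powr a"
    have b: "T + T powr (7/8) \<le> b" "b \<le> 2 * T" using elim by (auto simp: b_def)
    have Tb: "T < b" using elim(7) by (simp add: b_def)
    have mu: "strict_mono_on {T..b} (\<lambda>t. \<phi> t / 2)"
      using mono elim(6) unfolding strict_mono_on_def by auto
    have du: "((\<lambda>t. \<phi> t / 2) has_real_derivative d t / 2) (at t)" if "t \<in> {T..b}" for t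
      using est elim(6) that by (intro DERIV_cdivide) auto
    have "\<exists>t\<in>{T<..<b}. ln T ^ 5 \<le> hardy_Z (\<phi> t / 2) ^ 4 * (hardy_Z t)\<^sup>2"
    proof (rule elim(4)[rule_format, where u' = "\<lambda>t. d t / 2"])
      show "\<phi> b / 2 \<le> 2 * T" using bounds(2)[of b] b Tb elim by linarith
      show "T / 4 \<le> \<phi> T / 2" using bounds(1)[of T] elim by linarith
    qed (use b mu du est elim(6) in auto)
    then obtain t1 where t1: "t1 \<in> {T<..<b}" "ln T ^ 5 \<le> hardy_Z (\<phi> t1 / 2) ^ 4 * (hardy_Z t1)\<^sup>2" by blast
    have "\<exists>t\<in>{T<..<b}. hardy_Z t = 0" by (rule elim(5)[rule_format]) (use b elim in auto)
    then obtain t0 where t0: "t0 \<in> {T<..<b}" "hardy_Z t0 = 0" by blast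
    define F where "F = (\<lambda>t. hardy_Z (\<phi> t / 2) ^ 4 * (hardy_Z t)\<^sup>2)"
    define y where "y = 1 / (2 * pi\<^sup>2) * ln T ^ 5"
    have lT: "ln T ^ 5 \<ge> 0" using elim(7) by simp
    have pi1: "2 * pi\<^sup>2 \<ge> 1"
    proof -
      have "pi\<^sup>2 \<ge> 1" using pi_gt3 by (intro one_le_power) simp
      thus ?thesis by linarith
    qed
    have y: "0 \<le> y" "y \<le> ln T ^ 5"
    proof -
      show "0 \<le> y" using lT by (simp add: y_def)
      have "y \<le> 1 * ln T ^ 5" unfolding y_def using pi1 lT by (intro mult_right_mono) (auto simp: divide_le_eq)
      thus "y \<le> ln T ^ 5" by simp
    qed
    have F01: "F t0 \<le> y" "y \<le> F t1" using t0 t1 y by (auto simp: F_def)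
    have c\<phi>: "continuous_on {T..b} (\<lambda>t. \<phi> t / 2)"
      by (rule DERIV_continuous_on[of _ _ "\<lambda>t. d t / 2"]) (use du in \<open>auto intro: has_field_derivative_at_within\<close>)
    have cF: "continuous_on {T..b} F" unfolding F_def
      by (intro continuous_intros continuous_on_hardy_Z continuous_on_compose2[OF continuous_on_hardy_Z[of UNIV] c\<phi>]) auto
    have "\<exists>x. min t0 t1 \<le> x \<and> x \<le> max t0 t1 \<and> F x = y"
    proof (cases "t0 \<le> t1")
      case True
      have "continuous_on {t0..t1} F" by (rule continuous_on_subset[OF cF]) (use t0 t1 in auto)
      thus ?thesis using IVT'[of F t0 y t1] F01 True by auto
    next
      case False
      have "continuous_on {t1..t0} F" by (rule continuous_on_subset[OF cF]) (use t0 t1 in auto)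
      thus ?thesis using IVT2'[of F t0 y t1] F01 False by auto
    qed
    then obtain x where x: "min t0 t1 \<le> x" "x \<le> max t0 t1" "F x = y" by blast
    have xb: "x \<in> {T<..<b}" using x(1,2) t0 t1 by (auto simp: min_def max_def split: if_splits)
    moreover have "\<phi> x / 2 \<in> {\<phi> T / 2<..<\<phi> b / 2}" using mu xb unfolding strict_mono_on_def by auto
    ultimately show ?case using x(3) unfolding F_def y_def b_def by blast
  qed
qed

text \<open>
  With k = 1 - c, the loss (1 - \<delta>)^2 from the two asymptotic relations costs at most \<epsilon>
  of the constant for \<delta> = \<epsilon> / (2 k), and U costs another \<epsilon>.
\<close>
lemma ladder_separation:
  fixes a \<epsilon> :: real
  assumes ladder: "jacobs_ladder \<phi>" and a: "a < 1" and eps: "\<epsilon> > 0" "1 - euler_mascheroni - 2 * \<epsilon> > 0"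
  shows "eventually (\<lambda>T. T - \<phi> (T + T powr a) / 2 > (1 - euler_mascheroni - 2 * \<epsilon>) * (T / ln T)) at_top"
proof -
  define k where "k = (1 - euler_mascheroni :: real)"
  have k: "k > 0" "\<epsilon> < k" using eps by (auto simp: k_def)
  define \<delta> where "\<delta> = \<epsilon> / (2 * k)"
  have d: "\<delta> > 0" "\<delta> < 1" using eps k by (auto simp: \<delta>_def)
  have kd: "(1 - \<delta>) * (k * (1 - \<delta>)) \<ge> k - \<epsilon>"
  proof -
    have "(1 - \<delta>) * (k * (1 - \<delta>)) = k - 2 * k * \<delta> + k * \<delta>\<^sup>2" by (simp add: algebra_simps power2_eq_square)
    moreover have "2 * k * \<delta> = \<epsilon>" using k by (simp add: \<delta>_def)
    ultimately show ?thesis using k by simp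
  qed
  obtain T1 where est: "\<forall>t\<ge>T1. \<bar>(t - \<phi> t / 2) - k * real (prime_pi t)\<bar> \<le> \<delta> * (k * real (prime_pi t))"
    using jacobs_ladder_estimates[OF ladder d(1)] unfolding k_def by blast
  have ev1: "eventually (\<lambda>T::real. T powr a < \<epsilon> * (T / ln T)) at_top" using a eps by real_asymp
  show ?thesis using ev1 prime_pi_lower[OF d(1)] eventually_ge_at_top[of T1] eventually_gt_at_top[of 1]
  proof eventually_elim
    case (elim T)
    define b where "b = T + T powr a"
    have Tb: "T \<le> b" using elim by (simp add: b_def)
    have q: "T / ln T > 0" using elim(4) by simp
    have "(k - \<epsilon>) * (T / ln T) \<le> (1 - \<delta>) * (k * (1 - \<delta>)) * (T / ln T)" using kd q by (intro mult_right_mono) auto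
    also have "\<dots> = (1 - \<delta>) * k * ((1 - \<delta>) * (T / ln T))" by (simp only: mult_ac)
    also have "\<dots> \<le> (1 - \<delta>) * k * real (prime_pi b)"
    proof (intro mult_left_mono)
      have "real (prime_pi T) \<le> real (prime_pi b)" using prime_pi_mono[OF Tb] by simp
      thus "(1 - \<delta>) * (T / ln T) \<le> real (prime_pi b)" using elim(2) by linarith
    qed (use d k in auto)
    also have "\<dots> = k * real (prime_pi b) - \<delta> * (k * real (prime_pi b))" by (simp add: algebra_simps)
    also have "\<dots> \<le> b - \<phi> b / 2"
    proof -
      have "\<bar>(b - \<phi> b / 2) - k * real (prime_pi b)\<bar> \<le> \<delta> * (k * real (prime_pi b))" using est Tb elim(3) by auto
      thus ?thesis by linarith
    qed
    also have "\<dots> < T + \<epsilon> * (T / ln T) - \<phi> b / 2" using elim(1) by (simp add: b_def)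
    finally have lt: "(k - \<epsilon>) * (T / ln T) < T + \<epsilon> * (T / ln T) - \<phi> b / 2" .
    have "(1 - euler_mascheroni - 2 * \<epsilon>) * (T / ln T) = (k - \<epsilon>) * (T / ln T) - \<epsilon> * (T / ln T)"
      unfolding k_def by (simp only: left_diff_distrib[symmetric]) simp
    also have "\<dots> < T - \<phi> b / 2"
    proof -
      have "p - q < T - s" if "p < T + q - s" for p q s :: real using that by linarith
      from this[OF lt] show ?thesis .
    qed
    finally show ?case by (simp only: b_def)
  qed
qed

theorem mainTheorem2:
  fixes \<phi> :: "real \<Rightarrow> real" and \<epsilon> :: real and U :: "real \<Rightarrow> real"
  assumes ladder: "jacobs_ladder \<phi>"
    and eps_pos: "\<epsilon> > 0"
    and eps_small: "7/8 + 2 * \<epsilon> < 1" "1 - euler_mascheroni - 2 * \<epsilon> > 0"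
    and U: "\<And>T. U T = T powr (7/8 + 2 * \<epsilon>)"
  shows "(\<exists>\<alpha> :: real \<Rightarrow> real.
            (\<forall>\<^sub>F T in at_top.
               \<alpha> T \<in> {T <..< T + U T} \<and>
               \<phi> (\<alpha> T) / 2 \<in> {\<phi> T / 2 <..< \<phi> (T + U T) / 2}) \<and>
            (\<lambda>T. hardy_Z (\<phi> (\<alpha> T) / 2) ^ 4 * hardy_Z (\<alpha> T) ^ 2)
              \<sim>[at_top] (\<lambda>T. 1 / (2 * pi\<^sup>2) * ln T ^ 5)) \<and>
         (\<forall>\<^sub>F T in at_top.
            {T .. T + U T} \<inter> {\<phi> T / 2 .. \<phi> (T + U T) / 2} = {} \<and>
            setdist {T .. T + U T} {\<phi> T / 2 .. \<phi> (T + U T) / 2}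
              > (1 - euler_mascheroni - 2 * \<epsilon>) * (T / ln T)) \<and>
         filterlim (\<lambda>T. (1 - euler_mascheroni - 2 * \<epsilon>) * (T / ln T)) at_top at_top"
proof (intro conjI)
  define Q where "Q = (\<lambda>T x. x \<in> {T<..<T + U T} \<and> \<phi> x / 2 \<in> {\<phi> T / 2<..<\<phi> (T + U T) / 2} \<and>
    hardy_Z (\<phi> x / 2) ^ 4 * (hardy_Z x)\<^sup>2 = 1 / (2 * pi\<^sup>2) * ln T ^ 5)"
  have ex: "eventually (\<lambda>T. \<exists>x. Q T x) at_top"
    unfolding Q_def U by (rule ladder_value_attained[OF ladder]) (use eps_pos eps_small in auto)
  define \<alpha> where "\<alpha> = (\<lambda>T. SOME x. Q T x)"
  have al: "eventually (\<lambda>T. Q T (\<alpha> T)) at_top"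
    using ex unfolding \<alpha>_def by eventually_elim (rule someI_ex)
  show "\<exists>\<alpha> :: real \<Rightarrow> real.
            (\<forall>\<^sub>F T in at_top.
               \<alpha> T \<in> {T <..< T + U T} \<and>
               \<phi> (\<alpha> T) / 2 \<in> {\<phi> T / 2 <..< \<phi> (T + U T) / 2}) \<and>
            (\<lambda>T. hardy_Z (\<phi> (\<alpha> T) / 2) ^ 4 * hardy_Z (\<alpha> T) ^ 2)
              \<sim>[at_top] (\<lambda>T. 1 / (2 * pi\<^sup>2) * ln T ^ 5)"
  proof (intro exI[of _ \<alpha>] conjI)
    show "\<forall>\<^sub>F T in at_top. \<alpha> T \<in> {T <..< T + U T} \<and> \<phi> (\<alpha> T) / 2 \<in> {\<phi> T / 2 <..< \<phi> (T + U T) / 2}"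
      using al by eventually_elim (auto simp: Q_def)
    show "(\<lambda>T. hardy_Z (\<phi> (\<alpha> T) / 2) ^ 4 * hardy_Z (\<alpha> T) ^ 2) \<sim>[at_top] (\<lambda>T. 1 / (2 * pi\<^sup>2) * ln T ^ 5)"
      by (rule asymp_equiv_refl_ev) (use al in eventually_elim, simp add: Q_def)
  qed
  have sep: "eventually (\<lambda>T. T - \<phi> (T + U T) / 2 > (1 - euler_mascheroni - 2 * \<epsilon>) * (T / ln T)) at_top"
    unfolding U by (rule ladder_separation[OF ladder eps_small(1) eps_pos eps_small(2)])
  show "\<forall>\<^sub>F T in at_top.
            {T .. T + U T} \<inter> {\<phi> T / 2 .. \<phi> (T + U T) / 2} = {} \<and>
            setdist {T .. T + U T} {\<phi> T / 2 .. \<phi> (T + U T) / 2}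
              > (1 - euler_mascheroni - 2 * \<epsilon>) * (T / ln T)"
    using sep ex eventually_gt_at_top[of 1]
  proof eventually_elim
    case (elim T)
    have pos: "(1 - euler_mascheroni - 2 * \<epsilon>) * (T / ln T) > 0" using eps_small elim(3) by simp
    have U0: "U T \<ge> 0" by (simp add: U)
    have ne: "\<phi> T / 2 \<le> \<phi> (T + U T) / 2" using elim(2) by (auto simp: Q_def)
    have "T - \<phi> (T + U T) / 2 \<le> setdist {T .. T + U T} {\<phi> T / 2 .. \<phi> (T + U T) / 2}"
      by (rule le_setdistI) (use U0 ne in \<open>auto simp: dist_real_def\<close>)
    moreover have "{T .. T + U T} \<inter> {\<phi> T / 2 .. \<phi> (T + U T) / 2} = {}" using elim(1) pos by auto
    ultimately show ?case using elim(1) by linarith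
  qed
  show "filterlim (\<lambda>T. (1 - euler_mascheroni - 2 * \<epsilon>) * (T / ln T)) at_top at_top"
    using eps_small(2) by real_asymp
qed

end
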